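(* For a Frobenius Lie algebra $\mathfrak g$ with semisimple integral principal grading and principal multiplicities $h_j$, define $$\operatorname{Def}_{SL_2}(\mathfrak g)=\sum_{m\ge1}\max\{0,\,h_{m+1}-h_m\}.$$ This is the total negative coefficient mass of the virtual $SL_2$ character $\Theta_{\mathfrak g}(x)=\sum_{m\ge1}(h_m-h_{m+1})\chi_{2m-1}(x)$ (the sum of the absolute values of its negative coefficients), and it vanishes exactly when the Ooms multiplicities are unimodal. For every integer $L\ge1$, with $t=L+5$, the Frobenius parabolic $$\mathfrak g=\mathfrak q\bigl((2t^2+4r)\mid(t(t-1),\,t-1,\,2^{[r]},\,1,\,2^{[r]},\,t^2)\bigr)\subseteq\mathfrak{sl}_{2t^2+4r},\qquad r=t^2,$$ satisfies $$\operatorname{Def}_{SL_2}(\mathfrak g)\ge\frac{L(5L^2+43L+106)}{2}.$$ Hence the defect is unbounded along this family and grows at least cubically in $L$.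
   Context: All Lie algebras are finite-dimensional over $\mathbb C$. A Lie algebra $\mathfrak g$ is Frobenius if there is $F\in\mathfrak g^*$ whose Kirillov form $B_F(x,y)=F([x,y])$ is nondegenerate; the principal element $H=\widehat F$ is the unique element with $F([H,x])=F(x)$ for all $x\in\mathfrak g$. The principal grading is semisimple integral if $\operatorname{ad}H$ is semisimple with integral eigenvalues; then $\mathfrak g_j=\{x:[H,x]=jx\}$ and $h_j=\dim\mathfrak g_j$ are the principal (Ooms) multiplicities, which satisfy $h_{1-j}=h_j$. They are unimodal if $h_1\ge h_2\ge h_3\ge\cdots$. For the seaweeds below the grading is semisimple integral and the $h_j$ do not depend on $F$. The centered principal character is $\Theta_{\mathfrak g}(x)=\sum_jh_jx^{2j-1}$, and $\chi_n(x)=x^n+x^{n-2}+\cdots+x^{-n}$ is the character of the $SL_2$-module $\operatorname{Sym}^n(\mathbb C^2)$. For compositions $A,B$ of $n$ (cutting $1,\ldots,n$ into consecutive blocks), with $\alpha(i),\beta(i)$ the $A$-block and $B$-block containing $i$, the seaweed is $$\mathfrak q(A\mid B)=\mathfrak h\oplus\bigoplus_{i>j,\ \alpha(i)=\alpha(j)}\mathbb C E_{ij}\oplus\bigoplus_{i<j,\ \beta(i)=\beta(j)}\mathbb C E_{ij}\subseteq\mathfrak{sl}_n,$$ where $\mathfrak h$ is the trace-zero diagonal subalgebra. It is a parabolic when $A=(n)$. The notation $2^{[r]}$ means a list of $r$ parts equal to $2$. *)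

theory Defs
  imports
    Complex_Main
    "HOL-Library.Function_Algebras"
    "HOL-Library.Poly_Mapping"
    "HOL-Library.Landau_Symbols"
begin

section \<open>Virtual characters of \<open>SL\<^sub>2\<close>\<close>

text \<open>
  Integral Laurent polynomials are elements of the group ring \<^typ>\<open>int \<Rightarrow>\<^sub>0 int\<close>:
  \<open>Poly_Mapping.single k a\<close> stands for \<open>a x\<^sup>k\<close>, and multiplication is convolution.
\<close>

definition sym_char :: "nat \<Rightarrow> (int \<Rightarrow>\<^sub>0 int)" where
  "sym_char n = (\<Sum>k\<le>n. Poly_Mapping.single (int n - 2 * int k) 1)"

definition virtual_char :: "(nat \<Rightarrow>\<^sub>0 int) \<Rightarrow> (int \<Rightarrow>\<^sub>0 int)" where
  "virtual_char c = (\<Sum>n\<in>Poly_Mapping.keys c. of_int (Poly_Mapping.lookup c n) * sym_char n)"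

text \<open>
  The characters \<^term>\<open>sym_char n\<close> are linearly independent, so a virtual character determines
  its coefficients; the following descriptions are meaningful for virtual characters only.
\<close>

definition char_coeffs :: "(int \<Rightarrow>\<^sub>0 int) \<Rightarrow> (nat \<Rightarrow>\<^sub>0 int)" where
  "char_coeffs P = (THE c. virtual_char c = P)"

definition negative_mass :: "(int \<Rightarrow>\<^sub>0 int) \<Rightarrow> int" where
  "negative_mass P =
     (\<Sum>n | Poly_Mapping.lookup (char_coeffs P) n < 0. \<bar>Poly_Mapping.lookup (char_coeffs P) n\<bar>)"


section \<open>Frobenius Lie algebras\<close>

text \<open>
  The Lie algebra is a finite-dimensional subspace \<open>\<gg>\<close> of an ambient complex vector space; the
  bracket is constrained on \<open>\<gg>\<close> only.
\<close>

locale fin_dim_lie_algebra = vector_space scale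
  for scale :: "complex \<Rightarrow> 'a::ab_group_add \<Rightarrow> 'a" +
  fixes bracket :: "'a \<Rightarrow> 'a \<Rightarrow> 'a"
    and \<gg> :: "'a set"
  assumes finite_dimensional_subspace: "\<exists>B. finite B \<and> span B = \<gg>"
    and bracket_closed: "\<lbrakk>x \<in> \<gg>; y \<in> \<gg>\<rbrakk> \<Longrightarrow> bracket x y \<in> \<gg>"
    and bracket_add_left:
      "\<lbrakk>x \<in> \<gg>; y \<in> \<gg>; z \<in> \<gg>\<rbrakk> \<Longrightarrow> bracket (x + y) z = bracket x z + bracket y z"
    and bracket_add_right:
      "\<lbrakk>x \<in> \<gg>; y \<in> \<gg>; z \<in> \<gg>\<rbrakk> \<Longrightarrow> bracket x (y + z) = bracket x y + bracket x z"
    and bracket_scale_left: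
      "\<lbrakk>x \<in> \<gg>; y \<in> \<gg>\<rbrakk> \<Longrightarrow> bracket (scale c x) y = scale c (bracket x y)"
    and bracket_scale_right:
      "\<lbrakk>x \<in> \<gg>; y \<in> \<gg>\<rbrakk> \<Longrightarrow> bracket x (scale c y) = scale c (bracket x y)"
    and bracket_alternating: "x \<in> \<gg> \<Longrightarrow> bracket x x = 0"
    and jacobi: "\<lbrakk>x \<in> \<gg>; y \<in> \<gg>; z \<in> \<gg>\<rbrakk> \<Longrightarrow>
      bracket x (bracket y z) + bracket y (bracket z x) + bracket z (bracket x y) = 0"
begin

definition dual :: "('a \<Rightarrow> complex) set" where
  "dual = {F. (\<forall>x\<in>\<gg>. \<forall>y\<in>\<gg>. F (x + y) = F x + F y) \<and> (\<forall>c. \<forall>x\<in>\<gg>. F (scale c x) = c * F x)}"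

definition kirillov :: "('a \<Rightarrow> complex) \<Rightarrow> 'a \<Rightarrow> 'a \<Rightarrow> complex" where
  "kirillov F x y = F (bracket x y)"

definition frobenius_functional :: "('a \<Rightarrow> complex) \<Rightarrow> bool" where
  "frobenius_functional F \<longleftrightarrow>
     F \<in> dual \<and> (\<forall>x\<in>\<gg>. (\<forall>y\<in>\<gg>. kirillov F x y = 0) \<longrightarrow> x = 0)"

definition frobenius :: bool where
  "frobenius \<longleftrightarrow> (\<exists>F. frobenius_functional F)"

definition principal_element :: "('a \<Rightarrow> complex) \<Rightarrow> 'a" where
  "principal_element F = (THE H. H \<in> \<gg> \<and> (\<forall>x\<in>\<gg>. F (bracket H x) = F x))"

definition ad_eigenspace :: "'a \<Rightarrow> complex \<Rightarrow> 'a set" where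
  "ad_eigenspace H c = {x \<in> \<gg>. bracket H x = scale c x}"

text \<open>Over the complex numbers, semisimple operators are the diagonalizable ones.\<close>

definition ad_semisimple :: "'a \<Rightarrow> bool" where
  "ad_semisimple H \<longleftrightarrow> span (\<Union>c. ad_eigenspace H c) = \<gg>"

definition semisimple_integral_grading :: "('a \<Rightarrow> complex) \<Rightarrow> bool" where
  "semisimple_integral_grading F \<longleftrightarrow>
     ad_semisimple (principal_element F) \<and>
     (\<forall>c. ad_eigenspace (principal_element F) c \<noteq> {0} \<longrightarrow> c \<in> \<int>)"

definition principal_mult :: "('a \<Rightarrow> complex) \<Rightarrow> int \<Rightarrow> nat" where
  "principal_mult F j = dim (ad_eigenspace (principal_element F) (of_int j))"

definition unimodal :: "('a \<Rightarrow> complex) \<Rightarrow> bool" where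
  "unimodal F \<longleftrightarrow> (\<forall>m\<ge>1. principal_mult F (m + 1) \<le> principal_mult F m)"

definition centered_principal_char :: "('a \<Rightarrow> complex) \<Rightarrow> (int \<Rightarrow>\<^sub>0 int)" where
  "centered_principal_char F =
     Sum_any (\<lambda>j. Poly_Mapping.single (2 * j - 1) (int (principal_mult F j)))"

text \<open>Only finitely many multiplicities are nonzero, so the sum has finite support.\<close>

definition sl2_defect :: "('a \<Rightarrow> complex) \<Rightarrow> int" where
  "sl2_defect F = Sum_any (\<lambda>m::nat. if m \<ge> 1
     then max 0 (int (principal_mult F (int m + 1)) - int (principal_mult F (int m))) else 0)"

end


section \<open>Seaweed subalgebras of \<open>\<ss>\<ll>\<^sub>n\<close>\<close>

text \<open>
  An \<open>n \<times> n\<close> matrix is a function of type \<^typ>\<open>nat \<Rightarrow> nat \<Rightarrow> complex\<close> that vanishes outside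
  \<open>{1..n} \<times> {1..n}\<close>; addition is pointwise.
\<close>

definition mat_scale :: "complex \<Rightarrow> (nat \<Rightarrow> nat \<Rightarrow> complex) \<Rightarrow> nat \<Rightarrow> nat \<Rightarrow> complex" where
  "mat_scale c X = (\<lambda>i j. c * X i j)"

interpretation mat: vector_space mat_scale
  by unfold_locales (simp_all add: mat_scale_def fun_eq_iff algebra_simps)

definition mat_mult ::
  "nat \<Rightarrow> (nat \<Rightarrow> nat \<Rightarrow> complex) \<Rightarrow> (nat \<Rightarrow> nat \<Rightarrow> complex) \<Rightarrow> nat \<Rightarrow> nat \<Rightarrow> complex" where
  "mat_mult n X Y = (\<lambda>i j. \<Sum>k\<in>{1..n}. X i k * Y k j)"

definition commutator ::
  "nat \<Rightarrow> (nat \<Rightarrow> nat \<Rightarrow> complex) \<Rightarrow> (nat \<Rightarrow> nat \<Rightarrow> complex) \<Rightarrow> nat \<Rightarrow> nat \<Rightarrow> complex" where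
  "commutator n X Y = mat_mult n X Y - mat_mult n Y X"

definition matrix_unit :: "nat \<Rightarrow> nat \<Rightarrow> nat \<Rightarrow> nat \<Rightarrow> complex" where
  "matrix_unit i j = (\<lambda>k l. if k = i \<and> l = j then 1 else 0)"

definition traceless_diagonal :: "nat \<Rightarrow> (nat \<Rightarrow> nat \<Rightarrow> complex) set" where
  "traceless_diagonal n =
     {X. (\<forall>i j. X i j \<noteq> 0 \<longrightarrow> i = j \<and> i \<in> {1..n}) \<and> (\<Sum>i\<in>{1..n}. X i i) = 0}"

text \<open>The number (counted from 0) of the block of a composition that contains \<open>i \<ge> 1\<close>.\<close>

fun block_index :: "nat list \<Rightarrow> nat \<Rightarrow> nat" where
  "block_index [] i = 0"
| "block_index (a # A) i = (if i \<le> a then 0 else Suc (block_index A (i - a)))"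

definition composition :: "nat \<Rightarrow> nat list \<Rightarrow> bool" where
  "composition n A \<longleftrightarrow> sum_list A = n \<and> (\<forall>a\<in>set A. a \<ge> 1)"

text \<open>Meant for compositions \<open>A\<close> and \<open>B\<close> of \<open>n\<close>.\<close>

definition seaweed :: "nat \<Rightarrow> nat list \<Rightarrow> nat list \<Rightarrow> (nat \<Rightarrow> nat \<Rightarrow> complex) set" where
  "seaweed n A B = mat.span
     (traceless_diagonal n
      \<union> {matrix_unit i j | i j. i \<in> {1..n} \<and> j \<in> {1..n} \<and> i > j \<and> block_index A i = block_index A j}
      \<union> {matrix_unit i j | i j. i \<in> {1..n} \<and> j \<in> {1..n} \<and> i < j \<and> block_index B i = block_index B j})"

abbreviation seaweed_lie_algebra :: "nat \<Rightarrow> nat list \<Rightarrow> nat list \<Rightarrow> bool" where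
  "seaweed_lie_algebra n A B \<equiv> fin_dim_lie_algebra mat_scale (commutator n) (seaweed n A B)"

abbreviation seaweed_frobenius :: "nat \<Rightarrow> nat list \<Rightarrow> nat list \<Rightarrow> bool" where
  "seaweed_frobenius n A B \<equiv>
     fin_dim_lie_algebra.frobenius mat_scale (commutator n) (seaweed n A B)"

abbreviation seaweed_frobenius_functional ::
  "nat \<Rightarrow> nat list \<Rightarrow> nat list \<Rightarrow> ((nat \<Rightarrow> nat \<Rightarrow> complex) \<Rightarrow> complex) \<Rightarrow> bool" where
  "seaweed_frobenius_functional n A B \<equiv>
     fin_dim_lie_algebra.frobenius_functional mat_scale (commutator n) (seaweed n A B)"

abbreviation seaweed_semisimple_integral_grading ::
  "nat \<Rightarrow> nat list \<Rightarrow> nat list \<Rightarrow> ((nat \<Rightarrow> nat \<Rightarrow> complex) \<Rightarrow> complex) \<Rightarrow> bool" where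
  "seaweed_semisimple_integral_grading n A B \<equiv>
     fin_dim_lie_algebra.semisimple_integral_grading mat_scale (commutator n) (seaweed n A B)"

abbreviation seaweed_principal_mult ::
  "nat \<Rightarrow> nat list \<Rightarrow> nat list \<Rightarrow> ((nat \<Rightarrow> nat \<Rightarrow> complex) \<Rightarrow> complex) \<Rightarrow> int \<Rightarrow> nat" where
  "seaweed_principal_mult n A B \<equiv>
     fin_dim_lie_algebra.principal_mult mat_scale (commutator n) (seaweed n A B)"

abbreviation seaweed_sl2_defect ::
  "nat \<Rightarrow> nat list \<Rightarrow> nat list \<Rightarrow> ((nat \<Rightarrow> nat \<Rightarrow> complex) \<Rightarrow> complex) \<Rightarrow> int" where
  "seaweed_sl2_defect n A B \<equiv>
     fin_dim_lie_algebra.sl2_defect mat_scale (commutator n) (seaweed n A B)"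

definition family_size :: "nat \<Rightarrow> nat" where
  "family_size L = (let t = L + 5; r = t^2 in 2 * t^2 + 4 * r)"

definition family_composition :: "nat \<Rightarrow> nat list" where
  "family_composition L = (let t = L + 5; r = t^2 in
     [t * (t - 1), t - 1] @ replicate r 2 @ [1] @ replicate r 2 @ [t^2])"

end

theory Submission
  imports
    Defs
    "Jordan_Normal_Form.Determinant"
    "HOL-Complex_Analysis.Cauchy_Integral_Formula"
begin

text \<open>
  The statement about an arbitrary Frobenius algebra is formal. The Kirillov form pairs the eigenspaces
  of \<open>ad H\<close> for \<open>j\<close> and \<open>1 - j\<close> perfectly (\<open>eigenspace_pairing\<close>, \<open>eigenspace_dim_le\<close>), so
  \<open>h\<^sub>1\<^sub>-\<^sub>j = h\<^sub>j\<close> and the monomials of \<open>\<Theta>\<close> come in pairs \<open>x\<^sup>2\<^sup>m\<^sup>-\<^sup>1 + x\<^sup>1\<^sup>-\<^sup>2\<^sup>m\<close>. Summation by parts rewrites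
  \<open>\<Theta>\<close> in irreducible characters, and a virtual character determines its coefficients because the
  entries of the Laurent polynomial in degrees \<open>k\<close> and \<open>k + 2\<close> differ by one of them
  (\<open>virtual_char_coefficient\<close>).

  The family needs a statement about every Frobenius functional, and \<open>principal_spectrum_unique\<close>
  reduces it to a single one. Join two Frobenius functionals by the complex line
  \<open>F\<^sub>s = F\<^sub>0 + s (F\<^sub>1 - F\<^sub>0)\<close>. Except at finitely many \<open>s\<close>, the functional \<open>F\<^sub>s\<close> is Frobenius and its
  principal element \<open>H\<^sub>s\<close> is holomorphic in \<open>s\<close>. Differentiating \<open>F\<^sub>s [H\<^sub>s, x] = F\<^sub>s x\<close> gives
  \<open>H\<^sub>s' = [H\<^sub>s, y\<^sub>s]\<close>, where \<open>y\<^sub>s\<close> represents \<open>F\<^sub>1 - F\<^sub>0\<close> by the Kirillov form of \<open>F\<^sub>s\<close>. So \<open>ad H\<^sub>s\<close>, and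
  every polynomial in it, satisfies a Lax equation; its solutions have constant trace, and a solution
  that vanishes at one point vanishes everywhere. Hence a polynomial with simple roots that
  annihilates \<open>ad H\<^sub>0\<close> annihilates \<open>ad H\<^sub>1\<close>, and the multiplicities, being traces, agree.

  For a seaweed take the sum of the matrix entries at the arcs of the meander. The radical of its
  Kirillov form is the solution space of a sparse linear system (\<open>meander_kernel\<close>), and \<open>rigid\<close> says
  that only scalar matrices solve it. If the last bottom block has \<open>b\<close> vertices and the last top
  block at least \<open>2 b\<close>, the system can be solved on the last \<open>b\<close> vertices, which leaves the system of
  a smaller pair of compositions (\<open>rigid_reduce\<close>). With transposition and reversal of matrices this
  reduces the family to a single vertex (\<open>rigid_family\<close>).

  An integer function \<open>d\<close> on the vertices that changes by one along each arc gives the principal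
  element: the diagonal matrix \<open>d\<close> minus its mean. So \<open>h\<^sub>m\<close> counts the positions of the seaweed with
  \<open>d\<^sub>i - d\<^sub>j = m\<close>. Two distinct vertices of a common block are a position in exactly one order, whence
  \<open>h\<^sub>m + h\<^sub>-\<^sub>m\<close>, which is \<open>h\<^sub>m + h\<^sub>m\<^sub>+\<^sub>1\<close> by the symmetry, is a count of pairs inside blocks
  (\<open>principal_mult_recurrence\<close>). The count sees only how often each value of \<open>d\<close> occurs in a block, not
  the arrangement of the values.

  In the family, the first \<open>t\<^sup>2\<close> vertices form \<open>t\<close> rows of length \<open>t\<close>. The values of \<open>d\<close> on a row are
  \<open>t\<close> consecutive integers, and the rows start at \<open>t\<close> consecutive integers, so a value \<open>- x\<close> occurs as
  often as \<open>x\<close> is a sum of two numbers below \<open>t\<close>. On the long runs of blocks of size two, \<open>d\<close> takes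
  only the values \<open>-1, 0, 1\<close>. The pair counts become polynomials in \<open>m\<close>, and the recurrence, started at
  \<open>h\<^sub>0 = h\<^sub>1\<close>, yields a cubic formula for \<open>h\<^sub>m\<close> with \<open>3 \<le> m \<le> t - 2\<close> (\<open>ooms_mult_poly\<close>). On this range
  the multiplicities rise by exactly \<open>L (5 L\<^sup>2 + 43 L + 106) / 2\<close>, and the defect is at least the rise.
\<close>

section \<open>Linear algebra on a Lie algebra\<close>

context fin_dim_lie_algebra begin

lemma subspace_algebra: "subspace \<gg>"
  using finite_dimensional_subspace by (auto simp: subspace_span)

lemma mem_algebra [simp]: "0 \<in> \<gg>" and mem_add: "x \<in> \<gg> \<Longrightarrow> y \<in> \<gg> \<Longrightarrow> x + y \<in> \<gg>"
  and mem_scale: "x \<in> \<gg> \<Longrightarrow> scale c x \<in> \<gg>" and mem_diff: "x \<in> \<gg> \<Longrightarrow> y \<in> \<gg> \<Longrightarrow> x - y \<in> \<gg>"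
  and mem_neg: "x \<in> \<gg> \<Longrightarrow> - x \<in> \<gg>"
  using subspace_algebra subspace_0 subspace_add subspace_scale subspace_diff subspace_neg by auto

lemma mem_sum: "(\<And>i. i \<in> I \<Longrightarrow> f i \<in> \<gg>) \<Longrightarrow> sum f I \<in> \<gg>"
  using subspace_sum[OF subspace_algebra] by auto

text \<open>
  Values outside \<open>\<gg>\<close> are arbitrary, as for the members of \<^const>\<open>fin_dim_lie_algebra.dual\<close>; the same
  convention applies to operators.
\<close>

definition linear_functional :: "('a \<Rightarrow> complex) \<Rightarrow> bool" where
  "linear_functional f \<longleftrightarrow> (\<forall>x\<in>\<gg>. \<forall>y\<in>\<gg>. f (x + y) = f x + f y) \<and> (\<forall>c. \<forall>x\<in>\<gg>. f (scale c x) = c * f x)"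

lemma dual_eq: "dual = {F. linear_functional F}"
  by (auto simp: dual_def linear_functional_def)

definition linear_operator :: "('a \<Rightarrow> 'a) \<Rightarrow> bool" where
  "linear_operator T \<longleftrightarrow> (\<forall>x\<in>\<gg>. T x \<in> \<gg>) \<and> (\<forall>x\<in>\<gg>. \<forall>y\<in>\<gg>. T (x + y) = T x + T y) \<and>
     (\<forall>c. \<forall>x\<in>\<gg>. T (scale c x) = scale c (T x))"

lemma functional_add: "linear_functional f \<Longrightarrow> x \<in> \<gg> \<Longrightarrow> y \<in> \<gg> \<Longrightarrow> f (x + y) = f x + f y"
  and functional_scale: "linear_functional f \<Longrightarrow> x \<in> \<gg> \<Longrightarrow> f (scale c x) = c * f x"
  by (auto simp: linear_functional_def)

lemma functional_0: "linear_functional f \<Longrightarrow> f 0 = 0"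
  using functional_scale[of f 0 0] by simp

lemma functional_neg: "linear_functional f \<Longrightarrow> x \<in> \<gg> \<Longrightarrow> f (- x) = - f x"
  using functional_scale[of f x "-1"] by simp

lemma functional_diff: "linear_functional f \<Longrightarrow> x \<in> \<gg> \<Longrightarrow> y \<in> \<gg> \<Longrightarrow> f (x - y) = f x - f y"
  using functional_add[of f x "- y"] functional_neg[of f y] mem_neg by simp

lemma functional_sum:
  "linear_functional f \<Longrightarrow> (\<And>i. i \<in> I \<Longrightarrow> g i \<in> \<gg>) \<Longrightarrow> f (\<Sum>i\<in>I. g i) = (\<Sum>i\<in>I. f (g i))"
  by (induction I rule: infinite_finite_induct) (auto simp: functional_0 functional_add mem_sum)

lemma operator_mem: "linear_operator T \<Longrightarrow> x \<in> \<gg> \<Longrightarrow> T x \<in> \<gg>"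
  and operator_add: "linear_operator T \<Longrightarrow> x \<in> \<gg> \<Longrightarrow> y \<in> \<gg> \<Longrightarrow> T (x + y) = T x + T y"
  and operator_scale: "linear_operator T \<Longrightarrow> x \<in> \<gg> \<Longrightarrow> T (scale c x) = scale c (T x)"
  by (auto simp: linear_operator_def)

lemma operator_0: "linear_operator T \<Longrightarrow> T 0 = 0"
  using operator_scale[of T 0 0] by simp

lemma operator_diff: "linear_operator T \<Longrightarrow> x \<in> \<gg> \<Longrightarrow> y \<in> \<gg> \<Longrightarrow> T (x - y) = T x - T y"
  using operator_add[of T x "- y"] operator_scale[of T y "-1"] mem_neg by simp

lemma operator_sum:
  "linear_operator T \<Longrightarrow> (\<And>i. i \<in> I \<Longrightarrow> g i \<in> \<gg>) \<Longrightarrow> T (\<Sum>i\<in>I. g i) = (\<Sum>i\<in>I. T (g i))"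
  by (induction I rule: infinite_finite_induct) (auto simp: operator_0 operator_add mem_sum)

lemma linear_operator_ad: "x \<in> \<gg> \<Longrightarrow> linear_operator (bracket x)"
  using bracket_closed bracket_add_right bracket_scale_right by (auto simp: linear_operator_def)

lemma bracket_antisym: assumes "x \<in> \<gg>" "y \<in> \<gg>" shows "bracket x y = - bracket y x"
proof -
  have "bracket (x + y) (x + y) = (bracket x x + bracket x y) + (bracket y x + bracket y y)"
    using assms bracket_add_right[of "x + y" x y] bracket_add_left[of x y x] bracket_add_left[of x y y]
    by (simp add: mem_add algebra_simps)
  then have "bracket x y + bracket y x = 0"
    using assms mem_add by (simp add: bracket_alternating)
  then show ?thesis by (simp add: eq_neg_iff_add_eq_0)
qed

lemma linear_functional_bracket_left:
  assumes "linear_functional f" "y \<in> \<gg>" shows "linear_functional (\<lambda>x. f (bracket x y))"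
  using assms by (auto simp: linear_functional_def bracket_add_left bracket_scale_left bracket_closed)

lemma linear_functional_bracket_right:
  assumes "linear_functional f" "x \<in> \<gg>" shows "linear_functional (\<lambda>y. f (bracket x y))"
  using assms by (auto simp: linear_functional_def bracket_add_right bracket_scale_right bracket_closed)

lemma subspace_finite_basis:
  assumes "subspace V" "V \<subseteq> \<gg>"
  obtains B where "finite B" "independent B" "span B = V" "card B = dim V"
proof -
  obtain B where B: "B \<subseteq> V" "independent B" "V \<subseteq> span B" "card B = dim V"
    using basis_exists by blast
  obtain G where G: "finite G" "span G = \<gg>" using finite_dimensional_subspace by blast
  have "finite B" using independent_span_bound[OF G(1) B(2)] B(1) assms(2) G(2) by auto
  moreover have "span B = V" using B(1,3) assms(1) span_minimal by blast
  ultimately show thesis using that B by blast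
qed

text \<open>
  Each functional cuts the dimension by at most one, and the common kernel is zero.
\<close>

lemma dim_le_functionals:
  assumes "finite K" "\<And>k. k \<in> K \<Longrightarrow> linear_functional (\<phi> k)" "subspace V" "V \<subseteq> \<gg>"
    "\<And>x. x \<in> V \<Longrightarrow> (\<And>k. k \<in> K \<Longrightarrow> \<phi> k x = 0) \<Longrightarrow> x = 0"
  shows "dim V \<le> card K"
  using assms
proof (induction K arbitrary: V rule: finite_induct)
  case empty
  then have "V \<subseteq> {0}" by auto
  then show ?case using dim_le_card[of V "{}"] by simp
next
  case (insert k K)
  have lin: "linear_functional (\<phi> k)" using insert.prems by auto
  define W where "W = {x \<in> V. \<phi> k x = 0}"
  have V0: "0 \<in> V" "\<And>x y. x \<in> V \<Longrightarrow> y \<in> V \<Longrightarrow> x + y \<in> V" "\<And>c x. x \<in> V \<Longrightarrow> scale c x \<in> V"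
    using insert.prems(2) by (auto simp: subspace_def)
  have Vg: "\<And>x. x \<in> V \<Longrightarrow> x \<in> \<gg>" using insert.prems(3) by auto
  have W: "subspace W" "W \<subseteq> \<gg>"
    using V0 Vg functional_0[OF lin] functional_add[OF lin] functional_scale[OF lin]
    by (auto simp: W_def intro!: subspaceI)
  have "dim W \<le> card K"
    using insert.prems(1,4) W by (intro insert.IH) (auto simp: W_def)
  moreover have "dim V \<le> Suc (dim W)"
  proof (cases "\<exists>v\<in>V. \<phi> k v \<noteq> 0")
    case True
    then obtain v where v: "v \<in> V" "\<phi> k v \<noteq> 0" by auto
    obtain B where B: "finite B" "independent B" "span B = W" "card B = dim W"
      using subspace_finite_basis[OF W] by blast
    have "V \<subseteq> span (insert v B)"
    proof
      fix x assume x: "x \<in> V"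
      let ?y = "x - scale (\<phi> k x / \<phi> k v) v"
      have "\<phi> k ?y = 0"
        using x v Vg lin by (simp add: functional_diff functional_scale mem_scale)
      moreover have "?y \<in> V" using subspace_diff[OF insert.prems(2)] x v V0 by blast
      ultimately have "?y \<in> span B" using B by (simp add: W_def)
      then have "?y \<in> span (insert v B)" using span_mono[of B "insert v B"] by auto
      then have "?y + scale (\<phi> k x / \<phi> k v) v \<in> span (insert v B)"
        by (rule span_add[OF _ span_scale[OF span_base]]) simp
      then show "x \<in> span (insert v B)" by simp
    qed
    then have "dim V \<le> card (insert v B)" using B(1) by (intro dim_le_card) auto
    also have "\<dots> \<le> Suc (card B)" using B(1) by (simp add: card_insert_if)
    finally show ?thesis using B(4) by simp
  next
    case False
    then have "V = W" by (auto simp: W_def)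
    then show ?thesis by simp
  qed
  ultimately show ?case using insert.hyps by simp
qed

text \<open>
  The basis is enumerated by natural numbers so that linear maps become matrices of a fixed size; the
  functions \<open>\<rho> i\<close> are the coordinates.
\<close>

definition coordinate_system :: "nat \<Rightarrow> (nat \<Rightarrow> 'a) \<Rightarrow> (nat \<Rightarrow> 'a \<Rightarrow> complex) \<Rightarrow> bool" where
  "coordinate_system N b \<rho> \<longleftrightarrow> (\<forall>i<N. b i \<in> \<gg>) \<and> (\<forall>i<N. linear_functional (\<rho> i)) \<and>
     (\<forall>x\<in>\<gg>. x = (\<Sum>i<N. scale (\<rho> i x) (b i))) \<and> (\<forall>i<N. \<forall>j<N. \<rho> i (b j) = (if i = j then 1 else 0))"

lemma coordinate_system_exists: obtains N b \<rho> where "coordinate_system N b \<rho>"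
proof -
  obtain B where B: "finite B" "independent B" "span B = \<gg>"
    using subspace_finite_basis[OF subspace_algebra] by blast
  obtain b where b: "bij_betw b {..<card B} B"
    using ex_bij_betw_nat_finite[OF B(1)] by (auto simp: atLeast0LessThan)
  define \<rho> where "\<rho> i x = representation B x (b i)" for i x
  have bB: "b i \<in> B" if "i < card B" for i using b that by (auto simp: bij_betw_def)
  have inj: "b i = b j \<longleftrightarrow> i = j" if "i < card B" "j < card B" for i j
    using b that by (auto simp: bij_betw_def inj_on_def)
  have exp: "x = (\<Sum>i<card B. scale (\<rho> i x) (b i))" if "x \<in> \<gg>" for x
  proof -
    have "(\<Sum>v\<in>B. scale (representation B x v) v) = x"
      using sum_representation_eq[OF B(2) _ B(1)] that B(3) by auto
    moreover have "(\<Sum>v\<in>B. scale (representation B x v) v) = (\<Sum>i<card B. scale (\<rho> i x) (b i))"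
      unfolding \<rho>_def by (rule sum.reindex_bij_betw[OF b, symmetric])
    ultimately show ?thesis by simp
  qed
  have "coordinate_system (card B) b \<rho>"
    unfolding coordinate_system_def
  proof (intro conjI allI impI ballI)
    show "b i \<in> \<gg>" if "i < card B" for i using bB[OF that] B(3) span_base by blast
    show "linear_functional (\<rho> i)" for i
      unfolding linear_functional_def \<rho>_def using B
      by (simp add: representation_add representation_scale)
    show "\<rho> i (b j) = (if i = j then 1 else 0)" if "i < card B" "j < card B" for i j
      using that by (simp add: \<rho>_def representation_basis[OF B(2) bB] inj)
  qed (rule exp)
  then show thesis by (rule that)
qed

lemma coordinate_unique:
  assumes "coordinate_system N b \<rho>" "x \<in> \<gg>" "\<And>i. i < N \<Longrightarrow> \<rho> i x = 0" shows "x = 0"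
proof -
  have "x = (\<Sum>i<N. scale (\<rho> i x) (b i))" using assms by (auto simp: coordinate_system_def)
  then show ?thesis using assms(3) by simp
qed

end

section \<open>Principal elements and the principal grading\<close>

text \<open>
  The adjugate of a matrix of polynomials solves all the linear systems of the family at once, with
  a common denominator: its determinant \<open>D\<close>, which is nonzero at \<open>s\<close> exactly if the system at \<open>s\<close> is
  injective. With constant polynomials this is Cramer's rule for one system.
\<close>

lemma adjugate_family:
  fixes C :: "nat \<Rightarrow> nat \<Rightarrow> complex poly"
  obtains P D where
    "\<And>s. poly D s \<noteq> 0 \<longleftrightarrow>
       (\<forall>v. (\<forall>i<N. (\<Sum>j<N. poly (C i j) s * v j) = 0) \<longrightarrow> (\<forall>j<N. v j = 0))"
    "\<And>s i k. i < N \<Longrightarrow> k < N \<Longrightarrow>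
       (\<Sum>j<N. poly (C i j) s * poly (P j k) s) = (if i = k then poly D s else 0)"
proof -
  define A where "A = Matrix.mat N N (\<lambda>(i, j). C i j)"
  have A: "A \<in> carrier_mat N N" by (simp add: A_def)
  define D where "D = Determinant.det A"
  define P where "P j k = adj_mat A $$ (j, k)" for j k
  have adj: "adj_mat A \<in> carrier_mat N N" "A * adj_mat A = D \<cdot>\<^sub>m 1\<^sub>m N"
    using adj_mat[OF A] by (auto simp: D_def)
  have ev: "(\<Sum>j<N. poly (C i j) s * poly (P j k) s) = (if i = k then poly D s else 0)"
    if "i < N" "k < N" for s i k
  proof -
    have "(A * adj_mat A) $$ (i, k) = (\<Sum>j<N. C i j * P j k)"
      using that A adj(1)
      by (simp add: scalar_prod_def A_def P_def atLeast0LessThan)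
    then have "(\<Sum>j<N. C i j * P j k) = (if i = k then D else 0)"
      unfolding adj(2) using that by (simp split: if_splits)
    then have "poly (\<Sum>j<N. C i j * P j k) s = (if i = k then poly D s else 0)" by simp
    then show ?thesis by (simp add: poly_sum)
  qed
  have hom: "comm_ring_hom (\<lambda>p. poly p (s::complex))" for s
    by unfold_locales auto
  have dets: "poly D s \<noteq> 0 \<longleftrightarrow>
       (\<forall>v. (\<forall>i<N. (\<Sum>j<N. poly (C i j) s * v j) = 0) \<longrightarrow> (\<forall>j<N. v j = 0))" for s
  proof -
    interpret comm_ring_hom "\<lambda>p. poly p (s::complex)" by (rule hom)
    let ?M = "map_mat (\<lambda>p. poly p s) A"
    have M: "?M \<in> carrier_mat N N" using A by simp
    have d: "Determinant.det ?M = poly D s" by (simp add: D_def)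
    have mv: "vec_index (?M *\<^sub>v v) i = (\<Sum>j<N. poly (C i j) s * (vec_index v j))" if "i < N" "v \<in> carrier_vec N" for i v
      using that A by (simp add: scalar_prod_def A_def atLeast0LessThan)
    show ?thesis
    proof
      assume nz: "poly D s \<noteq> 0"
      show "\<forall>v. (\<forall>i<N. (\<Sum>j<N. poly (C i j) s * v j) = 0) \<longrightarrow> (\<forall>j<N. v j = 0)"
      proof (intro allI impI)
        fix v j assume v: "\<forall>i<N. (\<Sum>j<N. poly (C i j) s * v j) = 0" and j: "j < N"
        define w where "w = Matrix.vec N v"
        have w: "w \<in> carrier_vec N" by (simp add: w_def)
        have "?M *\<^sub>v w = 0\<^sub>v N"
        proof (rule eq_vecI)
          fix i assume "i < dim_vec (0\<^sub>v N :: complex Matrix.vec)"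
          then have i: "i < N" by simp
          show "vec_index (?M *\<^sub>v w) i = vec_index (0\<^sub>v N) i"
            unfolding mv[OF i w] using v i by (simp add: w_def)
        qed (use M w in simp)
        then have "w = 0\<^sub>v N"
          using det_0_iff_vec_prod_zero_field[OF M] d nz w by auto
        then have "vec_index w j = 0" using j by simp
        then show "v j = 0" using j by (simp add: w_def)
      qed
    next
      assume inj: "\<forall>v. (\<forall>i<N. (\<Sum>j<N. poly (C i j) s * v j) = 0) \<longrightarrow> (\<forall>j<N. v j = 0)"
      show "poly D s \<noteq> 0"
      proof
        assume "poly D s = 0"
        then obtain v where v: "v \<in> carrier_vec N" "v \<noteq> 0\<^sub>v N" "?M *\<^sub>v v = 0\<^sub>v N"
          using det_0_iff_vec_prod_zero_field[OF M] d by auto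
        have "\<forall>i<N. (\<Sum>j<N. poly (C i j) s * (vec_index v j)) = 0"
          using mv[OF _ v(1)] v(3) by (simp del: index_mult_mat_vec)
        then have "\<forall>j<N. vec_index v j = 0" using spec[OF inj, of "vec_index v"] by blast
        then have "v = 0\<^sub>v N" using v(1) by (intro eq_vecI) auto
        then show False using v(2) by simp
      qed
    qed
  qed
  show thesis by (rule that[OF dets ev])
qed

context fin_dim_lie_algebra begin

lemma frobenius_functional_iff:
  "frobenius_functional F \<longleftrightarrow> linear_functional F \<and>
     (\<forall>x\<in>\<gg>. (\<forall>y\<in>\<gg>. F (bracket x y) = 0) \<longrightarrow> x = 0)"
  by (auto simp: frobenius_functional_def dual_eq kirillov_def)

lemma frobenius_separates:
  assumes "frobenius_functional F" "x \<in> \<gg>" "x' \<in> \<gg>"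
    "\<And>y. y \<in> \<gg> \<Longrightarrow> F (bracket x y) = F (bracket x' y)"
  shows "x = x'"
proof -
  have F: "linear_functional F" using assms(1) frobenius_functional_iff by auto
  have "F (bracket (x - x') y) = 0" if y: "y \<in> \<gg>" for y
    using functional_diff[OF linear_functional_bracket_left[OF F y] assms(2,3)] assms(4)[OF y] by simp
  then have "x - x' = 0" using assms(1) mem_diff[OF assms(2,3)] frobenius_functional_iff by blast
  then show ?thesis by simp
qed

text \<open>
  The Kirillov form is an injective map from \<open>\<gg>\<close> to its dual, and both have the same dimension. In
  coordinates, the matrix of the form has nonzero determinant, and its adjugate gives the solution.
\<close>

lemma frobenius_represents:
  assumes F: "frobenius_functional F" and f: "linear_functional f"
  obtains x where "x \<in> \<gg>" "\<And>y. y \<in> \<gg> \<Longrightarrow> F (bracket x y) = f y"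
proof -
  obtain N b \<rho> where cs: "coordinate_system N b \<rho>" by (rule coordinate_system_exists)
  then have b: "\<And>i. i < N \<Longrightarrow> b i \<in> \<gg>" and ex: "\<And>x. x \<in> \<gg> \<Longrightarrow> x = (\<Sum>i<N. scale (\<rho> i x) (b i))"
    by (auto simp: coordinate_system_def)
  have lF: "linear_functional F" using F frobenius_functional_iff by auto
  have F_sum: "F (bracket (\<Sum>j<N. scale (v j) (b j)) y) = (\<Sum>j<N. v j * F (bracket (b j) y))" if "y \<in> \<gg>" for v y
  proof -
    note l = linear_functional_bracket_left[OF lF that]
    have "F (bracket (\<Sum>j<N. scale (v j) (b j)) y) = (\<Sum>j<N. F (bracket (scale (v j) (b j)) y))"
      by (rule functional_sum[OF l]) (use b mem_scale in auto)
    then show ?thesis using functional_scale[OF l] b by simp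
  qed
  obtain D P where PD: "\<And>s. poly D s \<noteq> 0 \<longleftrightarrow>
       (\<forall>v. (\<forall>i<N. (\<Sum>j<N. poly [:F (bracket (b j) (b i)):] s * v j) = 0) \<longrightarrow> (\<forall>j<N. v j = 0))"
    "\<And>s i k. i < N \<Longrightarrow> k < N \<Longrightarrow>
       (\<Sum>j<N. poly [:F (bracket (b j) (b i)):] s * poly (P j k) s) = (if i = k then poly D s else 0)"
    by (rule adjugate_family[of N "\<lambda>i j. [:F (bracket (b j) (b i)):]"]) blast
  have ext: "(\<forall>y\<in>\<gg>. F (bracket x y) = f y)" if x: "x \<in> \<gg>" and f: "linear_functional f"
      and e: "\<And>i. i < N \<Longrightarrow> F (bracket x (b i)) = f (b i)" for x f
  proof
    fix y assume y: "y \<in> \<gg>"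
    note l = linear_functional_bracket_right[OF lF x]
    have "F (bracket x y) = F (bracket x (\<Sum>i<N. scale (\<rho> i y) (b i)))" using ex[OF y] by simp
    also have "\<dots> = (\<Sum>i<N. F (bracket x (scale (\<rho> i y) (b i))))"
      by (rule functional_sum[OF l]) (use b mem_scale in auto)
    also have "\<dots> = (\<Sum>i<N. \<rho> i y * f (b i))" using functional_scale[OF l] b e by simp
    also have "\<dots> = (\<Sum>i<N. f (scale (\<rho> i y) (b i)))" using functional_scale[OF f] b by simp
    also have "\<dots> = f (\<Sum>i<N. scale (\<rho> i y) (b i))"
      by (rule functional_sum[OF f, symmetric]) (use b mem_scale in auto)
    also have "\<dots> = f y" using ex[OF y] by simp
    finally show "F (bracket x y) = f y" .
  qed
  have "poly D 0 \<noteq> 0"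
    unfolding PD(1)
  proof (intro allI impI)
    fix v j assume v: "\<forall>i<N. (\<Sum>j<N. poly [:F (bracket (b j) (b i)):] 0 * v j) = 0" and j: "j < N"
    define x where "x = (\<Sum>j<N. scale (v j) (b j))"
    have x: "x \<in> \<gg>" unfolding x_def using b mem_scale by (intro mem_sum) auto
    have "\<forall>y\<in>\<gg>. F (bracket x y) = 0"
    proof (rule ext[OF x, of "\<lambda>_. 0", simplified])
      show "linear_functional (\<lambda>_. 0)" by (simp add: linear_functional_def)
      show "F (bracket x (b i)) = 0" if "i < N" for i
        using F_sum[OF b[OF that], of v] v that by (simp add: x_def mult.commute)
    qed
    then have "x = 0" using F x frobenius_functional_iff by auto
    have "\<rho> j x = (\<Sum>k<N. \<rho> j (scale (v k) (b k)))"
      unfolding x_def using cs j b mem_scale by (intro functional_sum) (auto simp: coordinate_system_def)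
    also have "\<dots> = (\<Sum>k<N. v k * (if j = k then 1 else 0))"
      using cs j by (intro sum.cong) (auto simp: coordinate_system_def functional_scale)
    also have "\<dots> = v j" using j by (simp add: if_distrib cong: if_cong)
    finally show "v j = 0"
      using \<open>x = 0\<close> cs j functional_0[of "\<rho> j"] by (simp add: coordinate_system_def)
  qed
  then have D: "poly D 0 \<noteq> 0" .
  define v where "v j = (\<Sum>k<N. poly (P j k) 0 * f (b k)) / poly D 0" for j
  define x where "x = (\<Sum>j<N. scale (v j) (b j))"
  have x: "x \<in> \<gg>" unfolding x_def using b mem_scale by (intro mem_sum) auto
  have "F (bracket x (b i)) = f (b i)" if i: "i < N" for i
  proof -
    have "F (bracket x (b i)) = (\<Sum>j<N. \<Sum>k<N. F (bracket (b j) (b i)) * poly (P j k) 0 * f (b k) / poly D 0)"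
      unfolding x_def F_sum[OF b[OF i]] v_def
      by (simp add: sum_divide_distrib sum_distrib_left sum_distrib_right mult_ac)
    also have "\<dots> = (\<Sum>k<N. (\<Sum>j<N. F (bracket (b j) (b i)) * poly (P j k) 0) * f (b k) / poly D 0)"
      by (subst sum.swap) (simp add: sum_distrib_right sum_divide_distrib)
    also have "\<dots> = (\<Sum>k<N. (if i = k then poly D 0 else 0) * f (b k) / poly D 0)"
      using PD(2)[OF i, of _ 0] by (intro sum.cong) auto
    also have "\<dots> = (\<Sum>k<N. if i = k then f (b k) else 0)"
      using D by (intro sum.cong) auto
    also have "\<dots> = f (b i)" using i by simp
    finally show ?thesis .
  qed
  then show thesis using that[OF x] ext[OF x f] by blast
qed

lemma principal_element:
  assumes F: "frobenius_functional F"
  shows "principal_element F \<in> \<gg>" "\<And>x. x \<in> \<gg> \<Longrightarrow> F (bracket (principal_element F) x) = F x"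
proof -
  have lF: "linear_functional F" using F frobenius_functional_iff by auto
  obtain H where H: "H \<in> \<gg>" "\<And>y. y \<in> \<gg> \<Longrightarrow> F (bracket H y) = F y"
    using frobenius_represents[OF F lF] by blast
  have "\<exists>!H. H \<in> \<gg> \<and> (\<forall>x\<in>\<gg>. F (bracket H x) = F x)"
    using H frobenius_separates[OF F] by (intro ex1I[of _ H]) auto
  from theI'[OF this] show "principal_element F \<in> \<gg>"
    "\<And>x. x \<in> \<gg> \<Longrightarrow> F (bracket (principal_element F) x) = F x"
    unfolding principal_element_def by auto
qed

lemma principal_element_eqI:
  assumes "frobenius_functional F" "H \<in> \<gg>" "\<And>x. x \<in> \<gg> \<Longrightarrow> F (bracket H x) = F x"
  shows "principal_element F = H"
  using frobenius_separates[OF assms(1) principal_element(1)[OF assms(1)] assms(2)]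
    principal_element(2)[OF assms(1)] assms(3) by simp

lemma ad_eigenspace_iff: "x \<in> ad_eigenspace H c \<longleftrightarrow> x \<in> \<gg> \<and> bracket H x = scale c x"
  by (simp add: ad_eigenspace_def)

lemma subspace_ad_eigenspace: "H \<in> \<gg> \<Longrightarrow> subspace (ad_eigenspace H c)"
  using operator_0[OF linear_operator_ad]
  by (intro subspaceI)
    (auto simp: ad_eigenspace_iff mem_add mem_scale bracket_add_right bracket_scale_right scale_right_distrib mult.commute)

lemma ad_eigenspace_subset: "ad_eigenspace H c \<subseteq> \<gg>"
  by (auto simp: ad_eigenspace_iff)

text \<open>
  Induction on the number of eigenvalues: applying \<open>ad H - d\<close> removes the summand for \<open>d\<close> and scales
  the others by the nonzero numbers \<open>c - d\<close>.
\<close>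

lemma ad_eigenspaces_independent:
  assumes H: "H \<in> \<gg>" and "finite C" "\<And>c. c \<in> C \<Longrightarrow> v c \<in> ad_eigenspace H c" "(\<Sum>c\<in>C. v c) = 0" "c \<in> C"
  shows "v c = 0"
  using assms(2-)
proof (induction C arbitrary: v c rule: finite_induct)
  case (insert d C)
  have mem: "v c \<in> \<gg>" if "c \<in> insert d C" for c using insert.prems(1)[OF that] by (simp add: ad_eigenspace_iff)
  let ?T = "\<lambda>x. bracket H x - scale d x"
  have "(\<Sum>c\<in>C. scale (c - d) (v c)) = (\<Sum>c\<in>insert d C. scale (c - d) (v c))"
    using insert.hyps by simp
  also have "\<dots> = (\<Sum>c\<in>insert d C. bracket H (v c) - scale d (v c))"
    using insert.prems(1) by (intro sum.cong) (auto simp: ad_eigenspace_iff scale_left_diff_distrib)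
  also have "\<dots> = bracket H (\<Sum>c\<in>insert d C. v c) - scale d (\<Sum>c\<in>insert d C. v c)"
    unfolding sum_subtractf using operator_sum[OF linear_operator_ad[OF H], of "insert d C" v] mem
    by (simp add: scale_sum_right)
  also have "\<dots> = 0"
    unfolding insert.prems(2) using operator_0[OF linear_operator_ad[OF H]] by simp
  finally have s: "(\<Sum>c\<in>C. scale (c - d) (v c)) = 0" .
  have "scale (c - d) (v c) = 0" if "c \<in> C" for c
    using insert.prems(1) subspace_scale[OF subspace_ad_eigenspace[OF H]]
    by (intro insert.IH[OF _ s that]) auto
  then have z: "v c = 0" if "c \<in> C" for c using that insert.hyps by auto
  then have "v d = 0" using insert.prems(2) insert.hyps by simp
  then show ?case using z insert.prems(3) by auto
qed simp

lemma finite_eigenvalues: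
  assumes H: "H \<in> \<gg>" shows "finite {c. ad_eigenspace H c \<noteq> {0}}"
proof (rule ccontr)
  assume inf: "infinite {c. ad_eigenspace H c \<noteq> {0}}"
  have "\<exists>v. v \<in> ad_eigenspace H c \<and> v \<noteq> 0" if "ad_eigenspace H c \<noteq> {0}" for c
    using that subspace_0[OF subspace_ad_eigenspace[OF H], of c] by auto
  then obtain v where v: "\<And>c. ad_eigenspace H c \<noteq> {0} \<Longrightarrow> v c \<in> ad_eigenspace H c \<and> v c \<noteq> 0" by metis
  obtain C where C: "C \<subseteq> {c. ad_eigenspace H c \<noteq> {0}}" "finite C" "card C = Suc (dim \<gg>)"
    using infinite_arbitrarily_large[OF inf] by blast
  have CE: "ad_eigenspace H c \<noteq> {0}" if "c \<in> C" for c using C(1) that by blast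
  have vE: "v c \<in> ad_eigenspace H c" "v c \<noteq> 0" if "c \<in> C" for c using v[OF CE[OF that]] by auto
  have inj: "inj_on v C"
  proof (rule inj_onI)
    fix c d assume cd: "c \<in> C" "d \<in> C" "v c = v d"
    then have "scale c (v c) = scale d (v c)" using vE(1)[of c] vE(1)[of d] by (simp add: ad_eigenspace_iff)
    then show "c = d" using vE(2) cd by auto
  qed
  have "independent (v ` C)"
  proof (rule independent_if_scalars_zero)
    show "finite (v ` C)" using C(2) by simp
    fix f x assume s: "(\<Sum>x\<in>v ` C. scale (f x) x) = 0" and x: "x \<in> v ` C"
    then obtain c where c: "c \<in> C" "x = v c" by auto
    have "(\<Sum>c\<in>C. scale (f (v c)) (v c)) = 0" using s by (simp add: sum.reindex[OF inj])
    then have "scale (f (v c)) (v c) = 0"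
      using vE subspace_scale[OF subspace_ad_eigenspace[OF H]] c
      by (intro ad_eigenspaces_independent[OF H C(2), of "\<lambda>c. scale (f (v c)) (v c)"]) auto
    then show "f x = 0" using vE c by auto
  qed
  moreover have "v ` C \<subseteq> \<gg>" using vE(1) by (auto simp: ad_eigenspace_iff)
  moreover obtain G where G: "finite G" "independent G" "span G = \<gg>" "card G = dim \<gg>"
    using subspace_finite_basis[OF subspace_algebra] by auto
  ultimately have "card (v ` C) \<le> dim \<gg>"
    using independent_span_bound[OF G(1), of "v ` C"] by simp
  then show False using C(3) card_image[OF inj] by simp
qed

lemma ad_semisimple_decompose:
  assumes H: "H \<in> \<gg>" and ss: "ad_semisimple H" and x: "x \<in> \<gg>"
  obtains v where "\<And>c. v c \<in> ad_eigenspace H c" "x = (\<Sum>c | ad_eigenspace H c \<noteq> {0}. v c)"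
proof -
  let ?C = "{c. ad_eigenspace H c \<noteq> {0}}"
  let ?W = "{x. \<exists>v. (\<forall>c. v c \<in> ad_eigenspace H c) \<and> x = (\<Sum>c\<in>?C. v c)}"
  note sub = subspace_ad_eigenspace[OF H]
  have fin: "finite ?C" by (rule finite_eigenvalues[OF H])
  have "subspace ?W"
  proof (rule subspaceI)
    show "0 \<in> ?W" using subspace_0[OF sub] by (auto intro!: exI[of _ "\<lambda>_. 0"])
  next
    fix x y assume "x \<in> ?W" "y \<in> ?W"
    then obtain v w where "\<forall>c. v c \<in> ad_eigenspace H c" "x = (\<Sum>c\<in>?C. v c)"
      "\<forall>c. w c \<in> ad_eigenspace H c" "y = (\<Sum>c\<in>?C. w c)" by auto
    then show "x + y \<in> ?W"
      using subspace_add[OF sub] by (auto intro!: exI[of _ "\<lambda>c. v c + w c"] simp: sum.distrib)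
  next
    fix k x assume "x \<in> ?W"
    then obtain v where "\<forall>c. v c \<in> ad_eigenspace H c" "x = (\<Sum>c\<in>?C. v c)" by auto
    then show "scale k x \<in> ?W"
      using subspace_scale[OF sub] by (auto intro!: exI[of _ "\<lambda>c. scale k (v c)"] simp: scale_sum_right)
  qed
  moreover have "(\<Union>c. ad_eigenspace H c) \<subseteq> ?W"
  proof
    fix x assume "x \<in> (\<Union>c. ad_eigenspace H c)"
    then obtain d where d: "x \<in> ad_eigenspace H d" by auto
    show "x \<in> ?W"
    proof (cases "d \<in> ?C")
      case True
      then show ?thesis
        using d subspace_0[OF sub] fin
        by (auto intro!: exI[of _ "\<lambda>c. if c = d then x else 0"])
    next
      case False
      then have "x = 0" using d by auto
      then show ?thesis using subspace_0[OF sub] by (auto intro!: exI[of _ "\<lambda>_. 0"])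
    qed
  qed
  ultimately have "span (\<Union>c. ad_eigenspace H c) \<subseteq> ?W" by (rule span_minimal[rotated])
  then have "x \<in> ?W" using x ss by (auto simp: ad_semisimple_def)
  then show thesis using that by auto
qed

text \<open>
  The bracket lies in the eigenspace for \<open>a + c\<close>, while \<open>F\<close> is invariant under \<open>ad H\<close>; comparing the two
  gives \<open>(a + c) F [x, y] = F [x, y]\<close>.
\<close>

lemma eigenspace_pairing:
  assumes F: "frobenius_functional F"
    and x: "x \<in> ad_eigenspace (principal_element F) a" and y: "y \<in> ad_eigenspace (principal_element F) c"
    and "a + c \<noteq> 1"
  shows "F (bracket x y) = 0"
proof -
  let ?H = "principal_element F"
  have mem: "?H \<in> \<gg>" "x \<in> \<gg>" "y \<in> \<gg>" using principal_element(1)[OF F] x y by (auto simp: ad_eigenspace_iff)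
  have lF: "linear_functional F" using F frobenius_functional_iff by auto
  have "bracket ?H (bracket x y) = - bracket x (bracket y ?H) - bracket y (bracket ?H x)"
    using jacobi[OF mem] by (simp add: algebra_simps eq_neg_iff_add_eq_0)
  also have "bracket y ?H = - scale c y"
    using bracket_antisym[OF mem(3,1)] y by (simp add: ad_eigenspace_iff)
  also have "bracket x (- scale c y) = - scale c (bracket x y)"
    using bracket_scale_right[OF mem(2,3), of "- c"] by simp
  also have "bracket y (bracket ?H x) = scale a (bracket y x)"
    using x bracket_scale_right[OF mem(3,2)] by (simp add: ad_eigenspace_iff)
  also have "bracket y x = - bracket x y" by (rule bracket_antisym[OF mem(3,2)])
  finally have "bracket ?H (bracket x y) = scale (a + c) (bracket x y)"
    by (simp add: scale_left_distrib)
  then have "F (bracket x y) = (a + c) * F (bracket x y)"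
    using principal_element(2)[OF F bracket_closed[OF mem(2,3)]] functional_scale[OF lF bracket_closed[OF mem(2,3)]]
    by simp
  then show ?thesis using assms(4) by simp
qed

text \<open>
  By the previous lemma, an element of the eigenspace for \<open>c\<close> that is orthogonal to the one for \<open>1 - c\<close>
  is orthogonal to all of \<open>\<gg>\<close>, hence zero. So a basis of the latter yields functionals that separate
  the points of the former.
\<close>

lemma eigenspace_dim_le:
  assumes F: "frobenius_functional F" and ss: "ad_semisimple (principal_element F)"
  shows "dim (ad_eigenspace (principal_element F) c) \<le> dim (ad_eigenspace (principal_element F) (1 - c))"
proof -
  let ?H = "principal_element F"
  have H: "?H \<in> \<gg>" by (rule principal_element(1)[OF F])
  have lF: "linear_functional F" using F frobenius_functional_iff by auto
  obtain B where B: "finite B" "independent B" "span B = ad_eigenspace ?H (1 - c)"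
    "card B = dim (ad_eigenspace ?H (1 - c))"
    using subspace_finite_basis[OF subspace_ad_eigenspace[OF H] ad_eigenspace_subset] by blast
  have Bg: "y \<in> ad_eigenspace ?H (1 - c)" if "y \<in> B" for y using that B(3) span_base by blast
  have "dim (ad_eigenspace ?H c) \<le> card B"
  proof (rule dim_le_functionals[OF B(1), of "\<lambda>y x. F (bracket x y)"])
    show "linear_functional (\<lambda>x. F (bracket x y))" if "y \<in> B" for y
      using Bg[OF that] by (intro linear_functional_bracket_left[OF lF]) (simp add: ad_eigenspace_iff)
    fix x assume x: "x \<in> ad_eigenspace ?H c" and z: "\<And>y. y \<in> B \<Longrightarrow> F (bracket x y) = 0"
    have xg: "x \<in> \<gg>" using x by (simp add: ad_eigenspace_iff)
    note lx = linear_functional_bracket_right[OF lF xg]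
    have sp: "F (bracket x y) = 0" if "y \<in> span B" for y
    proof -
      have "y \<in> \<gg> \<and> F (bracket x y) = 0"
        using that
      proof (induct rule: span_induct_alt)
        case base
        then show ?case using functional_0[OF lx] by simp
      next
        case (step k u w)
        have "u \<in> \<gg>" using Bg[OF step(1)] by (simp add: ad_eigenspace_iff)
        moreover have w: "w \<in> \<gg>" "F (bracket x w) = 0" using step by auto
        ultimately show ?case
          using z[OF step(1)] functional_add[OF lx, of "scale k u" w] functional_scale[OF lx, of u k]
          by (simp add: mem_add mem_scale)
      qed
      then show ?thesis by simp
    qed
    have "F (bracket x y) = 0" if y: "y \<in> \<gg>" for y
    proof -
      obtain v where v: "\<And>c. v c \<in> ad_eigenspace ?H c" "y = (\<Sum>c | ad_eigenspace ?H c \<noteq> {0}. v c)"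
        using ad_semisimple_decompose[OF H ss y] by blast
      have "F (bracket x y) = (\<Sum>c | ad_eigenspace ?H c \<noteq> {0}. F (bracket x (v c)))"
        unfolding v(2) using v(1) ad_eigenspace_subset by (intro functional_sum[OF lx]) auto
      also have "\<dots> = 0"
      proof (intro sum.neutral ballI)
        fix d show "F (bracket x (v d)) = 0"
        proof (cases "c + d = 1")
          case True
          then have "d = 1 - c" by (metis add_diff_cancel_left')
          then show ?thesis using sp[of "v d"] v(1)[of d] B(3) by simp
        qed (rule eigenspace_pairing[OF F x v(1)])
      qed
      finally show ?thesis .
    qed
    then show "x = 0" using F xg frobenius_functional_iff by auto
  qed (use subspace_ad_eigenspace[OF H] ad_eigenspace_subset in auto)
  then show ?thesis using B(4) by simp
qed

lemma principal_mult_symmetric: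
  assumes "frobenius_functional F" "ad_semisimple (principal_element F)"
  shows "principal_mult F (1 - j) = principal_mult F j"
proof (rule antisym)
  show "principal_mult F (1 - j) \<le> principal_mult F j"
    using eigenspace_dim_le[OF assms, of "of_int (1 - j)"] by (simp add: principal_mult_def)
  show "principal_mult F j \<le> principal_mult F (1 - j)"
    using eigenspace_dim_le[OF assms, of "of_int j"] by (simp add: principal_mult_def)
qed

lemma finite_principal_mult:
  assumes "frobenius_functional F"
  shows "finite {j. principal_mult F j \<noteq> 0}"
proof -
  let ?H = "principal_element F"
  let ?E = "{c. ad_eigenspace ?H c \<noteq> {0}}"
  have dim0: "dim {0} = 0" using dim_le_card[of "{0}" "{}"] by simp
  have "of_int j \<in> ?E" if "principal_mult F j \<noteq> 0" for j
    using that dim0 unfolding principal_mult_def by (metis mem_Collect_eq)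
  then have "of_int ` {j. principal_mult F j \<noteq> 0} \<subseteq> ?E" by blast
  then have "finite (of_int ` {j. principal_mult F j \<noteq> 0} :: complex set)"
    using finite_eigenvalues[OF principal_element(1)[OF assms]] finite_subset by blast
  then show ?thesis by (rule finite_imageD) (metis injI inj_on_subset of_int_eq_iff subset_UNIV)
qed

end

section \<open>The virtual character and the defect\<close>

lemma lookup_of_int_mult: "Poly_Mapping.lookup (of_int a * p) k = a * Poly_Mapping.lookup (p :: int \<Rightarrow>\<^sub>0 int) k"
proof -
  have "of_nat n * p = (\<Sum>_<n. p)" for n :: nat by simp
  then have n: "Poly_Mapping.lookup (of_nat n * p) k = int n * Poly_Mapping.lookup p k" for n :: nat
    by (induction n) (simp_all add: lookup_add algebra_simps)
  show ?thesis
  proof (cases "a \<ge> 0")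
    case True
    then show ?thesis using n[of "nat a"] by simp
  next
    case False
    then have "of_int a = - (of_nat (nat (- a)) :: int \<Rightarrow>\<^sub>0 int)" by simp
    then show ?thesis using n[of "nat (- a)"] False by (simp add: lookup_uminus)
  qed
qed

lemma lookup_sum_any: "Poly_Mapping.lookup (\<Sum>i\<in>I. f i) k = (\<Sum>i\<in>I. Poly_Mapping.lookup (f i) k)"
  by (induction I rule: infinite_finite_induct) (auto simp: lookup_add)

lemma sym_char_step:
  "sym_char (n + 2) = sym_char n + Poly_Mapping.single (int n + 2) 1 + Poly_Mapping.single (- int n - 2) 1"
proof -
  let ?s = "\<lambda>k::nat. Poly_Mapping.single (int (n + 2) - 2 * int k) (1::int)"
  have "sym_char (n + 2) = (\<Sum>k\<le>Suc n. ?s k) + ?s (Suc (Suc n))"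
    by (simp add: sym_char_def)
  also have "(\<Sum>k\<le>Suc n. ?s k) = ?s 0 + (\<Sum>k\<le>n. ?s (Suc k))"
    by (rule sum.atMost_Suc_shift)
  also have "(\<Sum>k\<le>n. ?s (Suc k)) = sym_char n"
    by (simp add: sym_char_def algebra_simps)
  finally show ?thesis by (simp add: algebra_simps)
qed

text \<open>
  The weights of an irreducible character are an interval of a parity class that is symmetric about
  zero, so its coefficients drop only once on the nonnegative side, after the highest weight.
\<close>

lemma sym_char_coefficient_diff:
  "Poly_Mapping.lookup (sym_char n) (int k) - Poly_Mapping.lookup (sym_char n) (int k + 2) = (if n = k then 1 else 0)"
proof -
  have c: "Poly_Mapping.lookup (sym_char n) x = (\<Sum>i\<le>n. if int n - 2 * int i = x then 1 else 0)" for x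
    by (auto simp: sym_char_def lookup_sum_any lookup_single when_def intro!: sum.cong)
  have "Poly_Mapping.lookup (sym_char n) (int k + 2) = (\<Sum>i\<le>n. if int n - 2 * int (Suc i) = int k then 1 else 0)"
    unfolding c by (intro sum.cong) auto
  also have "\<dots> = (\<Sum>i\<le>Suc n. if int n - 2 * int i = int k then 1 else 0) - (if n = k then 1 else 0)"
    by (subst sum.atMost_Suc_shift) auto
  also have "(\<Sum>i\<le>Suc n. if int n - 2 * int i = int k then 1 else 0) = Poly_Mapping.lookup (sym_char n) (int k)"
    unfolding c by simp
  finally show ?thesis by simp
qed

lemma virtual_char_superset:
  assumes "finite K" "Poly_Mapping.keys c \<subseteq> K"
  shows "virtual_char c = (\<Sum>n\<in>K. of_int (Poly_Mapping.lookup c n) * sym_char n)"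
  unfolding virtual_char_def using assms
  by (intro sum.mono_neutral_left) (auto simp: in_keys_iff)

lemma virtual_char_coefficient:
  "Poly_Mapping.lookup c k = Poly_Mapping.lookup (virtual_char c) (int k) - Poly_Mapping.lookup (virtual_char c) (int k + 2)"
proof -
  have "Poly_Mapping.lookup (virtual_char c) (int k) - Poly_Mapping.lookup (virtual_char c) (int k + 2)
     = (\<Sum>n\<in>insert k (Poly_Mapping.keys c). Poly_Mapping.lookup c n * (if n = k then 1 else 0))"
    by (subst (1 2) virtual_char_superset[of "insert k (Poly_Mapping.keys c)"])
      (auto simp: lookup_sum_any lookup_of_int_mult sum_subtractf[symmetric] right_diff_distrib[symmetric]
        sym_char_coefficient_diff simp del: sum.insert)
  then show ?thesis by (simp add: if_distrib cong: if_cong del: sum.insert)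
qed

lemma char_coeffs_virtual_char: "char_coeffs (virtual_char c) = c"
proof -
  have "c' = c" if "virtual_char c' = virtual_char c" for c'
    using virtual_char_coefficient[of c'] virtual_char_coefficient[of c] that by (intro poly_mapping_eqI) simp
  then show ?thesis unfolding char_coeffs_def by (intro the_equality) auto
qed

text \<open>
  Summation by parts: by \<open>sym_char_step\<close>, each pair of monomials is the difference of two consecutive
  odd characters.
\<close>

lemma sum_symmetric_pairs:
  fixes h :: "nat \<Rightarrow> int"
  shows "(\<Sum>m=1..M. of_int (h m - h (m + 1)) * sym_char (2 * m - 1)) + of_int (h (M + 1)) * (if M = 0 then 0 else sym_char (2 * M - 1)) =
    (\<Sum>m=1..M. Poly_Mapping.single (2 * int m - 1) (h m) + Poly_Mapping.single (1 - 2 * int m) (h m))"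
proof (induction M)
  case (Suc M)
  have sm: "Poly_Mapping.single k a = of_int a * Poly_Mapping.single k (1::int)" for k a :: int
    by (intro poly_mapping_eqI) (simp add: lookup_of_int_mult lookup_single when_def)
  have st: "sym_char (2 * Suc M - 1) = (if M = 0 then 0 else sym_char (2 * M - 1)) +
      Poly_Mapping.single (2 * int (Suc M) - 1) 1 + Poly_Mapping.single (1 - 2 * int (Suc M)) 1"
  proof (cases M)
    case 0
    then show ?thesis by (simp add: sym_char_def numeral_2_eq_2 add.commute)
  next
    case (Suc M')
    then show ?thesis using sym_char_step[of "2 * M - 1"] by (simp add: algebra_simps)
  qed
  have "(\<Sum>m=1..Suc M. of_int (h m - h (m + 1)) * sym_char (2 * m - 1)) + of_int (h (Suc M + 1)) * sym_char (2 * Suc M - 1)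
     = (\<Sum>m=1..M. of_int (h m - h (m + 1)) * sym_char (2 * m - 1)) + of_int (h (M + 1)) * sym_char (2 * Suc M - 1)"
    by (simp add: algebra_simps)
  also have "\<dots> = ((\<Sum>m=1..M. of_int (h m - h (m + 1)) * sym_char (2 * m - 1)) + of_int (h (M + 1)) * (if M = 0 then 0 else sym_char (2 * M - 1)))
     + (of_int (h (Suc M)) * Poly_Mapping.single (2 * int (Suc M) - 1) 1 + of_int (h (Suc M)) * Poly_Mapping.single (1 - 2 * int (Suc M)) 1)"
    unfolding st by (simp only: distrib_left Suc_eq_plus1 add.assoc)
  also have "\<dots> = (\<Sum>m=1..Suc M. Poly_Mapping.single (2 * int m - 1) (h m) + Poly_Mapping.single (1 - 2 * int m) (h m))"
    unfolding Suc.IH sm[of _ "h (Suc M)", symmetric] by simp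
  finally show ?case by simp
qed simp

context fin_dim_lie_algebra begin

lemma principal_mult_bounded:
  assumes "frobenius_functional F"
  obtains M where "\<And>j. int M < \<bar>j\<bar> \<Longrightarrow> principal_mult F j = 0" "M \<ge> 1"
proof -
  have "finite ((\<lambda>j. nat \<bar>j\<bar>) ` {j. principal_mult F j \<noteq> 0})" using finite_principal_mult[OF assms] by simp
  then obtain M where "\<And>x. x \<in> (\<lambda>j. nat \<bar>j\<bar>) ` {j. principal_mult F j \<noteq> 0} \<Longrightarrow> x \<le> M"
    by (meson finite_nat_set_iff_bounded_le)
  then have "principal_mult F j = 0" if "int (Suc M) < \<bar>j\<bar>" for j using that by fastforce
  then show thesis using that[of "Suc M"] by auto
qed

context
  fixes F M
  assumes F: "frobenius_functional F" and grading: "semisimple_integral_grading F"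
    and M: "\<And>j. int M < \<bar>j\<bar> \<Longrightarrow> principal_mult F j = 0" "M \<ge> 1"
begin

definition "ooms m = int (principal_mult F (int m))"

lemma ooms_eq_0: "m > M \<Longrightarrow> ooms m = 0"
  using M(1)[of "int m"] by (simp add: ooms_def)

lemma centered_principal_char_sum:
  "centered_principal_char F = (\<Sum>m=1..M. of_int (ooms m - ooms (m + 1)) * sym_char (2 * m - 1))"
proof -
  let ?s = "\<lambda>j. Poly_Mapping.single (2 * j - 1) (int (principal_mult F j))"
  have ss: "ad_semisimple (principal_element F)" using grading by (simp add: semisimple_integral_grading_def)
  have refl: "principal_mult F (1 - int m) = principal_mult F (int m)" for m
    by (rule principal_mult_symmetric[OF F ss])
  have "centered_principal_char F = (\<Sum>j\<in>{1 - int M..int M}. ?s j)"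
    unfolding centered_principal_char_def
  proof (rule Sum_any.expand_superset)
    show "{a. ?s a \<noteq> 0} \<subseteq> {1 - int M..int M}"
    proof
      fix j assume "j \<in> {a. ?s a \<noteq> 0}"
      have nz: "principal_mult F j \<noteq> 0"
      proof
        assume "principal_mult F j = 0"
        then have "?s j = 0" by simp
        with \<open>j \<in> {a. ?s a \<noteq> 0}\<close> show False by blast
      qed
      then have nz': "principal_mult F (1 - j) \<noteq> 0" using principal_mult_symmetric[OF F ss, of j] by simp
      show "j \<in> {1 - int M..int M}" using M(1)[of j] M(1)[of "1 - j"] nz nz' unfolding atLeastAtMost_iff by linarith
    qed
  qed simp
  also have "{1 - int M..int M} = int ` {1..M} \<union> (\<lambda>m. 1 - int m) ` {1..M}"
  proof (intro equalityI subsetI)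
    fix j assume j: "j \<in> {1 - int M..int M}"
    show "j \<in> int ` {1..M} \<union> (\<lambda>m. 1 - int m) ` {1..M}"
    proof (cases "j \<ge> 1")
      case True
      then have "j = int (nat j)" "nat j \<in> {1..M}" using j by auto
      then show ?thesis by blast
    next
      case False
      then have "j = 1 - int (nat (1 - j))" "nat (1 - j) \<in> {1..M}" using j by auto
      then show ?thesis by blast
    qed
  qed auto
  also have "(\<Sum>j\<in>int ` {1..M} \<union> (\<lambda>m. 1 - int m) ` {1..M}. ?s j) = (\<Sum>m=1..M. ?s (int m)) + (\<Sum>m=1..M. ?s (1 - int m))"
    by (subst sum.union_disjoint) (auto simp: sum.reindex inj_on_def)
  also have "\<dots> = (\<Sum>m=1..M. Poly_Mapping.single (2 * int m - 1) (ooms m) + Poly_Mapping.single (1 - 2 * int m) (ooms m))"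
    unfolding sum.distrib[symmetric] refl ooms_def by (intro sum.cong) (auto simp: algebra_simps)
  also have "\<dots> = (\<Sum>m=1..M. of_int (ooms m - ooms (m + 1)) * sym_char (2 * m - 1))"
    unfolding sum_symmetric_pairs[symmetric] using M(1)[of "int M + 1"] by (simp add: ooms_def add.commute)
  finally show ?thesis .
qed

lemma centered_principal_char_expand:
  "centered_principal_char F = Sum_any (\<lambda>m::nat. if m \<ge> 1
     then of_int (ooms m - ooms (m + 1)) * sym_char (2 * m - 1) else 0)"
proof -
  have "{a. (if a \<ge> 1 then of_int (ooms a - ooms (a + 1)) * sym_char (2 * a - 1) else 0) \<noteq> 0} \<subseteq> {1..M}"
  proof
    fix a assume a: "a \<in> {a. (if a \<ge> 1 then of_int (ooms a - ooms (a + 1)) * sym_char (2 * a - 1) else 0) \<noteq> 0}"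
    have "\<not> a > M"
    proof
      assume "a > M"
      then have "ooms a = 0" "ooms (a + 1) = 0" by (auto intro: ooms_eq_0)
      then show False using a by (simp split: if_splits)
    qed
    then show "a \<in> {1..M}" using a by (auto split: if_splits)
  qed
  from Sum_any.expand_superset[OF finite_atLeastAtMost this] show ?thesis
    unfolding centered_principal_char_sum by simp
qed

lemma sl2_defect_sum: "sl2_defect F = (\<Sum>m=1..M. max 0 (ooms (m + 1) - ooms m))"
proof -
  have "{a. (if a \<ge> 1 then max 0 (ooms (a + 1) - ooms a) else 0) \<noteq> 0} \<subseteq> {1..M}"
  proof
    fix a assume a: "a \<in> {a. (if a \<ge> 1 then max 0 (ooms (a + 1) - ooms a) else 0) \<noteq> 0}"
    have "\<not> a > M"
    proof
      assume "a > M"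
      then have "ooms a = 0" "ooms (a + 1) = 0" by (auto intro: ooms_eq_0)
      then show False using a by (simp split: if_splits)
    qed
    then show "a \<in> {1..M}" using a by (auto split: if_splits)
  qed
  from Sum_any.expand_superset[OF finite_atLeastAtMost this]
  have e1: "Sum_any (\<lambda>a. if a \<ge> 1 then max 0 (ooms (a + 1) - ooms a) else 0) = (\<Sum>m=1..M. max 0 (ooms (m + 1) - ooms m))"
    by simp
  have e2: "(\<lambda>m::nat. if m \<ge> 1 then max 0 (int (principal_mult F (int m + 1)) - int (principal_mult F (int m))) else 0)
      = (\<lambda>a. if a \<ge> 1 then max 0 (ooms (a + 1) - ooms a) else 0)"
    by (intro ext) (auto simp: ooms_def add.commute)
  show ?thesis unfolding sl2_defect_def e2 by (rule e1)
qed

lemma sl2_defect_negative_mass: "sl2_defect F = negative_mass (centered_principal_char F)"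
proof -
  define c where "c = (\<Sum>m=1..M. Poly_Mapping.single (2 * m - 1) (ooms m - ooms (m + 1)))"
  have lc: "Poly_Mapping.lookup c k = (\<Sum>m=1..M. if 2 * m - 1 = k then ooms m - ooms (m + 1) else 0)" for k
    by (simp add: c_def lookup_sum_any lookup_single when_def cong: if_cong)
  have odd: "Poly_Mapping.lookup c (2 * m - 1) = ooms m - ooms (m + 1)" if "m \<in> {1..M}" for m
  proof -
    have "Poly_Mapping.lookup c (2 * m - 1) = (\<Sum>i=1..M. if i = m then ooms i - ooms (i + 1) else 0)"
      unfolding lc using that by (intro sum.cong) auto
    then show ?thesis using that by simp
  qed
  have other: "Poly_Mapping.lookup c k = 0" if "k \<notin> (\<lambda>m. 2 * m - 1) ` {1..M}" for k
    unfolding lc using that by (intro sum.neutral) auto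
  have inj: "inj_on (\<lambda>m. 2 * m - 1 :: nat) {1..M}" by (auto simp: inj_on_def)
  have "virtual_char c = (\<Sum>n\<in>(\<lambda>m. 2 * m - 1) ` {1..M}. of_int (Poly_Mapping.lookup c n) * sym_char n)"
    by (rule virtual_char_superset) (use other in \<open>auto simp: in_keys_iff\<close>)
  also have "\<dots> = centered_principal_char F"
    unfolding sum.reindex[OF inj] centered_principal_char_sum using odd by (intro sum.cong) auto
  finally have "char_coeffs (centered_principal_char F) = c" using char_coeffs_virtual_char[of c] by simp
  then have "negative_mass (centered_principal_char F) = (\<Sum>n | Poly_Mapping.lookup c n < 0. \<bar>Poly_Mapping.lookup c n\<bar>)"
    by (simp add: negative_mass_def)
  also have "\<dots> = (\<Sum>n\<in>(\<lambda>m. 2 * m - 1) ` {1..M}. max 0 (- Poly_Mapping.lookup c n))"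
  proof (rule sum.mono_neutral_cong_left)
    show "{n. Poly_Mapping.lookup c n < 0} \<subseteq> (\<lambda>m. 2 * m - 1) ` {1..M}" using other by force
  qed auto
  also have "\<dots> = sl2_defect F"
    unfolding sum.reindex[OF inj] sl2_defect_sum using odd by (intro sum.cong) auto
  finally show ?thesis by simp
qed

lemma sl2_defect_eq_0_iff: "sl2_defect F = 0 \<longleftrightarrow> unimodal F"
proof -
  have "sl2_defect F = 0 \<longleftrightarrow> (\<forall>m\<in>{1..M}. ooms (m + 1) \<le> ooms m)"
    unfolding sl2_defect_sum by (subst sum_nonneg_eq_0_iff) (auto simp: max_def)
  also have "\<dots> \<longleftrightarrow> unimodal F"
  proof
    assume u: "\<forall>m\<in>{1..M}. ooms (m + 1) \<le> ooms m"
    show "unimodal F"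
      unfolding unimodal_def
    proof (intro allI impI)
      fix m :: int assume m: "1 \<le> m"
      show "principal_mult F (m + 1) \<le> principal_mult F m"
      proof (cases "m \<le> int M")
        case True
        then have "nat m \<in> {1..M}" using m by auto
        then have "ooms (nat m + 1) \<le> ooms (nat m)" using u by blast
        then show ?thesis using m by (simp add: ooms_def add.commute)
      next
        case False
        then show ?thesis using M(1)[of "m + 1"] by simp
      qed
    qed
  next
    assume u: "unimodal F"
    have "principal_mult F (int m + 1) \<le> principal_mult F (int m)" if "1 \<le> m" for m
      using u that by (simp add: unimodal_def)
    then show "\<forall>m\<in>{1..M}. ooms (m + 1) \<le> ooms m" by (auto simp: ooms_def add.commute)
  qed
  finally show ?thesis .
qed

end

end

section \<open>Lax equations\<close>

definition mat_prod :: "nat \<Rightarrow> (nat \<Rightarrow> nat \<Rightarrow> complex) \<Rightarrow> (nat \<Rightarrow> nat \<Rightarrow> complex) \<Rightarrow> nat \<Rightarrow> nat \<Rightarrow> complex" where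
  "mat_prod N A B i j = (\<Sum>k<N. A i k * B k j)"

text \<open>
  The equation \<open>M' = M Y - Y M\<close> on \<open>S\<close>, entrywise for the entries with indices below \<open>N\<close>.
\<close>

definition lax :: "nat \<Rightarrow> complex set \<Rightarrow> (complex \<Rightarrow> nat \<Rightarrow> nat \<Rightarrow> complex) \<Rightarrow> (complex \<Rightarrow> nat \<Rightarrow> nat \<Rightarrow> complex) \<Rightarrow> bool" where
  "lax N S Y M \<longleftrightarrow> (\<forall>s\<in>S. \<forall>i<N. \<forall>j<N.
     ((\<lambda>s. M s i j) has_field_derivative
        (mat_prod N (M s) (Y s) i j - mat_prod N (Y s) (M s) i j)) (at s))"

lemma mat_prod_assoc: "mat_prod N (mat_prod N A B) C = mat_prod N A (mat_prod N B C)"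
proof (intro ext)
  fix i j
  have "mat_prod N (mat_prod N A B) C i j = (\<Sum>k<N. \<Sum>l<N. A i l * B l k * C k j)"
    by (simp add: mat_prod_def sum_distrib_right)
  also have "\<dots> = (\<Sum>l<N. \<Sum>k<N. A i l * B l k * C k j)" by (rule sum.swap)
  also have "\<dots> = mat_prod N A (mat_prod N B C) i j"
    by (simp add: mat_prod_def sum_distrib_left mult.assoc)
  finally show "mat_prod N (mat_prod N A B) C i j = mat_prod N A (mat_prod N B C) i j" .
qed

text \<open>
  The commutator with \<open>Y\<close> is a derivation, as is differentiation.
\<close>

lemma lax_prod:
  assumes "lax N S Y A" "lax N S Y B"
  shows "lax N S Y (\<lambda>s. mat_prod N (A s) (B s))"
  unfolding lax_def
proof (intro ballI allI impI)
  fix s i j assume s: "s \<in> S" and ij: "i < N" "j < N"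
  let ?dA = "\<lambda>i j. mat_prod N (A s) (Y s) i j - mat_prod N (Y s) (A s) i j"
  let ?dB = "\<lambda>i j. mat_prod N (B s) (Y s) i j - mat_prod N (Y s) (B s) i j"
  have "((\<lambda>s. mat_prod N (A s) (B s) i j) has_field_derivative
      (\<Sum>k<N. ?dA i k * B s k j + ?dB k j * A s i k)) (at s)"
    unfolding mat_prod_def[of N "A _" "B _"]
    using assms s ij unfolding lax_def by (intro DERIV_sum DERIV_mult) auto
  moreover have "(\<Sum>k<N. ?dA i k * B s k j + ?dB k j * A s i k) =
      mat_prod N (mat_prod N (A s) (Y s)) (B s) i j - mat_prod N (mat_prod N (Y s) (A s)) (B s) i j +
      (mat_prod N (A s) (mat_prod N (B s) (Y s)) i j - mat_prod N (A s) (mat_prod N (Y s) (B s)) i j)"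
    unfolding mat_prod_def[of N "mat_prod _ _ _"] mat_prod_def[of N "A s" "mat_prod _ _ _"]
    by (simp add: algebra_simps sum.distrib sum_subtractf)
  ultimately show "((\<lambda>s. mat_prod N (A s) (B s) i j) has_field_derivative
      (mat_prod N (mat_prod N (A s) (B s)) (Y s) i j - mat_prod N (Y s) (mat_prod N (A s) (B s)) i j)) (at s)"
    by (simp add: mat_prod_assoc)
qed

lemma lax_diff_scale:
  assumes "lax N S Y A" "lax N S Y B"
  shows "lax N S Y (\<lambda>s i j. A s i j - c * B s i j)"
  unfolding lax_def
proof (intro ballI allI impI)
  fix s i j assume s: "s \<in> S" and ij: "i < N" "j < N"
  have "((\<lambda>s. A s i j - c * B s i j) has_field_derivative
     ((mat_prod N (A s) (Y s) i j - mat_prod N (Y s) (A s) i j) - c * (mat_prod N (B s) (Y s) i j - mat_prod N (Y s) (B s) i j))) (at s)"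
    using assms s ij unfolding lax_def by (intro DERIV_diff DERIV_cmult) auto
  then show "((\<lambda>s. A s i j - c * B s i j) has_field_derivative
     (mat_prod N (\<lambda>i j. A s i j - c * B s i j) (Y s) i j - mat_prod N (Y s) (\<lambda>i j. A s i j - c * B s i j) i j)) (at s)"
    by (simp add: mat_prod_def algebra_simps sum_subtractf sum_distrib_left)
qed

lemma lax_identity: "lax N S Y (\<lambda>s i j. if i = j then 1 else 0)"
  unfolding lax_def
proof (intro ballI allI impI)
  fix s i j assume ij: "i < N" "j < N"
  have "mat_prod N (\<lambda>i j. if i = j then 1 else 0) (Y s) i j = Y s i j"
       "mat_prod N (Y s) (\<lambda>i j. if i = j then 1 else 0) i j = Y s i j"
    using ij by (auto simp: mat_prod_def if_distrib[of "\<lambda>x. x * _"] if_distrib[of "\<lambda>x. _ * x"] cong: if_cong)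
  then show "((\<lambda>s. if i = j then 1 else 0) has_field_derivative
     (mat_prod N (\<lambda>i j. if i = j then 1 else 0) (Y s) i j - mat_prod N (Y s) (\<lambda>i j. if i = j then 1 else 0) i j)) (at s)"
    by simp
qed

lemma lax_trace_constant:
  assumes "lax N S Y M" "open S" "connected S" "s \<in> S" "s' \<in> S"
  shows "(\<Sum>i<N. M s i i) = (\<Sum>i<N. M s' i i)"
proof -
  have d: "((\<lambda>s. \<Sum>i<N. M s i i) has_field_derivative 0) (at s)" if "s \<in> S" for s
  proof -
    have "((\<lambda>s. \<Sum>i<N. M s i i) has_field_derivative
       (\<Sum>i<N. mat_prod N (M s) (Y s) i i - mat_prod N (Y s) (M s) i i)) (at s)"
      using assms(1) that unfolding lax_def by (intro DERIV_sum) auto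
    moreover have "(\<Sum>i<N. mat_prod N (M s) (Y s) i i) = (\<Sum>i<N. mat_prod N (Y s) (M s) i i)"
      unfolding mat_prod_def by (subst sum.swap) (simp add: mult.commute)
    ultimately show ?thesis by (simp add: sum_subtractf)
  qed
  have "(\<lambda>s. \<Sum>i<N. M s i i) constant_on S"
    using d assms(2,3) by (intro has_field_derivative_0_imp_constant_on)
  then show ?thesis using assms(4,5) by (auto simp: constant_on_def)
qed

text \<open>
  The equation expresses each derivative of \<open>M\<close> at \<open>s\<^sub>0\<close> by lower ones, so all of them vanish, and the
  identity theorem spreads the zero over the connected set \<open>S\<close>.
\<close>

lemma lax_zero:
  assumes M: "lax N S Y M" and S: "open S" "connected S"
    and Y: "\<And>i j. i < N \<Longrightarrow> j < N \<Longrightarrow> (\<lambda>s. Y s i j) holomorphic_on S"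
    and s0: "s0 \<in> S" "\<And>i j. i < N \<Longrightarrow> j < N \<Longrightarrow> M s0 i j = 0"
    and "s \<in> S" "i < N" "j < N"
  shows "M s i j = 0"
proof -
  have holM: "(\<lambda>s. M s i j) holomorphic_on S" if "i < N" "j < N" for i j
    using M S(1) that unfolding lax_def by (auto simp: holomorphic_on_open)
  have all: "(deriv ^^ n) (\<lambda>s. M s i j) s0 = 0" if "i < N" "j < N" for n i j
    using that
  proof (induction n arbitrary: i j rule: less_induct)
    case (less n)
    show ?case
    proof (cases n)
      case 0
      then show ?thesis using s0 less.prems by simp
    next
      case (Suc m)
      let ?L = "\<lambda>s. (\<Sum>k<N. M s i k * Y s k j) - (\<Sum>k<N. Y s i k * M s k j)"
      have hol: "(\<lambda>s. M s i k * Y s k j) holomorphic_on S" "(\<lambda>s. Y s i k * M s k j) holomorphic_on S"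
        if "k < N" for k
        using that less.prems holM Y by (auto intro!: holomorphic_intros)
      have z: "(deriv ^^ m) (\<lambda>s. M s i k * Y s k j) s0 = 0" "(deriv ^^ m) (\<lambda>s. Y s i k * M s k j) s0 = 0"
        if k: "k < N" for k
      proof -
        have "(deriv ^^ m) (\<lambda>s. M s i k * Y s k j) s0 =
           (\<Sum>q = 0..m. of_nat (m choose q) * (deriv ^^ q) (\<lambda>s. M s i k) s0 * (deriv ^^ (m - q)) (\<lambda>s. Y s k j) s0)"
          using k less.prems by (intro higher_deriv_mult[OF holM Y S(1) s0(1)])
        then show "(deriv ^^ m) (\<lambda>s. M s i k * Y s k j) s0 = 0"
          using less.IH[of _ i k] k less.prems Suc by simp
        have "(deriv ^^ m) (\<lambda>s. Y s i k * M s k j) s0 =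
           (\<Sum>q = 0..m. of_nat (m choose q) * (deriv ^^ q) (\<lambda>s. Y s i k) s0 * (deriv ^^ (m - q)) (\<lambda>s. M s k j) s0)"
          using k less.prems by (intro higher_deriv_mult[OF Y holM S(1) s0(1)])
        then show "(deriv ^^ m) (\<lambda>s. Y s i k * M s k j) s0 = 0"
          using less.IH[of _ k j] k less.prems Suc by simp
      qed
      have sums: "(deriv ^^ m) (\<lambda>s. \<Sum>k\<in>K. f k s) s0 = (\<Sum>k\<in>K. (deriv ^^ m) (f k) s0)"
        if "finite K" "\<And>k. k \<in> K \<Longrightarrow> f k holomorphic_on S" for K :: "nat set" and f
        using that
      proof (induction K rule: finite_induct)
        case (insert x K)
        have "(deriv ^^ m) (\<lambda>s. f x s + (\<Sum>k\<in>K. f k s)) s0 =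
            (deriv ^^ m) (f x) s0 + (deriv ^^ m) (\<lambda>s. \<Sum>k\<in>K. f k s) s0"
          using insert by (intro higher_deriv_add[OF _ _ S(1) s0(1)]) (auto intro!: holomorphic_intros)
        then show ?case using insert by simp
      qed (simp add: higher_deriv_const)
      have "(deriv ^^ Suc m) (\<lambda>s. M s i j) s0 = (deriv ^^ m) (deriv (\<lambda>s. M s i j)) s0"
        by (simp add: funpow_swap1)
      also have "\<dots> = (deriv ^^ m) ?L s0"
      proof (rule higher_deriv_cong_ev)
        show "\<forall>\<^sub>F s in nhds s0. deriv (\<lambda>s. M s i j) s = ?L s"
          using eventually_nhds_in_open[OF S(1) s0(1)]
        proof eventually_elim
          case (elim s)
          then show ?case using M less.prems unfolding lax_def mat_prod_def by (intro DERIV_imp_deriv) auto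
        qed
      qed simp
      also have "\<dots> = (deriv ^^ m) (\<lambda>s. \<Sum>k<N. M s i k * Y s k j) s0 - (deriv ^^ m) (\<lambda>s. \<Sum>k<N. Y s i k * M s k j) s0"
        using hol by (intro higher_deriv_diff[OF _ _ S(1) s0(1)] holomorphic_on_sum) auto
      also have "\<dots> = 0"
        using hol z by (subst (1 2) sums) auto
      finally show ?thesis using Suc by simp
    qed
  qed
  show ?thesis
    using holomorphic_fun_eq_0_on_connected[OF holM S all s0(1)] assms by auto
qed

lemma lax_cong:
  assumes "lax N S Y M" "\<And>s i j. i < N \<Longrightarrow> j < N \<Longrightarrow> M s i j = M' s i j"
  shows "lax N S Y M'"
proof -
  have "(\<lambda>s. M' s i j) = (\<lambda>s. M s i j)" if "i < N" "j < N" for i j using assms(2) that by auto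
  moreover have "mat_prod N (M' s) (Y s) i j = mat_prod N (M s) (Y s) i j"
    "mat_prod N (Y s) (M' s) i j = mat_prod N (Y s) (M s) i j" if "i < N" "j < N" for s i j
    using assms(2) that by (auto simp: mat_prod_def)
  ultimately show ?thesis using assms(1) by (simp add: lax_def)
qed

section \<open>Independence of the principal spectrum\<close>

context fin_dim_lie_algebra begin

text \<open>
  The operator \<open>(ad H - c\<^sub>1) \<dots> (ad H - c\<^sub>k)\<close> for the list of the numbers \<open>c\<^sub>i\<close>.
\<close>

definition ad_polynomial :: "'a \<Rightarrow> complex list \<Rightarrow> 'a \<Rightarrow> 'a" where
  "ad_polynomial H cs x = foldr (\<lambda>c y. bracket H y - scale c y) cs x"

lemma ad_polynomial_simps [simp]:
  "ad_polynomial H [] x = x"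
  "ad_polynomial H (c # cs) x = bracket H (ad_polynomial H cs x) - scale c (ad_polynomial H cs x)"
  by (simp_all add: ad_polynomial_def)

lemma linear_operator_ad_polynomial: "H \<in> \<gg> \<Longrightarrow> linear_operator (ad_polynomial H cs)"
proof (induction cs)
  case (Cons c cs)
  note IH = Cons.IH[OF Cons.prems] and ad = linear_operator_ad[OF Cons.prems]
  show ?case
    unfolding linear_operator_def
  proof (intro conjI ballI allI)
    fix x y k assume x: "x \<in> \<gg>"
    note p = operator_mem[OF IH x]
    show "ad_polynomial H (c # cs) x \<in> \<gg>" using p ad by (simp add: mem_diff mem_scale operator_mem)
    show "ad_polynomial H (c # cs) (scale k x) = scale k (ad_polynomial H (c # cs) x)"
      using x p IH ad by (simp add: operator_scale scale_right_diff_distrib mult.commute)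
    assume y: "y \<in> \<gg>"
    show "ad_polynomial H (c # cs) (x + y) = ad_polynomial H (c # cs) x + ad_polynomial H (c # cs) y"
      using x y p operator_mem[OF IH y] IH ad by (simp add: operator_add scale_right_distrib algebra_simps)
  qed
qed (auto simp: linear_operator_def)

lemma ad_polynomial_eigenvector:
  "H \<in> \<gg> \<Longrightarrow> x \<in> ad_eigenspace H d \<Longrightarrow> ad_polynomial H cs x = scale (\<Prod>c\<leftarrow>cs. d - c) x"
  by (induction cs) (auto simp: ad_eigenspace_iff bracket_scale_right scale_left_diff_distrib algebra_simps)

text \<open>
  An operator annihilated by a polynomial with simple roots is diagonalizable. Peeling off the first
  root \<open>c\<close>: the remaining factors map \<open>x\<close> to an eigenvector for \<open>c\<close>, and subtracting the right multiple
  of that eigenvector from \<open>x\<close> leaves an element that they annihilate.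
\<close>

lemma ad_polynomial_kernel:
  assumes H: "H \<in> \<gg>" and "distinct cs" "x \<in> \<gg>" "ad_polynomial H cs x = 0"
  shows "x \<in> span (\<Union>c\<in>set cs. ad_eigenspace H c)"
  using assms(2-)
proof (induction cs arbitrary: x)
  case Nil
  then show ?case by (simp add: span_zero)
next
  case (Cons c cs)
  note lin = linear_operator_ad_polynomial[OF H]
  let ?y = "ad_polynomial H cs x" and ?k = "\<Prod>d\<leftarrow>cs. c - d"
  have k: "?k \<noteq> 0" using Cons.prems(1) by (auto simp: prod_list_zero_iff)
  have y: "?y \<in> ad_eigenspace H c"
    using Cons.prems operator_mem[OF lin] by (simp add: ad_eigenspace_iff)
  have yg: "?y \<in> \<gg>" using y by (simp add: ad_eigenspace_iff)
  let ?z = "x - scale (1 / ?k) ?y"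
  have z: "?z \<in> \<gg>" using Cons.prems(2) yg by (simp add: mem_diff mem_scale)
  have "ad_polynomial H cs ?z = ?y - scale (1 / ?k) (scale ?k ?y)"
    using operator_diff[OF lin Cons.prems(2) mem_scale[OF yg]] operator_scale[OF lin yg]
      ad_polynomial_eigenvector[OF H y] by simp
  then have "ad_polynomial H cs ?z = 0" using k by simp
  then have "?z \<in> span (\<Union>c\<in>set cs. ad_eigenspace H c)"
    using Cons.IH[OF _ z] Cons.prems(1) by simp
  then have "?z \<in> span (\<Union>c\<in>set (c # cs). ad_eigenspace H c)"
    using span_mono[of "\<Union>c\<in>set cs. ad_eigenspace H c" "\<Union>c\<in>set (c # cs). ad_eigenspace H c"] by auto
  then have "?z + scale (1 / ?k) ?y \<in> span (\<Union>c\<in>set (c # cs). ad_eigenspace H c)"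
    by (rule span_add[OF _ span_scale[OF span_base]]) (use y in auto)
  then show ?case by simp
qed

text \<open>
  The left side is the trace of \<open>T\<close> in the chosen coordinates. The image of \<open>T\<close> lies in one eigenspace,
  so the trace can be computed in a basis of that space instead.
\<close>

lemma coordinate_trace:
  assumes cs: "coordinate_system N b \<rho>" and H: "H \<in> \<gg>" and ss: "ad_semisimple H"
    and T: "linear_operator T" and scal: "\<And>x. x \<in> ad_eigenspace H c \<Longrightarrow> T x = scale k x"
    and zero: "\<And>d x. d \<noteq> c \<Longrightarrow> x \<in> ad_eigenspace H d \<Longrightarrow> T x = 0"
  shows "(\<Sum>i<N. \<rho> i (T (b i))) = k * of_nat (dim (ad_eigenspace H c))"
proof -
  note sub = subspace_ad_eigenspace[OF H]
  obtain B where B: "finite B" "independent B" "span B = ad_eigenspace H c" "card B = dim (ad_eigenspace H c)"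
    using subspace_finite_basis[OF sub ad_eigenspace_subset] by blast
  have b: "\<And>i. i < N \<Longrightarrow> b i \<in> \<gg>" and \<rho>: "\<And>i. i < N \<Longrightarrow> linear_functional (\<rho> i)"
    and ex: "\<And>x. x \<in> \<gg> \<Longrightarrow> x = (\<Sum>i<N. scale (\<rho> i x) (b i))"
    using cs by (auto simp: coordinate_system_def)
  have TV: "T x \<in> span B" if x: "x \<in> \<gg>" for x
  proof -
    obtain v where v: "\<And>c. v c \<in> ad_eigenspace H c" "x = (\<Sum>c | ad_eigenspace H c \<noteq> {0}. v c)"
      using ad_semisimple_decompose[OF H ss x] by blast
    have "T x = (\<Sum>d | ad_eigenspace H d \<noteq> {0}. T (v d))"
      unfolding v(2) using v(1) ad_eigenspace_subset by (intro operator_sum[OF T]) auto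
    also have "\<dots> \<in> span B"
    proof (intro span_sum)
      fix d show "T (v d) \<in> span B"
        using zero[of d "v d"] scal[of "v d"] v(1)[of d] v(1)[of c] B(3) subspace_scale[OF sub]
        by (cases "d = c") (auto simp: span_zero)
    qed
    finally show ?thesis .
  qed
  define \<phi> where "\<phi> u x = representation B (T x) u" for u x
  have lin\<phi>: "linear_functional (\<phi> u)" for u
    unfolding linear_functional_def \<phi>_def using TV T
    by (auto simp: operator_add operator_scale representation_add[OF B(2)] representation_scale[OF B(2)])
  have Bg: "u \<in> ad_eigenspace H c" "u \<in> \<gg>" if "u \<in> B" for u
    using that B(3) span_base[OF that] by (auto simp: ad_eigenspace_iff)
  have Tb: "T x = (\<Sum>u\<in>B. scale (\<phi> u x) u)" if "x \<in> \<gg>" for x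
    unfolding \<phi>_def using sum_representation_eq[OF B(2) TV[OF that] B(1)] by simp
  have "(\<Sum>i<N. \<rho> i (T (b i))) = (\<Sum>i<N. \<Sum>u\<in>B. \<phi> u (b i) * \<rho> i u)"
  proof (intro sum.cong refl)
    fix i assume "i \<in> {..<N}"
    then have i: "i < N" by simp
    have "\<rho> i (T (b i)) = (\<Sum>u\<in>B. \<rho> i (scale (\<phi> u (b i)) u))"
      unfolding Tb[OF b[OF i]] using Bg mem_scale by (intro functional_sum[OF \<rho>[OF i]]) auto
    then show "\<rho> i (T (b i)) = (\<Sum>u\<in>B. \<phi> u (b i) * \<rho> i u)"
      using functional_scale[OF \<rho>[OF i]] Bg by simp
  qed
  also have "\<dots> = (\<Sum>u\<in>B. \<Sum>i<N. \<phi> u (scale (\<rho> i u) (b i)))"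
    by (subst sum.swap) (use functional_scale[OF lin\<phi>] b in \<open>simp add: mult.commute\<close>)
  also have "\<dots> = (\<Sum>u\<in>B. \<phi> u u)"
  proof (intro sum.cong refl)
    fix u assume u: "u \<in> B"
    have "\<phi> u u = \<phi> u (\<Sum>i<N. scale (\<rho> i u) (b i))" using ex[OF Bg(2)[OF u]] by simp
    also have "\<dots> = (\<Sum>i<N. \<phi> u (scale (\<rho> i u) (b i)))"
      using b mem_scale by (intro functional_sum[OF lin\<phi>]) auto
    finally show "(\<Sum>i<N. \<phi> u (scale (\<rho> i u) (b i))) = \<phi> u u" by simp
  qed
  also have "\<dots> = (\<Sum>u\<in>B. k)"
  proof (intro sum.cong refl)
    fix u assume u: "u \<in> B"
    show "\<phi> u u = k"
      unfolding \<phi>_def scal[OF Bg(1)[OF u]]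
      using representation_scale[OF B(2) span_base[OF u]] representation_basis[OF B(2) u] by simp
  qed
  also have "\<dots> = k * of_nat (dim (ad_eigenspace H c))" using B(4) by simp
  finally show ?thesis .
qed

lemma operator_coordinates:
  assumes cs: "coordinate_system N b \<rho>" and T: "linear_operator T" and x: "x \<in> \<gg>" and i: "i < N"
  shows "\<rho> i (T x) = (\<Sum>k<N. \<rho> i (T (b k)) * \<rho> k x)"
proof -
  have b: "\<And>i. i < N \<Longrightarrow> b i \<in> \<gg>" and \<rho>: "linear_functional (\<rho> i)"
    and ex: "x = (\<Sum>i<N. scale (\<rho> i x) (b i))"
    using cs x i by (auto simp: coordinate_system_def)
  have "T x = (\<Sum>k<N. T (scale (\<rho> k x) (b k)))"
    by (subst ex) (use b mem_scale in \<open>auto intro!: operator_sum[OF T]\<close>)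
  then have "\<rho> i (T x) = (\<Sum>k<N. \<rho> i (T (scale (\<rho> k x) (b k))))"
    using b mem_scale operator_mem[OF T] by (auto intro!: functional_sum[OF \<rho>])
  then show ?thesis
    using b operator_scale[OF T] functional_scale[OF \<rho> operator_mem[OF T]] by (simp add: mult.commute)
qed

lemma jacobi_derivation:
  assumes "x \<in> \<gg>" "y \<in> \<gg>" "z \<in> \<gg>"
  shows "bracket (bracket x y) z = bracket x (bracket y z) - bracket y (bracket x z)"
proof -
  have 1: "bracket (bracket x y) z = - bracket z (bracket x y)"
    by (rule bracket_antisym) (use assms bracket_closed in auto)
  have 2: "bracket y (bracket z x) = - bracket y (bracket x z)"
    using bracket_antisym[OF assms(3,1)] bracket_scale_right[OF assms(2) bracket_closed[OF assms(1,3)], of "-1"] by simp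
  have "bracket x (bracket y z) - bracket y (bracket x z) = - bracket z (bracket x y)"
    unfolding eq_neg_iff_add_eq_0 using jacobi[OF assms] 2 by simp
  then show ?thesis using 1 by simp
qed

text \<open>
  The path \<open>H s\<close> consists of the principal elements of the functionals \<open>F0 + s (F1 - F0)\<close>, and \<open>S\<close> is the
  set of \<open>s\<close> for which this functional is Frobenius: the complement of the finitely many zeros of
  one polynomial, hence connected.
\<close>

lemma lax_deformation:
  assumes F0: "frobenius_functional F0" and F1: "frobenius_functional F1"
    and cs: "coordinate_system N b \<rho>"
  obtains S H Y where "open S" "connected S" "0 \<in> S" "1 \<in> S"
    "\<And>s. s \<in> S \<Longrightarrow> H s \<in> \<gg>" "H 0 = principal_element F0" "H 1 = principal_element F1"
    "\<And>i j. i < N \<Longrightarrow> j < N \<Longrightarrow> (\<lambda>s. Y s i j) holomorphic_on S"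
    "lax N S Y (\<lambda>s i j. \<rho> i (bracket (H s) (b j)))"
proof -
  have b: "\<And>i. i < N \<Longrightarrow> b i \<in> \<gg>" and ex: "\<And>x. x \<in> \<gg> \<Longrightarrow> x = (\<Sum>i<N. scale (\<rho> i x) (b i))"
    and \<rho>: "\<And>i. i < N \<Longrightarrow> linear_functional (\<rho> i)"
    and \<rho>b: "\<And>i j. i < N \<Longrightarrow> j < N \<Longrightarrow> \<rho> i (b j) = (if i = j then 1 else 0)"
    using cs by (auto simp: coordinate_system_def)
  have l0: "linear_functional F0" and l1: "linear_functional F1"
    using F0 F1 frobenius_functional_iff by auto
  define G where "G x = F1 x - F0 x" for x
  define Fs where "Fs s x = F0 x + s * G x" for s x
  have lG: "linear_functional G" using l0 l1 by (auto simp: linear_functional_def G_def algebra_simps)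
  have lFs: "linear_functional (Fs s)" for s
    using l0 lG by (auto simp: linear_functional_def Fs_def algebra_simps)
  have Fs0: "Fs 0 = F0" and Fs1: "Fs 1 = F1" by (auto simp: Fs_def G_def)
  have lin_sum: "f (bracket (\<Sum>j<N. scale (v j) (b j)) y) = (\<Sum>j<N. v j * f (bracket (b j) y))"
    if "linear_functional f" "y \<in> \<gg>" for v y f
  proof -
    note l = linear_functional_bracket_left[OF that]
    have "f (bracket (\<Sum>j<N. scale (v j) (b j)) y) = (\<Sum>j<N. f (bracket (scale (v j) (b j)) y))"
      by (rule functional_sum[OF l]) (use b mem_scale in auto)
    then show ?thesis using functional_scale[OF l] b by simp
  qed
  have comb: "(\<Sum>j<N. scale (v j) (b j)) \<in> \<gg>" for v
    using b mem_scale by (intro mem_sum) auto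
  have basis_ext: "f x = g x" if "linear_functional f" "linear_functional g" "x \<in> \<gg>"
    "\<And>i. i < N \<Longrightarrow> f (b i) = g (b i)" for f g x
  proof -
    have "f (\<Sum>i<N. scale (\<rho> i x) (b i)) = (\<Sum>i<N. f (scale (\<rho> i x) (b i)))"
      using b mem_scale by (intro functional_sum that(1)) auto
    also have "\<dots> = (\<Sum>i<N. g (scale (\<rho> i x) (b i)))"
      using b functional_scale[OF that(1)] functional_scale[OF that(2)] that(4) by (intro sum.cong) auto
    also have "\<dots> = g (\<Sum>i<N. scale (\<rho> i x) (b i))"
      using b mem_scale by (intro functional_sum[symmetric] that(2)) auto
    finally have "f (\<Sum>i<N. scale (\<rho> i x) (b i)) = g (\<Sum>i<N. scale (\<rho> i x) (b i))" .
    then show ?thesis using ex[OF that(3)] by simp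
  qed
  define C where "C i j = [:F0 (bracket (b j) (b i)), G (bracket (b j) (b i)):]" for i j
  have C: "poly (C i j) s = Fs s (bracket (b j) (b i))" for i j s
    by (simp add: C_def Fs_def)
  obtain D P where D: "\<And>s. poly D s \<noteq> 0 \<longleftrightarrow>
       (\<forall>v. (\<forall>i<N. (\<Sum>j<N. poly (C i j) s * v j) = 0) \<longrightarrow> (\<forall>j<N. v j = 0))"
    and P: "\<And>s i k. i < N \<Longrightarrow> k < N \<Longrightarrow>
       (\<Sum>j<N. poly (C i j) s * poly (P j k) s) = (if i = k then poly D s else 0)"
    by (rule adjugate_family[of N C]) blast
  have zero_comb: "v j = 0" if "(\<Sum>j<N. scale (v j) (b j)) = 0" "j < N" for v j
  proof -
    have "\<rho> j (\<Sum>k<N. scale (v k) (b k)) = (\<Sum>k<N. \<rho> j (scale (v k) (b k)))"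
      using b mem_scale by (intro functional_sum[OF \<rho>[OF that(2)]]) auto
    also have "\<dots> = (\<Sum>k<N. v k * (if j = k then 1 else 0))"
      using b \<rho>b[OF that(2)] functional_scale[OF \<rho>[OF that(2)]] by simp
    also have "\<dots> = v j" using that(2) by (simp add: if_distrib cong: if_cong)
    finally show ?thesis using that functional_0[OF \<rho>[OF that(2)]] by simp
  qed
  have frob: "frobenius_functional (Fs s) \<longleftrightarrow> poly D s \<noteq> 0" for s
  proof
    assume fr: "frobenius_functional (Fs s)"
    show "poly D s \<noteq> 0"
      unfolding D
    proof (intro allI impI)
      fix v j assume v: "\<forall>i<N. (\<Sum>j<N. poly (C i j) s * v j) = 0" and j: "j < N"
      let ?x = "\<Sum>j<N. scale (v j) (b j)"
      have "Fs s (bracket ?x y) = 0" if y: "y \<in> \<gg>" for y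
      proof (rule basis_ext[of "\<lambda>y. Fs s (bracket ?x y)" "\<lambda>_. 0"])
        show "linear_functional (\<lambda>y. Fs s (bracket ?x y))"
          by (rule linear_functional_bracket_right[OF lFs comb])
        show "Fs s (bracket ?x (b i)) = 0" if "i < N" for i
          using lin_sum[OF lFs b[OF that]] v that by (simp add: C mult.commute)
      qed (use y in \<open>auto simp: linear_functional_def\<close>)
      then have "?x = 0" using fr comb[of v] unfolding frobenius_functional_iff by blast
      then show "v j = 0" using zero_comb j by blast
    qed
  next
    assume d: "poly D s \<noteq> 0"
    show "frobenius_functional (Fs s)"
      unfolding frobenius_functional_iff
    proof (intro conjI ballI impI lFs)
      fix x assume x: "x \<in> \<gg>" and z: "\<forall>y\<in>\<gg>. Fs s (bracket x y) = 0"
      have rows: "(\<Sum>j<N. poly (C i j) s * \<rho> j x) = 0" if i: "i < N" for i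
      proof -
        have "(\<Sum>j<N. poly (C i j) s * \<rho> j x) = Fs s (bracket (\<Sum>j<N. scale (\<rho> j x) (b j)) (b i))"
          using lin_sum[OF lFs b[OF i]] by (simp add: C mult.commute)
        also have "\<dots> = 0" unfolding ex[OF x, symmetric] using z b[OF i] by simp
        finally show ?thesis .
      qed
      have "\<forall>v. (\<forall>i<N. (\<Sum>j<N. poly (C i j) s * v j) = 0) \<longrightarrow> (\<forall>j<N. v j = 0)"
        using d unfolding D .
      from spec[OF this, of "\<lambda>j. \<rho> j x"] have "\<And>j. j < N \<Longrightarrow> \<rho> j x = 0"
        using rows by simp
      then show "x = 0" by (rule coordinate_unique[OF cs x])
    qed
  qed
  define S where "S = {s. poly D s \<noteq> 0}"
  have S01: "0 \<in> S" "1 \<in> S" using frob[of 0] frob[of 1] F0 F1 by (auto simp: S_def Fs0 Fs1)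
  then have "D \<noteq> 0" by (auto simp: S_def)
  then have fin: "finite {s. poly D s = 0}" by (rule poly_roots_finite)
  have Seq: "S = - {s. poly D s = 0}" by (auto simp: S_def)
  have "open S" unfolding Seq using fin by (simp add: finite_imp_closed open_Compl)
  have "connected S"
    unfolding Seq Compl_eq_Diff_UNIV
    using fin by (intro connected_open_delete_finite) (auto simp: connected_UNIV)
  define sol where "sol g s j = (\<Sum>k<N. poly (P j k) s * g k s) / poly D s" for g s j
  have sol: "Fs s (bracket (\<Sum>j<N. scale (sol g s j) (b j)) (b i)) = g i s" if s: "s \<in> S" and i: "i < N" for g s i
  proof -
    have "Fs s (bracket (\<Sum>j<N. scale (sol g s j) (b j)) (b i))
        = (\<Sum>j<N. \<Sum>k<N. poly (C i j) s * poly (P j k) s * g k s / poly D s)"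
      unfolding lin_sum[OF lFs b[OF i]] C sol_def
      by (simp add: sum_divide_distrib sum_distrib_left sum_distrib_right mult_ac)
    also have "\<dots> = (\<Sum>k<N. (\<Sum>j<N. poly (C i j) s * poly (P j k) s) * g k s / poly D s)"
      by (subst sum.swap) (simp add: sum_distrib_right sum_divide_distrib)
    also have "\<dots> = (\<Sum>k<N. if i = k then g k s else 0)"
      using s i P by (intro sum.cong) (auto simp: S_def)
    also have "\<dots> = g i s" using i by simp
    finally show ?thesis .
  qed
  have hol_sol: "(\<lambda>s. sol g s j) holomorphic_on S" if "\<And>k. (\<lambda>s. g k s) holomorphic_on S" for g j
    unfolding sol_def using that by (auto intro!: holomorphic_intros simp: S_def)
  \<comment> \<open>The coordinates of the principal element and of the element that represents \<open>G\<close>.\<close>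
  define \<eta> where "\<eta> = sol (\<lambda>k s. Fs s (b k))"
  define \<zeta> where "\<zeta> = sol (\<lambda>k s. G (b k))"
  have hol\<eta>: "(\<lambda>s. \<eta> s j) holomorphic_on S" for j
    unfolding \<eta>_def by (rule hol_sol) (auto simp: Fs_def intro!: holomorphic_intros)
  have hol\<zeta>: "(\<lambda>s. \<zeta> s j) holomorphic_on S" for j
    unfolding \<zeta>_def by (rule hol_sol) (auto intro!: holomorphic_intros)
  define H where "H s = (\<Sum>j<N. scale (\<eta> s j) (b j))" for s
  define y where "y s = (\<Sum>j<N. scale (\<zeta> s j) (b j))" for s
  have Hg: "H s \<in> \<gg>" and yg: "y s \<in> \<gg>" for s unfolding H_def y_def by (rule comb)+
  have FH: "Fs s (bracket (H s) x) = Fs s x" if "s \<in> S" "x \<in> \<gg>" for s x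
  proof (rule basis_ext[of "\<lambda>x. Fs s (bracket (H s) x)" "Fs s"])
    show "Fs s (bracket (H s) (b i)) = Fs s (b i)" if "i < N" for i
      using sol[OF \<open>s \<in> S\<close> that, of "\<lambda>k s. Fs s (b k)"] by (simp add: H_def \<eta>_def)
  qed (use that linear_functional_bracket_right[OF lFs Hg] lFs in auto)
  have Fy: "Fs s (bracket (y s) x) = G x" if "s \<in> S" "x \<in> \<gg>" for s x
  proof (rule basis_ext[of "\<lambda>x. Fs s (bracket (y s) x)" G])
    show "Fs s (bracket (y s) (b i)) = G (b i)" if "i < N" for i
      using sol[OF \<open>s \<in> S\<close> that, of "\<lambda>k s. G (b k)"] by (simp add: y_def \<zeta>_def)
  qed (use that linear_functional_bracket_right[OF lFs yg] lG in auto)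
  define H' where "H' s = (\<Sum>j<N. scale (deriv (\<lambda>s. \<eta> s j) s) (b j))" for s
  have H'g: "H' s \<in> \<gg>" for s unfolding H'_def by (rule comb)
  have d\<eta>: "((\<lambda>s. \<eta> s j) has_field_derivative deriv (\<lambda>s. \<eta> s j) s) (at s)" if "s \<in> S" for s j
    by (rule holomorphic_derivI[OF hol\<eta> \<open>open S\<close> that])
  have H'_eq: "H' s = bracket (H s) (y s)" if s: "s \<in> S" for s
  proof (rule frobenius_separates[of "Fs s"])
    show "frobenius_functional (Fs s)" using s frob by (simp add: S_def)
    show "H' s \<in> \<gg>" "bracket (H s) (y s) \<in> \<gg>" using H'g Hg yg bracket_closed by auto
    fix x assume x: "x \<in> \<gg>"
    let ?f = "\<lambda>s. \<Sum>j<N. \<eta> s j * (F0 (bracket (b j) x) + s * G (bracket (b j) x))"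
    have f: "?f s = F0 x + s * G x" if "s \<in> S" for s
      using FH[OF that x] lin_sum[OF lFs x, of s "\<eta> s"] by (simp add: H_def Fs_def)
    have d1: "(?f has_field_derivative (\<Sum>j<N. deriv (\<lambda>s. \<eta> s j) s * (F0 (bracket (b j) x) + s * G (bracket (b j) x))
        + G (bracket (b j) x) * \<eta> s j)) (at s)"
      by (rule DERIV_sum) (rule DERIV_mult[OF d\<eta>[OF s]], auto intro!: derivative_eq_intros)
    have "(?f has_field_derivative G x) (at s)"
    proof (rule DERIV_cong_ev[THEN iffD1, OF refl _ refl])
      show "\<forall>\<^sub>F s in nhds s. F0 x + s * G x = ?f s"
        using eventually_nhds_in_open[OF \<open>open S\<close> s] by eventually_elim (use f in simp)
      show "((\<lambda>s. F0 x + s * G x) has_field_derivative G x) (at s)"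
        by (auto intro!: derivative_eq_intros)
    qed
    from DERIV_unique[OF d1 this]
    have "Fs s (bracket (H' s) x) + G (bracket (H s) x) = G x"
      unfolding H'_def H_def lin_sum[OF lFs x] lin_sum[OF lG x]
      by (simp add: Fs_def sum.distrib mult.commute)
    then have "Fs s (bracket (H' s) x) = Fs s (bracket (y s) x) - Fs s (bracket (y s) (bracket (H s) x))"
      using Fy[OF s x] Fy[OF s bracket_closed[OF Hg x]] by (simp add: algebra_simps)
    also have "Fs s (bracket (y s) x) = Fs s (bracket (H s) (bracket (y s) x))"
      using FH[OF s bracket_closed[OF yg x]] by simp
    also have "\<dots> - Fs s (bracket (y s) (bracket (H s) x)) = Fs s (bracket (bracket (H s) (y s)) x)"
      unfolding jacobi_derivation[OF Hg yg x]
      using Hg yg x bracket_closed by (simp add: functional_diff[OF lFs])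
    finally show "Fs s (bracket (H' s) x) = Fs s (bracket (bracket (H s) (y s)) x)" .
  qed
  define Y where "Y s i j = \<rho> i (bracket (y s) (b j))" for s i j
  have \<rho>lin: "\<rho> i (bracket (\<Sum>k<N. scale (v k) (b k)) (b j)) = (\<Sum>k<N. v k * \<rho> i (bracket (b k) (b j)))"
    if "i < N" "j < N" for i j v
    by (rule lin_sum[OF \<rho>[OF that(1)] b[OF that(2)]])
  have "lax N S Y (\<lambda>s i j. \<rho> i (bracket (H s) (b j)))"
    unfolding lax_def
  proof (intro ballI allI impI)
    fix s i j assume s: "s \<in> S" and i: "i < N" and j: "j < N"
    have "((\<lambda>s. \<Sum>k<N. \<eta> s k * \<rho> i (bracket (b k) (b j))) has_field_derivative
        (\<Sum>k<N. deriv (\<lambda>s. \<eta> s k) s * \<rho> i (bracket (b k) (b j)))) (at s)"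
      by (rule DERIV_sum) (rule DERIV_cmult_right[OF d\<eta>[OF s]])
    then have "((\<lambda>s. \<rho> i (bracket (H s) (b j))) has_field_derivative \<rho> i (bracket (H' s) (b j))) (at s)"
      unfolding H_def H'_def \<rho>lin[OF i j] .
    moreover have "\<rho> i (bracket (H' s) (b j)) =
        \<rho> i (bracket (H s) (bracket (y s) (b j))) - \<rho> i (bracket (y s) (bracket (H s) (b j)))"
      unfolding H'_eq[OF s] jacobi_derivation[OF Hg yg b[OF j]]
      using Hg yg b[OF j] bracket_closed by (simp add: functional_diff[OF \<rho>[OF i]])
    moreover have "\<rho> i (bracket (H s) (bracket (y s) (b j))) =
        mat_prod N (\<lambda>i j. \<rho> i (bracket (H s) (b j))) (Y s) i j"
      unfolding mat_prod_def Y_def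
      by (rule operator_coordinates[OF cs linear_operator_ad[OF Hg] bracket_closed[OF yg b[OF j]] i])
    moreover have "\<rho> i (bracket (y s) (bracket (H s) (b j))) =
        mat_prod N (Y s) (\<lambda>i j. \<rho> i (bracket (H s) (b j))) i j"
      unfolding mat_prod_def Y_def
      by (rule operator_coordinates[OF cs linear_operator_ad[OF yg] bracket_closed[OF Hg b[OF j]] i])
    ultimately show "((\<lambda>s. \<rho> i (bracket (H s) (b j))) has_field_derivative
        (mat_prod N (\<lambda>i j. \<rho> i (bracket (H s) (b j))) (Y s) i j
         - mat_prod N (Y s) (\<lambda>i j. \<rho> i (bracket (H s) (b j))) i j)) (at s)"
      by simp
  qed
  moreover have "(\<lambda>s. Y s i j) holomorphic_on S" if "i < N" "j < N" for i j
    unfolding Y_def y_def \<rho>lin[OF that] by (auto intro!: holomorphic_intros hol\<zeta>)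
  moreover have "H 0 = principal_element F0" "H 1 = principal_element F1"
    using principal_element_eqI[OF F0 Hg[of 0]] principal_element_eqI[OF F1 Hg[of 1]]
      FH[OF S01(1), unfolded Fs0] FH[OF S01(2), unfolded Fs1] by simp_all
  ultimately show thesis using \<open>open S\<close> \<open>connected S\<close> S01 Hg by (intro that) auto
qed

end

context fin_dim_lie_algebra begin

text \<open>
  Over the complex numbers the Frobenius functionals form a single coadjoint orbit, so this is
  expected; the Lax equation replaces the group. The product of the factors \<open>ad (H s) - c\<close> over
  the eigenvalues \<open>c\<close> of \<open>ad (H 0)\<close> vanishes at \<open>s = 0\<close>, hence everywhere. Omitting one factor leaves a
  multiple of the projection to an eigenspace, whose trace is constant.
\<close>

theorem principal_spectrum_unique:
  assumes F0: "frobenius_functional F0" and F1: "frobenius_functional F1"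
    and grading: "semisimple_integral_grading F0"
  shows "semisimple_integral_grading F1" "principal_mult F1 = principal_mult F0"
proof -
  obtain N b \<rho> where cs: "coordinate_system N b \<rho>" by (rule coordinate_system_exists)
  have b: "\<And>i. i < N \<Longrightarrow> b i \<in> \<gg>" and \<rho>: "\<And>i. i < N \<Longrightarrow> linear_functional (\<rho> i)"
    and \<rho>b: "\<And>i j. i < N \<Longrightarrow> j < N \<Longrightarrow> \<rho> i (b j) = (if i = j then 1 else 0)"
    using cs by (auto simp: coordinate_system_def)
  obtain S H Y where S: "open S" "connected S" "0 \<in> S" "1 \<in> S" and Hg: "\<And>s. s \<in> S \<Longrightarrow> H s \<in> \<gg>"
    and H01: "H 0 = principal_element F0" "H 1 = principal_element F1"
    and Y: "\<And>i j. i < N \<Longrightarrow> j < N \<Longrightarrow> (\<lambda>s. Y s i j) holomorphic_on S"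
    and lax: "lax N S Y (\<lambda>s i j. \<rho> i (bracket (H s) (b j)))"
    by (rule lax_deformation[OF F0 F1 cs]) blast
  define Q where "Q l s i j = \<rho> i (ad_polynomial (H s) l (b j))" for l s i j
  \<comment> \<open>The matrices of all polynomials in \<open>ad (H s)\<close> satisfy the Lax equation.\<close>
  have laxQ: "lax N S Y (Q l)" for l
  proof (induction l)
    case Nil
    show ?case
      by (rule lax_cong[OF lax_identity]) (simp add: Q_def \<rho>b)
  next
    case (Cons c l)
    let ?P = "\<lambda>s i j. mat_prod N (\<lambda>i j. \<rho> i (bracket (H s) (b j))) (Q l s) i j - c * Q l s i j"
    have P: "lax N S Y ?P"
      by (rule lax_diff_scale[OF lax_prod[OF lax Cons.IH] Cons.IH])
    have eq: "Q (c # l) s i j = ?P s i j" if s: "s \<in> S" and i: "i < N" and j: "j < N" for s i j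
    proof -
      let ?x = "ad_polynomial (H s) l (b j)"
      have x: "?x \<in> \<gg>" using operator_mem[OF linear_operator_ad_polynomial[OF Hg[OF s]] b[OF j]] .
      have "\<rho> i (bracket (H s) ?x - scale c ?x) = \<rho> i (bracket (H s) ?x) - c * \<rho> i ?x"
        using x bracket_closed[OF Hg[OF s] x] \<rho>[OF i]
        by (simp add: functional_diff functional_scale mem_scale)
      then show ?thesis
        unfolding Q_def mat_prod_def
        using operator_coordinates[OF cs linear_operator_ad[OF Hg[OF s]] x i] by simp
    qed
    show ?case
      unfolding lax_def
    proof (intro ballI allI impI)
      fix s i j assume s: "s \<in> S" and ij: "i < N" "j < N"
      have d: "((\<lambda>s. ?P s i j) has_field_derivative
          (mat_prod N (?P s) (Y s) i j - mat_prod N (Y s) (?P s) i j)) (at s)"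
        using P s ij unfolding lax_def by blast
      have m: "mat_prod N (?P s) (Y s) i j = mat_prod N (Q (c # l) s) (Y s) i j"
        "mat_prod N (Y s) (?P s) i j = mat_prod N (Y s) (Q (c # l) s) i j"
        unfolding mat_prod_def[of N "?P s"] mat_prod_def[of N "Q (c # l) s"]
          mat_prod_def[of N "Y s" "?P s"] mat_prod_def[of N "Y s" "Q (c # l) s"]
        using eq[OF s] ij by auto
      show "((\<lambda>s. Q (c # l) s i j) has_field_derivative
          (mat_prod N (Q (c # l) s) (Y s) i j - mat_prod N (Y s) (Q (c # l) s) i j)) (at s)"
        unfolding m[symmetric]
      proof (rule DERIV_cong_ev[THEN iffD1, OF refl _ refl d])
        show "\<forall>\<^sub>F s in nhds s. ?P s i j = Q (c # l) s i j"
          using eventually_nhds_in_open[OF S(1) s] by eventually_elim (use eq ij in simp)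
      qed
    qed
  qed
  let ?E = "\<lambda>s c. ad_eigenspace (H s) c"
  have H0: "H 0 \<in> \<gg>" and H1: "H 1 \<in> \<gg>" using Hg S by auto
  have ss0: "ad_semisimple (H 0)" and int0: "\<And>c. ?E 0 c \<noteq> {0} \<Longrightarrow> c \<in> \<int>"
    using grading by (auto simp: semisimple_integral_grading_def H01)
  obtain es where es: "set es = {c. ?E 0 c \<noteq> {0}}" "distinct es"
    using finite_distinct_list[OF finite_eigenvalues[OF H0]] by blast
  have zero0: "ad_polynomial (H 0) es x = 0" if x: "x \<in> \<gg>" for x
  proof -
    note lin = linear_operator_ad_polynomial[OF H0]
    obtain v where v: "\<And>c. v c \<in> ?E 0 c" "x = (\<Sum>c | ?E 0 c \<noteq> {0}. v c)"
      using ad_semisimple_decompose[OF H0 ss0 x] by blast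
    have "ad_polynomial (H 0) es x = (\<Sum>c | ?E 0 c \<noteq> {0}. ad_polynomial (H 0) es (v c))"
      unfolding v(2) using v(1) ad_eigenspace_subset by (intro operator_sum[OF lin]) auto
    also have "\<dots> = 0"
    proof (intro sum.neutral ballI)
      fix c assume "c \<in> {c. ?E 0 c \<noteq> {0}}"
      then have "(\<Prod>d\<leftarrow>es. c - d) = 0" using es(1) by (auto simp: prod_list_zero_iff)
      then show "ad_polynomial (H 0) es (v c) = 0"
        using ad_polynomial_eigenvector[OF H0 v(1)[of c]] by simp
    qed
    finally show ?thesis .
  qed
  have zero1: "ad_polynomial (H 1) es x = 0" if x: "x \<in> \<gg>" for x
  proof (rule coordinate_unique[OF cs])
    note lin = linear_operator_ad_polynomial[OF H1]
    show "ad_polynomial (H 1) es x \<in> \<gg>" by (rule operator_mem[OF lin x])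
    fix i assume i: "i < N"
    have "Q es 0 i j = 0" if "i < N" "j < N" for i j
      using that zero0[OF b] functional_0[OF \<rho>] by (simp add: Q_def)
    then have "Q es 1 i j = 0" if "i < N" "j < N" for i j
      using lax_zero[OF laxQ S(1,2) Y S(3) _ S(4)] that by blast
    then show "\<rho> i (ad_polynomial (H 1) es x) = 0"
      using operator_coordinates[OF cs lin x i] i by (simp add: Q_def)
  qed
  have ss1: "ad_semisimple (H 1)"
    unfolding ad_semisimple_def
  proof
    show "span (\<Union>c. ?E 1 c) \<subseteq> \<gg>"
      using ad_eigenspace_subset by (intro span_minimal subspace_algebra) auto
    show "\<gg> \<subseteq> span (\<Union>c. ?E 1 c)"
    proof
      fix x assume x: "x \<in> \<gg>"
      have "x \<in> span (\<Union>c\<in>set es. ?E 1 c)"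
        by (rule ad_polynomial_kernel[OF H1 es(2) x zero1[OF x]])
      then show "x \<in> span (\<Union>c. ?E 1 c)" using span_mono[of "\<Union>c\<in>set es. ?E 1 c" "\<Union>c. ?E 1 c"] by auto
    qed
  qed
  have eig1: "c \<in> set es" if nz: "?E 1 c \<noteq> {0}" for c
  proof -
    obtain v where v: "v \<in> ?E 1 c" "v \<noteq> 0"
      using nz subspace_0[OF subspace_ad_eigenspace[OF H1], of c] by auto
    have "scale (\<Prod>d\<leftarrow>es. c - d) v = 0"
      using ad_polynomial_eigenvector[OF H1 v(1), of es] zero1[of v] v(1) by (simp add: ad_eigenspace_iff)
    then show ?thesis using v(2) by (auto simp: prod_list_zero_iff)
  qed
  show "semisimple_integral_grading F1"
    unfolding semisimple_integral_grading_def H01(2)[symmetric]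
    using ss1 eig1 es(1) int0 by blast
  have dims: "dim (?E 1 c) = dim (?E 0 c)" for c
  proof (cases "c \<in> set es")
    case False
    then have "?E 0 c = {0}" using es(1) by blast
    moreover have "?E 1 c = {0}" using False eig1[of c] by blast
    ultimately show ?thesis by simp
  next
    case True
    \<comment> \<open>Up to the factor \<open>k\<close>, this product is the projection to the eigenspace for \<open>c\<close>, for all \<open>s\<close>.\<close>
    define l where "l = removeAll c es"
    define k where "k = (\<Prod>d\<leftarrow>l. c - d)"
    have k: "k \<noteq> 0" by (auto simp: k_def l_def prod_list_zero_iff)
    have tr: "(\<Sum>i<N. Q l s i i) = k * of_nat (dim (?E s c))"
      if s: "s \<in> S" and ss: "ad_semisimple (H s)" and eig: "\<And>c. ?E s c \<noteq> {0} \<Longrightarrow> c \<in> set es" for s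
      unfolding Q_def
    proof (rule coordinate_trace[OF cs Hg[OF s] ss linear_operator_ad_polynomial[OF Hg[OF s]]])
      show "ad_polynomial (H s) l x = scale k x" if "x \<in> ?E s c" for x
        using ad_polynomial_eigenvector[OF Hg[OF s] that] by (simp add: k_def)
      fix d x assume d: "d \<noteq> c" and x: "x \<in> ?E s d"
      show "ad_polynomial (H s) l x = 0"
      proof (cases "?E s d = {0}")
        case True
        then show ?thesis using x operator_0[OF linear_operator_ad_polynomial[OF Hg[OF s]]] by auto
      next
        case False
        then have "d \<in> set l" using eig d by (auto simp: l_def)
        then have "(\<Prod>e\<leftarrow>l. d - e) = 0" by (auto simp: prod_list_zero_iff)
        then show ?thesis using ad_polynomial_eigenvector[OF Hg[OF s] x] by simp
      qed
    qed
    have "k * of_nat (dim (?E 1 c)) = k * of_nat (dim (?E 0 c))"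
      using tr[OF S(4) ss1 eig1] tr[OF S(3) ss0] es(1)
        lax_trace_constant[OF laxQ[of l] S(1,2) S(4) S(3)] by auto
    then show ?thesis using k by simp
  qed
  show "principal_mult F1 = principal_mult F0"
    by (rule ext) (simp add: principal_mult_def dims H01[symmetric])
qed

end

section \<open>Meander reduction\<close>

text \<open>
  The reflection of each block of a composition: the arcs of the meander join \<open>i\<close> to its mirror image.
\<close>

fun block_mirror :: "nat list \<Rightarrow> nat \<Rightarrow> nat" where
  "block_mirror [] i = i"
| "block_mirror (a # A) i = (if i \<le> a then a + 1 - i else a + block_mirror A (i - a))"

lemma block_index_append:
  "1 \<le> i \<Longrightarrow> block_index (A @ B) i =
     (if i \<le> sum_list A then block_index A i else length A + block_index B (i - sum_list A))"
  by (induction A arbitrary: i) auto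

lemma block_index_less_length: "1 \<le> i \<Longrightarrow> i \<le> sum_list A \<Longrightarrow> block_index A i < length A"
  by (induction A arbitrary: i) auto

lemma block_mirror_append:
  "1 \<le> i \<Longrightarrow> block_mirror (A @ B) i =
     (if i \<le> sum_list A then block_mirror A i else sum_list A + block_mirror B (i - sum_list A))"
  by (induction A arbitrary: i) auto

lemma block_mirror_range:
  "1 \<le> i \<Longrightarrow> i \<le> sum_list A \<Longrightarrow> 1 \<le> block_mirror A i \<and> block_mirror A i \<le> sum_list A"
proof (induction A arbitrary: i)
  case (Cons a A)
  show ?case
  proof (cases "i \<le> a")
    case False
    then have *: "1 \<le> i - a" "i - a \<le> sum_list A" using Cons.prems by auto
    show ?thesis using Cons.IH[OF *] False by auto
  qed (use Cons.prems in auto)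
qed auto

lemma block_mirror_involution:
  "1 \<le> i \<Longrightarrow> i \<le> sum_list A \<Longrightarrow> block_mirror A (block_mirror A i) = i"
proof (induction A arbitrary: i)
  case (Cons a A)
  show ?case
  proof (cases "i \<le> a")
    case False
    then have *: "1 \<le> i - a" "i - a \<le> sum_list A" using Cons.prems by auto
    show ?thesis using Cons.IH[OF *] block_mirror_range[OF *] False Cons.prems by auto
  qed (use Cons.prems in auto)
qed auto

lemma block_index_mono: "i \<le> j \<Longrightarrow> block_index A i \<le> block_index A j"
  by (induction A arbitrary: i j) auto

lemma block_mirror_rev:
  "1 \<le> i \<Longrightarrow> i \<le> sum_list A \<Longrightarrow>
     block_mirror (rev A) (sum_list A + 1 - i) = sum_list A + 1 - block_mirror A i"
proof (induction A arbitrary: i)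
  case (Cons a A)
  show ?case
  proof (cases "i \<le> a")
    case True
    then show ?thesis using Cons.prems by (auto simp: block_mirror_append)
  next
    case False
    then have *: "1 \<le> i - a" "i - a \<le> sum_list A" using Cons.prems by auto
    have e: "sum_list (a # A) + 1 - i = sum_list A + 1 - (i - a)" using False by auto
    show ?thesis unfolding e using Cons.IH[OF *] * False block_mirror_range[OF *]
      by (auto simp: block_mirror_append sum_list_rev)
  qed
qed auto

lemma block_index_rev:
  "1 \<le> i \<Longrightarrow> i \<le> sum_list A \<Longrightarrow>
     block_index (rev A) (sum_list A + 1 - i) + block_index A i + 1 = length A"
proof (induction A arbitrary: i)
  case (Cons a A)
  show ?case
  proof (cases "i \<le> a")
    case True
    then show ?thesis using Cons.prems by (auto simp: block_index_append)
  next
    case False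
    then have *: "1 \<le> i - a" "i - a \<le> sum_list A" using Cons.prems by auto
    have e: "sum_list (a # A) + 1 - i = sum_list A + 1 - (i - a)" using False by auto
    show ?thesis unfolding e using Cons.IH[OF *] * False
      by (auto simp: block_index_append sum_list_rev)
  qed
qed auto

text \<open>
  The positions of the matrix units in \<^term>\<open>seaweed n A B\<close> together with the diagonal; the indices
  range over \<open>{1..n}\<close> for the common sum \<open>n\<close> of \<open>A\<close> and \<open>B\<close>.
\<close>

definition seaweed_position :: "nat list \<Rightarrow> nat list \<Rightarrow> nat \<Rightarrow> nat \<Rightarrow> bool" where
  "seaweed_position A B i j \<longleftrightarrow>
     i \<in> {1..sum_list A} \<and> j \<in> {1..sum_list A} \<and>
     (i = j \<or> (j < i \<and> block_index A i = block_index A j)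
            \<or> (i < j \<and> block_index B i = block_index B j))"

text \<open>
  Let \<open>M\<close> be the matrix with an entry 1 at (left end, right end) of every top arc and at (right end,
  left end) of every bottom arc. The equation for the position \<open>(i, j)\<close> says that the commutator of
  \<open>M\<close> and \<open>X\<close> vanishes at \<open>(j, i)\<close>; see \<open>meander_functional_bracket\<close>.
\<close>

definition meander_kernel :: "nat list \<Rightarrow> nat list \<Rightarrow> (nat \<Rightarrow> nat \<Rightarrow> complex) \<Rightarrow> bool" where
  "meander_kernel A B X \<longleftrightarrow>
     (\<forall>i j. \<not> seaweed_position A B i j \<longrightarrow> X i j = 0) \<and>
     (\<forall>i j. seaweed_position A B i j \<longrightarrow>
        (if j < block_mirror A j then X (block_mirror A j) i else 0) +
        (if block_mirror B j < j then X (block_mirror B j) i else 0) =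
        (if block_mirror A i < i then X j (block_mirror A i) else 0) +
        (if i < block_mirror B i then X j (block_mirror B i) else 0))"

definition rigid :: "nat list \<Rightarrow> nat list \<Rightarrow> bool" where
  "rigid A B \<longleftrightarrow> sum_list A = sum_list B \<and>
     (\<forall>X. meander_kernel A B X \<longrightarrow>
        (\<exists>c. \<forall>i\<in>{1..sum_list A}. \<forall>j\<in>{1..sum_list A}. X i j = (if i = j then c else 0)))"

lemma rigidI:
  assumes "sum_list A = sum_list B"
    and "\<And>X. meander_kernel A B X \<Longrightarrow>
      \<exists>c. \<forall>i\<in>{1..sum_list A}. \<forall>j\<in>{1..sum_list A}. X i j = (if i = j then c else 0)"
  shows "rigid A B"
  using assms by (auto simp: rigid_def)

text \<open>
  Transposition of matrices exchanges the two compositions.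
\<close>

lemma rigid_swap: assumes "rigid A B" shows "rigid B A"
proof (rule rigidI)
  show eq: "sum_list B = sum_list A" using assms by (simp add: rigid_def)
  fix X assume X: "meander_kernel B A X"
  have sp: "seaweed_position A B i j \<longleftrightarrow> seaweed_position B A j i" for i j
    using eq by (auto simp: seaweed_position_def)
  have "meander_kernel A B (\<lambda>i j. X j i)"
    unfolding meander_kernel_def
  proof (intro conjI allI impI)
    fix i j assume "\<not> seaweed_position A B i j"
    then show "X j i = 0" using X sp by (auto simp: meander_kernel_def)
  next
    fix i j assume "seaweed_position A B i j"
    then have "seaweed_position B A j i" using sp by simp
    then have "(if i < block_mirror B i then X (block_mirror B i) j else 0) +
        (if block_mirror A i < i then X (block_mirror A i) j else 0) =
        (if block_mirror B j < j then X i (block_mirror B j) else 0) +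
        (if j < block_mirror A j then X i (block_mirror A j) else 0)"
      using X unfolding meander_kernel_def by blast
    then show "(if j < block_mirror A j then X i (block_mirror A j) else 0) +
        (if block_mirror B j < j then X i (block_mirror B j) else 0) =
        (if block_mirror A i < i then X (block_mirror A i) j else 0) +
        (if i < block_mirror B i then X (block_mirror B i) j else 0)"
      by (simp only: add.commute)
  qed
  then obtain c where "\<forall>i\<in>{1..sum_list A}. \<forall>j\<in>{1..sum_list A}. X j i = (if i = j then c else 0)"
    using assms unfolding rigid_def by blast
  then show "\<exists>c. \<forall>i\<in>{1..sum_list B}. \<forall>j\<in>{1..sum_list B}. X i j = (if i = j then c else 0)"
    using eq by (intro exI[of _ c]) auto
qed

text \<open>
  Reversing the order of the vertices turns lower triangular matrices into upper triangular ones, so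
  it reverses the compositions and exchanges them.
\<close>

lemma rigid_rev: assumes "rigid A B" shows "rigid (rev B) (rev A)"
proof (rule rigidI)
  have eq: "sum_list A = sum_list B" using assms by (simp add: rigid_def)
  then show "sum_list (rev B) = sum_list (rev A)" by (simp add: sum_list_rev)
  let ?n = "sum_list A"
  define f where "f i = ?n + 1 - i" for i
  fix X assume X: "meander_kernel (rev B) (rev A) X"
  have fr: "f i \<in> {1..?n}" if "i \<in> {1..?n}" for i using that by (auto simp: f_def)
  have ff: "f (f i) = i" if "i \<in> {1..?n}" for i using that by (auto simp: f_def)
  have idx: "block_index (rev C) (f i) = block_index (rev C) (f j) \<longleftrightarrow> block_index C i = block_index C j"
    if "i \<in> {1..?n}" "j \<in> {1..?n}" "sum_list C = ?n" for i j C
    using block_index_rev[of i C] block_index_rev[of j C] that unfolding f_def by auto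
  have mir: "block_mirror (rev C) (f i) = f (block_mirror C i)"
    if "i \<in> {1..?n}" "sum_list C = ?n" for i C
    using block_mirror_rev[of i C] that unfolding f_def by auto
  have lt: "f i < f j \<longleftrightarrow> j < i" if "i \<in> {1..?n}" "j \<in> {1..?n}" for i j
    using that by (auto simp: f_def)
  have mr: "block_mirror C i \<in> {1..?n}" if "i \<in> {1..?n}" "sum_list C = ?n" for i C
    using block_mirror_range[of i C] that by auto
  have sp: "seaweed_position (rev B) (rev A) (f i) (f j) \<longleftrightarrow> seaweed_position A B i j"
    if "i \<in> {1..?n}" "j \<in> {1..?n}" for i j
  proof -
    have 1: "f i = f j \<longleftrightarrow> i = j" using that by (auto simp: f_def)
    have 2: "sum_list (rev B) = ?n" using eq by (simp add: sum_list_rev)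
    show ?thesis
      unfolding seaweed_position_def 2
      using that fr[OF that(1)] fr[OF that(2)]
      by (simp only: 1 lt idx[OF that refl] idx[OF that eq[symmetric]] simp_thms) blast
  qed
  have "meander_kernel A B (\<lambda>i j. if i \<in> {1..?n} \<and> j \<in> {1..?n} then X (f i) (f j) else 0)"
    (is "meander_kernel A B ?Y")
    unfolding meander_kernel_def
  proof (intro conjI allI impI)
    fix i j assume "\<not> seaweed_position A B i j"
    then show "?Y i j = 0" using X sp by (auto simp: meander_kernel_def)
  next
    fix i j assume s: "seaweed_position A B i j"
    then have ij: "i \<in> {1..?n}" "j \<in> {1..?n}" by (auto simp: seaweed_position_def)
    have "seaweed_position (rev B) (rev A) (f i) (f j)" using s sp ij by simp
    then have "(if f j < block_mirror (rev B) (f j) then X (block_mirror (rev B) (f j)) (f i) else 0) +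
        (if block_mirror (rev A) (f j) < f j then X (block_mirror (rev A) (f j)) (f i) else 0) =
        (if block_mirror (rev B) (f i) < f i then X (f j) (block_mirror (rev B) (f i)) else 0) +
        (if f i < block_mirror (rev A) (f i) then X (f j) (block_mirror (rev A) (f i)) else 0)"
      using X unfolding meander_kernel_def by blast
    then have e: "(if block_mirror B j < j then X (f (block_mirror B j)) (f i) else 0) +
        (if j < block_mirror A j then X (f (block_mirror A j)) (f i) else 0) =
        (if i < block_mirror B i then X (f j) (f (block_mirror B i)) else 0) +
        (if block_mirror A i < i then X (f j) (f (block_mirror A i)) else 0)"
      using ij by (simp only: mir[OF _ refl] mir[OF _ eq[symmetric]] lt mr[OF _ refl] mr[OF _ eq[symmetric]])
    show "(if j < block_mirror A j then ?Y (block_mirror A j) i else 0) +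
        (if block_mirror B j < j then ?Y (block_mirror B j) i else 0) =
        (if block_mirror A i < i then ?Y j (block_mirror A i) else 0) +
        (if i < block_mirror B i then ?Y j (block_mirror B i) else 0)"
      using e ij mr[OF ij(1) refl] mr[OF ij(2) refl] mr[OF ij(1) eq[symmetric]] mr[OF ij(2) eq[symmetric]]
      by (simp only: add.commute simp_thms if_True)
  qed
  then obtain c where c: "\<forall>i\<in>{1..?n}. \<forall>j\<in>{1..?n}. ?Y i j = (if i = j then c else 0)"
    using assms unfolding rigid_def by blast
  have "X i j = (if i = j then c else 0)" if ij: "i \<in> {1..?n}" "j \<in> {1..?n}" for i j
  proof -
    have "f i = f j \<longleftrightarrow> i = j" using ij by (auto simp: f_def)
    then show ?thesis
      using bspec[OF bspec[OF c fr[OF ij(1)]] fr[OF ij(2)]] fr[OF ij(1)] fr[OF ij(2)]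
      by (simp only: ff[OF ij(1)] ff[OF ij(2)] if_True simp_thms)
  qed
  then show "\<exists>c. \<forall>i\<in>{1..sum_list (rev B)}. \<forall>j\<in>{1..sum_list (rev B)}. X i j = (if i = j then c else 0)"
    using eq by (intro exI[of _ c]) (auto simp: sum_list_rev)
qed

lemma block_index_last:
  assumes "1 \<le> i" "1 \<le> j" "i \<le> sum_list A + a" "j \<le> sum_list A + a"
  shows "block_index (A @ [a]) i = block_index (A @ [a]) j \<longleftrightarrow>
    (i \<le> sum_list A \<and> j \<le> sum_list A \<and> block_index A i = block_index A j) \<or>
    (sum_list A < i \<and> sum_list A < j)"
  using assms block_index_less_length[of i A] block_index_less_length[of j A]
  by (auto simp: block_index_append)

text \<open>
  Let \<open>C\<close> be the last bottom block; the top reflection identifies it with the first \<open>b\<close> vertices \<open>C'\<close> of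
  the last top block. The equations with one index in \<open>C\<close> say that the diagonal block of \<open>X\<close> at \<open>C\<close> is
  a copy of the one at \<open>C'\<close> (\<open>X_new\<close>) and that the vertices of the top block between \<open>C'\<close> and \<open>C\<close> have no
  entries in the columns of \<open>C'\<close> (\<open>X_mid\<close>), which is the support condition after \<open>C'\<close> is split off as a top block of its own. The
  equations with both indices in \<open>C\<close> express the entries with row in \<open>C\<close> and column in \<open>C'\<close> by those of
  the diagonal block (\<open>E2\<close>). Inserted into the remaining equations, these entries turn the bottom arcs of \<open>C\<close> into
  top arcs of \<open>C'\<close>: what remains is the system of the smaller pair.
\<close>

lemma rigid_reduce:
  assumes le: "2 * b \<le> a" and rigid: "rigid (A @ [b, a - 2 * b]) B"
  shows "rigid (A @ [a]) (B @ [b])"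
proof (rule rigidI)
  define p where "p = sum_list A"
  define n where "n = p + a"
  define m where "m = sum_list B"
  have sB: "sum_list B = m" by (simp add: m_def)
  have nm: "n = m + b" and bn: "p + b \<le> m"
    using rigid le by (auto simp: rigid_def p_def n_def m_def)
  then show sums: "sum_list (A @ [a]) = sum_list (B @ [b])" using sB by (auto simp: p_def n_def)
  have sAa: "sum_list (A @ [a]) = n" and sA': "sum_list (A @ [b, a - 2 * b]) = m"
    using le nm by (auto simp: p_def n_def)
  let ?T = "block_mirror (A @ [a])" and ?T' = "block_mirror (A @ [b, a - 2 * b])"
  let ?M = "block_mirror (B @ [b])"
  let ?S = "seaweed_position (A @ [a]) (B @ [b])"
  let ?S' = "seaweed_position (A @ [b, a - 2 * b]) B"
  have T_left: "?T i = block_mirror A i" "?T' i = block_mirror A i" "1 \<le> block_mirror A i" "block_mirror A i \<le> p"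
    if "1 \<le> i" "i \<le> p" for i
    using that block_mirror_range[of i A] by (auto simp: block_mirror_append p_def)
  have T_right: "?T i = p + n + 1 - i" if "p < i" "i \<le> n" for i
    using that by (auto simp: block_mirror_append p_def n_def)
  have T'_new: "?T' i = 2 * p + b + 1 - i" if "p < i" "i \<le> p + b" for i
    using that by (auto simp: block_mirror_append p_def n_def)
  have T'_mid: "?T' i = p + n + 1 - i" if "p + b < i" "i \<le> m" for i
    using that le nm by (auto simp: block_mirror_append p_def n_def)
  have M_left: "?M i = block_mirror B i" "1 \<le> block_mirror B i" "block_mirror B i \<le> m"
    if "1 \<le> i" "i \<le> m" for i
    using that block_mirror_range[of i B] by (auto simp: block_mirror_append sB)
  have M_right: "?M i = n + m + 1 - i" if "m < i" "i \<le> n" for i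
    using that bn nm by (auto simp: block_mirror_append sB)
  have S_iff: "?S i j \<longleftrightarrow> i = j \<or>
       (j < i \<and> ((i \<le> p \<and> block_index A i = block_index A j) \<or> p < j)) \<or>
       (i < j \<and> ((j \<le> m \<and> block_index B i = block_index B j) \<or> m < i))"
    if "1 \<le> i" "i \<le> n" "1 \<le> j" "j \<le> n" for i j
  proof -
    have 1: "block_index (A @ [a]) i = block_index (A @ [a]) j \<longleftrightarrow>
        (i \<le> p \<and> j \<le> p \<and> block_index A i = block_index A j) \<or> (p < i \<and> p < j)"
      using block_index_last[of i j A a] that by (simp add: p_def n_def)
    have 2: "block_index (B @ [b]) i = block_index (B @ [b]) j \<longleftrightarrow>
        (i \<le> m \<and> j \<le> m \<and> block_index B i = block_index B j) \<or> (m < i \<and> m < j)"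
      using block_index_last[of i j B b] that bn nm sB by simp
    show ?thesis
      unfolding seaweed_position_def sAa 1 2 using that by (cases i j rule: linorder_cases) auto
  qed
  have S'_iff: "?S' i j \<longleftrightarrow> i = j \<or>
       (j < i \<and> ((i \<le> p \<and> block_index A i = block_index A j) \<or>
                 (p < j \<and> i \<le> p + b) \<or> p + b < j)) \<or>
       (i < j \<and> block_index B i = block_index B j)"
    if "1 \<le> i" "i \<le> m" "1 \<le> j" "j \<le> m" for i j
  proof -
    have 1: "block_index (A @ [b, a - 2 * b]) i = block_index (A @ [b, a - 2 * b]) j \<longleftrightarrow>
        (i \<le> p + b \<and> j \<le> p + b \<and> block_index (A @ [b]) i = block_index (A @ [b]) j) \<or>
        (p + b < i \<and> p + b < j)"
      using block_index_last[of i j "A @ [b]" "a - 2 * b"] that bn nm by (simp add: p_def n_def)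
    have 2: "block_index (A @ [b]) i = block_index (A @ [b]) j \<longleftrightarrow>
        (i \<le> p \<and> j \<le> p \<and> block_index A i = block_index A j) \<or> (p < i \<and> p < j)"
      if "i \<le> p + b" "j \<le> p + b"
      using block_index_last[of i j A b] that \<open>1 \<le> i\<close> \<open>1 \<le> j\<close> by (simp add: p_def)
    show ?thesis
      unfolding seaweed_position_def sA' 1 using that nm 2 by (cases i j rule: linorder_cases) auto
  qed
  fix X assume X: "meander_kernel (A @ [a]) (B @ [b]) X"
  have S_range: "1 \<le> i" "i \<le> n" "1 \<le> j" "j \<le> n" if "?S i j" for i j
    using that unfolding seaweed_position_def sAa by auto
  have supp: "X i j = 0" if "\<not> ?S i j" for i j
    using X that by (auto simp: meander_kernel_def)
  have eqn: "(if j < ?T j then X (?T j) i else 0) + (if ?M j < j then X (?M j) i else 0) =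
             (if ?T i < i then X j (?T i) else 0) + (if i < ?M i then X j (?M i) else 0)"
    if "?S i j" for i j
    using X that unfolding meander_kernel_def by blast
  \<comment> \<open>No position leads into the last bottom block from outside: that block ends the last top block.\<close>
  have X_up: "X w c = 0" if "w \<le> m" "m < c" for w c
  proof (cases "?S w c")
    case True
    from S_range[OF this] show ?thesis using S_iff[of w c] True that by auto
  qed (use supp in auto)
  have X_down_left: "X c w = 0" if "w \<le> p" "m < c" for w c
  proof (cases "?S c w")
    case True
    from S_range[OF this] show ?thesis using S_iff[of c w] True that bn nm by auto
  qed (use supp in auto)
  have E1: "(if w < ?T w then X (?T w) c else 0) = X w (p + n + 1 - c)"
    if "p < w" "w \<le> m" "m < c" "c \<le> n" for w c
  proof -
    have "?S c w" using that bn nm S_iff[of c w] by auto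
    note e = eqn[OF this]
    have "?T c = p + n + 1 - c" "?T c < c" using T_right[of c] that bn nm by auto
    moreover have "X (?M w) c = 0" using X_up[of "?M w" c] M_left[of w] that by auto
    moreover have "X w (?M c) = 0" using X_up[of w "?M c"] M_right[of c] that by auto
    ultimately show ?thesis using e by (simp cong: if_cong)
  qed
  have X_new: "X (p + n + 1 - w) c = X w (p + n + 1 - c)"
    if "p < w" "w \<le> p + b" "m < c" "c \<le> n" for w c
  proof -
    have "?T w = p + n + 1 - w" "w < ?T w" "w \<le> m" using T_right[of w] that bn nm by auto
    then show ?thesis using E1[of w c] that by simp
  qed
  have X_mid: "X w w' = 0" if "p + b < w" "w \<le> m" "p < w'" "w' \<le> p + b" for w w'
  proof -
    have "X w (p + n + 1 - (p + n + 1 - w')) = (if w < ?T w then X (?T w) (p + n + 1 - w') else 0)"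
      using E1[of w "p + n + 1 - w'"] that bn nm by auto
    also have "\<dots> = 0" using that bn nm T_right[of w] X_up[of "?T w" "p + n + 1 - w'"] by auto
    finally show ?thesis using that bn nm by auto
  qed
  have E2: "X j (p + n + 1 - i) = (if ?M j < j then X (?M j) i else 0) - (if i < ?M i then X j (?M i) else 0)"
    if "m < i" "i \<le> n" "m < j" "j \<le> n" for i j
  proof -
    have "?S i j" using that bn nm S_iff[of i j] by auto
    note e = eqn[OF this]
    have "?T i = p + n + 1 - i" "?T i < i" "\<not> j < ?T j"
      using T_right[of i] T_right[of j] that bn nm by auto
    then show ?thesis using e by (simp add: algebra_simps)
  qed
  define Y where "Y i j = (if i \<le> m \<and> j \<le> m then X i j else 0)" for i j
  have "meander_kernel (A @ [b, a - 2 * b]) B Y"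
    unfolding meander_kernel_def
  proof (intro conjI allI impI)
    fix i j assume s: "\<not> ?S' i j"
    show "Y i j = 0"
    proof (cases "?S i j \<and> i \<le> m \<and> j \<le> m")
      case True
      then have "1 \<le> i" "1 \<le> j" using S_range by auto
      then have "p + b < i \<and> p < j \<and> j \<le> p + b"
        using True s S_iff[of i j] S'_iff[of i j] nm by (cases i j rule: linorder_cases) auto
      then show ?thesis using X_mid[of i j] True by (simp add: Y_def)
    qed (auto simp: Y_def supp)
  next
    fix i j assume s': "?S' i j"
    then have ij: "1 \<le> i" "i \<le> m" "1 \<le> j" "j \<le> m"
      unfolding seaweed_position_def sA' by auto
    have s: "?S i j" using s' S_iff[of i j] S'_iff[of i j] ij nm by (cases i j rule: linorder_cases) auto
    have T'_range: "?T' k \<le> m" if "1 \<le> k" "k \<le> m" for k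
      using block_mirror_range[of k "A @ [b, a - 2 * b]"] that sA' by auto
    have e: "(if j < ?T j then X (?T j) i else 0) + (if block_mirror B j < j then X (block_mirror B j) i else 0) =
             (if ?T i < i then X j (?T i) else 0) + (if i < block_mirror B i then X j (block_mirror B i) else 0)"
      using eqn[OF s] M_left[of i] M_left[of j] ij by (simp cong: if_cong)
    have same: "?T' k = ?T k" if "1 \<le> k" "k \<le> m" "\<not> (p < k \<and> k \<le> p + b)" for k
      using T_left[of k] T_right[of k] T'_mid[of k] that nm by (cases "k \<le> p") auto
    have main: "(if j < ?T j then X (?T j) i else 0) - (if ?T i < i then X j (?T i) else 0) =
          (if j < ?T' j then X (?T' j) i else 0) - (if ?T' i < i then X j (?T' i) else 0)"
    proof (cases "p < j \<and> j \<le> p + b"; cases "p < i \<and> i \<le> p + b")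
      assume "\<not> (p < j \<and> j \<le> p + b)" "\<not> (p < i \<and> i \<le> p + b)"
      then show ?thesis using same[of i] same[of j] ij by simp
    next
      assume j: "p < j \<and> j \<le> p + b" and i: "\<not> (p < i \<and> i \<le> p + b)"
      have ip: "i \<le> p" using s' S'_iff[of i j] ij i j by (cases i j rule: linorder_cases) auto
      have "X (?T j) i = 0" using X_down_left[of i "?T j"] T_right[of j] ip j bn nm by auto
      moreover have "X (?T' j) i = 0"
      proof -
        have "p < ?T' j" "?T' j \<le> n" using T'_new[of j] j bn nm by auto
        then have "\<not> ?S (?T' j) i" using S_iff[of "?T' j" i] ip ij by auto
        then show ?thesis by (rule supp)
      qed
      ultimately show ?thesis using same[of i] i ij by simp
    next
      assume j: "\<not> (p < j \<and> j \<le> p + b)" and i: "p < i \<and> i \<le> p + b"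
      have jm: "p + b < j"
        using s' S'_iff[of i j] ij i j by (cases i j rule: linorder_cases) auto
      have "X j (?T' i) = 0" using X_mid[of j "?T' i"] T'_new[of i] i jm ij by auto
      then show ?thesis using same[of j] j ij i T_right[of i] bn nm by auto
    next
      assume j: "p < j \<and> j \<le> p + b" and i: "p < i \<and> i \<le> p + b"
      let ?i = "p + n + 1 - i" and ?j = "p + n + 1 - j"
      have r: "m < ?i" "?i \<le> n" "m < ?j" "?j \<le> n" "p + n + 1 - ?i = i" "p + n + 1 - ?j = j"
        using i j bn nm by auto
      have M: "?M ?i = p + n + 1 - ?T' i" "?M ?j = p + n + 1 - ?T' j"
      proof -
        have "n + m + 1 - (p + n + 1 - x) = p + n + 1 - (2 * p + b + 1 - x)" if x: "p < x" "x \<le> p + b" for x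
        proof -
          obtain k l where "x = p + k" "b = k + l" using x by (metis add_le_cancel_left less_imp_le nat_le_iff_add)
          then show ?thesis unfolding nm by simp
        qed
        then show "?M ?i = p + n + 1 - ?T' i" "?M ?j = p + n + 1 - ?T' j"
          using M_right[OF r(1,2)] M_right[OF r(3,4)] T'_new[of i] T'_new[of j] i j by simp_all
      qed
      have t: "p < ?T' i" "?T' i \<le> p + b" "p < ?T' j" "?T' j \<le> p + b"
        using T'_new[of i] T'_new[of j] i j by auto
      have "X ?j i = (if j < ?T' j then X (p + n + 1 - ?T' j) ?i else 0) - (if ?T' i < i then X ?j (p + n + 1 - ?T' i) else 0)"
      proof -
        have "p + n + 1 - ?T' j < ?j \<longleftrightarrow> j < ?T' j" "?i < p + n + 1 - ?T' i \<longleftrightarrow> ?T' i < i"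
          using t i j bn nm by linarith+
        then show ?thesis using E2[OF r(1-4)] unfolding M r(5) by simp
      qed
      also have "X (p + n + 1 - ?T' j) ?i = X (?T' j) i"
        using X_new[OF t(3,4) r(1,2)] r by simp
      also have "X ?j (p + n + 1 - ?T' i) = X j (?T' i)"
        using X_new[of j "p + n + 1 - ?T' i"] t j bn nm by auto
      finally show ?thesis using T_right[of j] T_right[of i] i j bn nm by auto
    qed
    show "(if j < ?T' j then Y (?T' j) i else 0) + (if block_mirror B j < j then Y (block_mirror B j) i else 0) =
          (if ?T' i < i then Y j (?T' i) else 0) + (if i < block_mirror B i then Y j (block_mirror B i) else 0)"
    proof -
      have swap: "u' + b1 = v' + b2" if "u + b1 = v + b2" "u - v = u' - v'"
        for u v u' v' b1 b2 :: complex
      proof -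
        have "u = v + b2 - b1" using that(1) by (simp add: eq_diff_eq)
        moreover have "u' = u - v + v'" using that(2) by simp
        ultimately show ?thesis by simp
      qed
      have "?T' i \<le> m" "?T' j \<le> m" "block_mirror B i \<le> m" "block_mirror B j \<le> m"
        using T'_range M_left ij by auto
      with swap[OF e main] show ?thesis using ij by (simp add: Y_def cong: if_cong)
    qed
  qed
  then obtain c where "\<forall>i\<in>{1..m}. \<forall>j\<in>{1..m}. Y i j = (if i = j then c else 0)"
    using rigid unfolding rigid_def sA' by blast
  then have c: "X i j = (if i = j then c else 0)" if "1 \<le> i" "i \<le> m" "1 \<le> j" "j \<le> m" for i j
    using that by (auto simp: Y_def)
  have cc: "X i j = (if i = j then c else 0)" if "m < i" "i \<le> n" "m < j" "j \<le> n" for i j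
    using X_new[of "p + n + 1 - i" j] c[of "p + n + 1 - i" "p + n + 1 - j"] that bn nm by auto
  have cnew: "X i j = 0" if "m < i" "i \<le> n" "p < j" "j \<le> p + b" for i j
  proof -
    have "X i j = (if ?M i < i then X (?M i) (p + n + 1 - j) else 0)
        - (if p + n + 1 - j < ?M (p + n + 1 - j) then X i (?M (p + n + 1 - j)) else 0)"
      using E2[of "p + n + 1 - j" i] that bn nm by auto
    also have "\<dots> = 0"
      using that bn nm M_right[of i] M_right[of "p + n + 1 - j"]
        cc[of "?M i" "p + n + 1 - j"] cc[of i "?M (p + n + 1 - j)"] by auto
    finally show ?thesis .
  qed
  have cmid: "X i j = 0" if "m < i" "i \<le> n" "p + b < j" "j \<le> m" for i j
  proof -
    let ?i = "p + n + 1 - i"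
    have i: "p < ?i" "?i \<le> p + b" using that bn nm by auto
    have "?S j ?i" using S_iff[of j ?i] that i bn nm by auto
    note e = eqn[OF this]
    have T: "?T ?i = i" "?i < ?T ?i" using T_right[of ?i] that i bn nm by auto
    have "?M ?i < ?i \<longrightarrow> X (?M ?i) j = 0"
      using c[of "?M ?i" j] M_left[of ?i] that i bn nm by auto
    moreover have "?T j < j \<longrightarrow> X ?i (?T j) = 0"
      using c[of ?i "?T j"] T_right[of j] that i bn nm by auto
    moreover have "j < ?M j \<longrightarrow> X ?i (?M j) = 0"
      using c[of ?i "?M j"] M_left[of j] that i bn nm by auto
    ultimately show ?thesis using e T by (simp cong: if_cong)
  qed
  have "X i j = (if i = j then c else 0)" if "1 \<le> i" "i \<le> n" "1 \<le> j" "j \<le> n" for i j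
  proof (cases "i \<le> m"; cases "j \<le> m")
    assume "\<not> i \<le> m" "j \<le> m"
    then show ?thesis
      using that cnew[of i j] cmid[of i j] X_down_left[of j i] by (cases "j \<le> p"; cases "j \<le> p + b") auto
  qed (use that c[of i j] cc[of i j] X_up[of i j] in auto)
  then show "\<exists>c. \<forall>i\<in>{1..sum_list (A @ [a])}. \<forall>j\<in>{1..sum_list (A @ [a])}. X i j = (if i = j then c else 0)"
    unfolding sAa by (intro exI[of _ c]) auto
qed

lemma block_mirror_drop_zeros: "1 \<le> i \<Longrightarrow> block_mirror (filter ((<) 0) A) i = block_mirror A i"
  by (induction A arbitrary: i) auto

lemma same_block_drop_zeros:
  "1 \<le> i \<Longrightarrow> 1 \<le> j \<Longrightarrow>
     block_index (filter ((<) 0) A) i = block_index (filter ((<) 0) A) j \<longleftrightarrow>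
     block_index A i = block_index A j"
proof (induction A arbitrary: i j)
  case (Cons a A)
  then show ?case using Cons.IH[of "i - a" "j - a"] by (cases "a = 0") auto
qed auto

lemma sum_list_drop_zeros: "sum_list (filter ((<) 0) A) = sum_list (A :: nat list)"
  by (induction A) auto

text \<open>
  Empty blocks change neither the relation of lying in one block nor the reflections. Allowing them
  spares the reductions the distinction whether a block is used up completely.
\<close>

lemma rigid_drop_zeros:
  "rigid A B \<longleftrightarrow> rigid (filter ((<) 0) A) (filter ((<) 0) B)"
proof -
  let ?A = "filter ((<) 0) A" and ?B = "filter ((<) 0) B"
  have sp: "seaweed_position ?A ?B = seaweed_position A B"
    unfolding seaweed_position_def fun_eq_iff sum_list_drop_zeros using same_block_drop_zeros by auto
  have "meander_kernel ?A ?B X \<longleftrightarrow> meander_kernel A B X" for X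
  proof -
    have "seaweed_position A B i j \<Longrightarrow> block_mirror ?A i = block_mirror A i \<and> block_mirror ?A j = block_mirror A j
       \<and> block_mirror ?B i = block_mirror B i \<and> block_mirror ?B j = block_mirror B j" for i j
      by (auto simp: seaweed_position_def block_mirror_drop_zeros)
    then show ?thesis unfolding meander_kernel_def sp by (simp cong: conj_cong imp_cong)
  qed
  then show ?thesis by (simp add: rigid_def sum_list_drop_zeros)
qed

lemma rigid_singleton: "rigid [1] [1]"
  by (auto simp: rigid_def)

lemma rigid_reduce_half:
  assumes "rigid (A @ [b]) B" shows "rigid (A @ [2 * b]) (B @ [b])"
proof (rule rigid_reduce)
  show "rigid (A @ [b, 2 * b - 2 * b]) B"
    using assms rigid_drop_zeros[of "A @ [b, 0]" B] rigid_drop_zeros[of "A @ [b]" B]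
    by (cases "b = 0") auto
qed simp

text \<open>
  Every bottom block of size two at the end moves to the top and shortens the last top block by four.
\<close>

lemma rigid_tail_pairs:
  "rigid (A @ replicate (l + k) 2) C \<Longrightarrow> rigid (A @ replicate l 2 @ [4 * k]) (C @ replicate k 2)"
proof (induction k arbitrary: l)
  case 0
  then show ?case
    using rigid_drop_zeros[of "A @ replicate l 2 @ [0]" C] rigid_drop_zeros[of "A @ replicate l 2" C] by simp
next
  case (Suc k)
  have "rigid (A @ replicate (Suc l) 2 @ [4 * k]) (C @ replicate k 2)"
    using Suc.IH[of "Suc l"] Suc.prems by (simp only: add_Suc_right add_Suc)
  then have "rigid ((A @ replicate l 2) @ [2, 4 * Suc k - 2 * 2]) (C @ replicate k 2)"
    by (simp add: replicate_app_Cons_same)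
  then have "rigid ((A @ replicate l 2) @ [4 * Suc k]) ((C @ replicate k 2) @ [2])"
    by (intro rigid_reduce) auto
  then show ?case by (simp add: replicate_append_same)
qed

text \<open>
  The final bottom block 1 halves the top block 2 above it, which then halves the next bottom block 2:
  two reductions, with the roles of top and bottom exchanged in between, remove one pair.
\<close>

lemma rigid_peel_pairs:
  "rigid A (C @ [1]) \<Longrightarrow> rigid (A @ replicate k 2) (C @ replicate k 2 @ [1])"
proof (induction k)
  case (Suc k)
  have "rigid ((C @ replicate k 2) @ [1]) (A @ replicate k 2)"
    using rigid_swap[OF Suc.IH[OF Suc.prems]] by simp
  from rigid_reduce_half[OF this] have "rigid ((A @ replicate k 2) @ [1]) (C @ replicate (Suc k) 2)"
    using rigid_swap by (simp add: replicate_append_same)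
  from rigid_reduce_half[OF this] show ?case
    by (simp add: replicate_append_same)
qed simp

lemma rigid_bottom_chain: "1 \<le> t \<Longrightarrow> rigid [t] [t - 1, 1]"
proof (induction t rule: nat_induct_at_least)
  case base
  then show ?case using rigid_singleton rigid_drop_zeros[of "[1]" "[0, 1]"] by simp
next
  case (Suc t)
  have "rigid [1, t - 1] [t]" using rigid_rev[OF Suc.IH] by simp
  then show ?case using rigid_reduce[of 1 "Suc t" "[]" "[t]"] Suc.hyps by simp
qed

text \<open>
  Two reductions at the right end move the blocks 1 and \<open>t - 1\<close> to the top, where they precede a block of
  size \<open>t (k - 2)\<close>. Read from right to left, this is the same shape with \<open>k - 1\<close> in place of \<open>k\<close>.
\<close>

lemma rigid_core: "1 \<le> k \<Longrightarrow> 1 \<le> t \<Longrightarrow> rigid [t * k] [t * (k - 1), t - 1, 1]"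
proof (induction k rule: nat_induct_at_least)
  case base
  then show ?case
    using rigid_bottom_chain[of t] rigid_drop_zeros[of "[t]" "[t - 1, 1]"]
      rigid_drop_zeros[of "[t]" "[0, t - 1, 1]"] by simp
next
  case (Suc k)
  have le: "2 * t \<le> t * Suc k" using Suc.hyps by simp
  have "t * Suc k - 2 * 1 - 2 * (t - 1) = t * (k - 1)"
    using Suc.hyps Suc.prems by (simp add: algebra_simps)
  then have "rigid ([1] @ [t - 1, (t * Suc k - 2 * 1) - 2 * (t - 1)]) [t * k]"
    using rigid_rev[OF Suc.IH[OF Suc.prems]] by simp
  then have "rigid ([1] @ [t * Suc k - 2 * 1]) ([t * k] @ [t - 1])"
    by (rule rigid_reduce[rotated])
      (use diff_le_mono[OF le, of 2] in \<open>simp add: diff_mult_distrib2\<close>)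
  then have "rigid ([] @ [1, t * Suc k - 2 * 1]) [t * k, t - 1]"
    by simp
  then have "rigid ([] @ [t * Suc k]) ([t * k, t - 1] @ [1])"
    by (rule rigid_reduce[rotated]) (use le Suc.prems in linarith)
  then show ?case by simp
qed

lemma rigid_family: "rigid [family_size L] (family_composition L)"
proof -
  define t where "t = L + 5"
  have "rigid [t\<^sup>2] ([t * (t - 1), t - 1] @ [1])"
    using rigid_core[of t t] by (simp add: t_def power2_eq_square)
  from rigid_peel_pairs[OF this, of "t\<^sup>2"]
  have "rigid ([t\<^sup>2] @ replicate (0 + t\<^sup>2) 2) ([t * (t - 1), t - 1] @ replicate (t\<^sup>2) 2 @ [1])"
    by simp
  from rigid_tail_pairs[OF this]
  have "rigid ([] @ [t\<^sup>2, (6 * t\<^sup>2) - 2 * t\<^sup>2]) ([t * (t - 1), t - 1] @ replicate (t\<^sup>2) 2 @ [1] @ replicate (t\<^sup>2) 2)"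
    by simp
  then have "rigid ([] @ [6 * t\<^sup>2]) (([t * (t - 1), t - 1] @ replicate (t\<^sup>2) 2 @ [1] @ replicate (t\<^sup>2) 2) @ [t\<^sup>2])"
    by (rule rigid_reduce[rotated]) simp
  then show ?thesis by (simp add: family_size_def family_composition_def Let_def t_def)
qed

section \<open>Seaweed algebras and the meander functional\<close>

lemma fun_sum_apply: "(\<Sum>i\<in>I. f i) x = (\<Sum>i\<in>I. f i x)"
  by (induction I rule: infinite_finite_induct) auto

lemma mat_scale_apply [simp]: "mat_scale c X i j = c * X i j"
  by (simp add: mat_scale_def)

lemma mat_mult_add_left: "mat_mult n (X + Y) Z = mat_mult n X Z + mat_mult n Y Z"
  and mat_mult_add_right: "mat_mult n X (Y + Z) = mat_mult n X Y + mat_mult n X Z"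
  and mat_mult_diff_left: "mat_mult n (X - Y) Z = mat_mult n X Z - mat_mult n Y Z"
  and mat_mult_diff_right: "mat_mult n X (Y - Z) = mat_mult n X Y - mat_mult n X Z"
  and mat_mult_scale_left: "mat_mult n (mat_scale c X) Y = mat_scale c (mat_mult n X Y)"
  and mat_mult_scale_right: "mat_mult n X (mat_scale c Y) = mat_scale c (mat_mult n X Y)"
  by (auto simp: mat_mult_def fun_eq_iff algebra_simps sum.distrib sum_subtractf sum_distrib_left)

lemma mat_mult_assoc: "mat_mult n (mat_mult n X Y) Z = mat_mult n X (mat_mult n Y Z)"
proof (intro ext)
  fix i j
  have "mat_mult n (mat_mult n X Y) Z i j = (\<Sum>k\<in>{1..n}. \<Sum>l\<in>{1..n}. X i l * Y l k * Z k j)"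
    by (simp add: mat_mult_def sum_distrib_right)
  also have "\<dots> = (\<Sum>l\<in>{1..n}. \<Sum>k\<in>{1..n}. X i l * Y l k * Z k j)" by (rule sum.swap)
  also have "\<dots> = mat_mult n X (mat_mult n Y Z) i j"
    by (simp add: mat_mult_def sum_distrib_left mult.assoc)
  finally show "mat_mult n (mat_mult n X Y) Z i j = mat_mult n X (mat_mult n Y Z) i j" .
qed

lemma commutator_trace: "(\<Sum>i\<in>{1..n}. commutator n X Y i i) = 0"
proof -
  have "(\<Sum>i\<in>{1..n}. mat_mult n X Y i i) = (\<Sum>i\<in>{1..n}. mat_mult n Y X i i)"
    unfolding mat_mult_def by (subst sum.swap) (simp add: mult.commute)
  then show ?thesis by (simp add: commutator_def sum_subtractf)
qed

lemma commutator_jacobi: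
  "commutator n X (commutator n Y Z) + commutator n Y (commutator n Z X) + commutator n Z (commutator n X Y) = 0"
  by (simp add: commutator_def mat_mult_diff_left mat_mult_diff_right mat_mult_assoc algebra_simps)

text \<open>
  The span of the matrix units at the positions in \<open>P\<close>, for finite \<open>P\<close>.
\<close>

definition supported :: "(nat \<times> nat) set \<Rightarrow> (nat \<Rightarrow> nat \<Rightarrow> complex) set" where
  "supported P = {X. \<forall>i j. (i, j) \<notin> P \<longrightarrow> X i j = 0}"

lemma matrix_unit_apply: "matrix_unit i j k l = (if k = i \<and> l = j then 1 else 0)"
  by (simp add: matrix_unit_def)

lemma matrix_unit_eq_iff: "matrix_unit i j = matrix_unit k l \<longleftrightarrow> i = k \<and> j = l"
proof
  assume "matrix_unit i j = matrix_unit k l"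
  then have "matrix_unit k l i j = (1 :: complex)" by (metis matrix_unit_apply)
  then show "i = k \<and> j = l" by (simp add: matrix_unit_apply split: if_splits)
qed simp

lemma supported_expand:
  assumes "finite P" "X \<in> supported P"
  shows "X = (\<Sum>(i, j)\<in>P. mat_scale (X i j) (matrix_unit i j))"
proof (intro ext)
  fix k l
  have "(\<Sum>(i, j)\<in>P. mat_scale (X i j) (matrix_unit i j)) k l
      = (\<Sum>p\<in>P. if p = (k, l) then X k l else 0)"
    unfolding fun_sum_apply by (intro sum.cong) (auto simp: matrix_unit_apply split: if_splits)
  also have "\<dots> = X k l" using assms by (auto simp: supported_def)
  finally show "X k l = (\<Sum>(i, j)\<in>P. mat_scale (X i j) (matrix_unit i j)) k l" by simp
qed

lemma subspace_supported: "mat.subspace (supported P)"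
  by (intro mat.subspaceI) (auto simp: supported_def)

lemma span_matrix_units:
  assumes "finite P" shows "mat.span ((\<lambda>(i, j). matrix_unit i j) ` P) = supported P"
proof
  show "mat.span ((\<lambda>(i, j). matrix_unit i j) ` P) \<subseteq> supported P"
    by (intro mat.span_minimal subspace_supported) (auto simp: supported_def matrix_unit_apply)
  show "supported P \<subseteq> mat.span ((\<lambda>(i, j). matrix_unit i j) ` P)"
  proof
    fix X assume "X \<in> supported P"
    then have "X = (\<Sum>p\<in>P. mat_scale (X (fst p) (snd p)) (case p of (i, j) \<Rightarrow> matrix_unit i j))"
      using supported_expand[OF assms] by (simp add: case_prod_beta)
    also have "\<dots> \<in> mat.span ((\<lambda>(i, j). matrix_unit i j) ` P)"
      by (intro mat.span_sum mat.span_scale mat.span_base) auto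
    finally show "X \<in> mat.span ((\<lambda>(i, j). matrix_unit i j) ` P)" .
  qed
qed

lemma dim_supported:
  assumes "finite P" shows "mat.dim (supported P) = card P"
proof -
  let ?E = "\<lambda>(i, j). matrix_unit i j"
  have inj: "inj_on ?E P"
    by (auto simp: inj_on_def matrix_unit_eq_iff)
  have "mat.independent (?E ` P)"
  proof (rule mat.independent_if_scalars_zero)
    show "finite (?E ` P)" using assms by simp
    fix f X assume s: "(\<Sum>X\<in>?E ` P. mat_scale (f X) X) = 0" and X: "X \<in> ?E ` P"
    then obtain k l where kl: "(k, l) \<in> P" "X = matrix_unit k l" by auto
    have "0 = (\<Sum>p\<in>P. mat_scale (f (?E p)) (?E p)) k l"
      using s by (simp add: sum.reindex[OF inj])
    also have "\<dots> = (\<Sum>p\<in>P. if p = (k, l) then f X else 0)"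
      unfolding fun_sum_apply using kl by (intro sum.cong) (auto simp: matrix_unit_apply split: if_splits)
    also have "\<dots> = f X" using assms kl by simp
    finally show "f X = 0" by simp
  qed
  then show ?thesis
    using mat.dim_eq_card_independent[of "?E ` P"] mat.dim_span[of "?E ` P"] span_matrix_units[OF assms] card_image[OF inj]
    by simp
qed

lemma finite_seaweed_positions: "finite {(i, j). seaweed_position A B i j}"
  by (rule finite_subset[of _ "{1..sum_list A} \<times> {1..sum_list A}"]) (auto simp: seaweed_position_def)

text \<open>
  Blocks are intervals: if the outer two of three vertices share a block, so does the middle one.
\<close>

lemma seaweed_position_trans:
  assumes "seaweed_position A B i k" "seaweed_position A B k j" shows "seaweed_position A B i j"
proof -
  have squeeze: "block_index C x = block_index C y \<and> block_index C y = block_index C z"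
    if "x \<le> y" "y \<le> z" "block_index C x = block_index C z" for x y z and C :: "nat list"
    using block_index_mono[of x y C] block_index_mono[of y z C] that by linarith
  have range: "i \<in> {1..sum_list A}" "j \<in> {1..sum_list A}"
    using assms by (auto simp: seaweed_position_def)
  show ?thesis
  proof (cases "i = k \<or> k = j \<or> i = j")
    case True
    then show ?thesis using assms range by (elim disjE) (simp_all add: seaweed_position_def)
  next
    case False
    have up: "seaweed_position A B i j" if "j < i" "block_index A i = block_index A j"
      using that range by (simp add: seaweed_position_def)
    have down: "seaweed_position A B i j" if "i < j" "block_index B i = block_index B j"
      using that range by (simp add: seaweed_position_def)
    have d1: "k < i \<and> block_index A i = block_index A k \<or> i < k \<and> block_index B i = block_index B k"
      and d2: "j < k \<and> block_index A k = block_index A j \<or> k < j \<and> block_index B k = block_index B j"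
      using assms False unfolding seaweed_position_def by metis+
    show ?thesis
    proof (rule disjE[OF d1]; rule disjE[OF d2])
      assume 1: "k < i \<and> block_index A i = block_index A k" "j < k \<and> block_index A k = block_index A j"
      show ?thesis
        by (rule up[OF less_trans[OF conjunct1[OF 1(2)] conjunct1[OF 1(1)]]
              trans[OF conjunct2[OF 1(1)] conjunct2[OF 1(2)]]])
    next
      assume 1: "k < i \<and> block_index A i = block_index A k" "k < j \<and> block_index B k = block_index B j"
      show ?thesis
      proof (cases "j < i")
        case True
        have s: "block_index A k = block_index A j \<and> block_index A j = block_index A i"
          by (rule squeeze) (use True 1 in simp_all)
        show ?thesis by (rule up) (use True s in simp_all)
      next
        case False
        then have "i < j" using \<open>\<not> (i = k \<or> k = j \<or> i = j)\<close> by simp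
        have s: "block_index B k = block_index B i \<and> block_index B i = block_index B j"
          by (rule squeeze) (use \<open>i < j\<close> 1 in simp_all)
        show ?thesis by (rule down) (use \<open>i < j\<close> s in simp_all)
      qed
    next
      assume 1: "i < k \<and> block_index B i = block_index B k" "j < k \<and> block_index A k = block_index A j"
      show ?thesis
      proof (cases "j < i")
        case True
        have s: "block_index A j = block_index A i \<and> block_index A i = block_index A k"
          by (rule squeeze) (use True 1 in simp_all)
        show ?thesis by (rule up) (use True s in simp_all)
      next
        case False
        then have "i < j" using \<open>\<not> (i = k \<or> k = j \<or> i = j)\<close> by simp
        have s: "block_index B i = block_index B j \<and> block_index B j = block_index B k"
          by (rule squeeze) (use \<open>i < j\<close> 1 in simp_all)
        show ?thesis by (rule down) (use \<open>i < j\<close> s in simp_all)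
      qed
    next
      assume 1: "i < k \<and> block_index B i = block_index B k" "k < j \<and> block_index B k = block_index B j"
      show ?thesis
        by (rule down[OF less_trans[OF conjunct1[OF 1(1)] conjunct1[OF 1(2)]]
              trans[OF conjunct2[OF 1(1)] conjunct2[OF 1(2)]]])
    qed
  qed
qed

lemma seaweed_iff:
  assumes n: "sum_list A = n"
  shows "X \<in> seaweed n A B \<longleftrightarrow> X \<in> supported {(i, j). seaweed_position A B i j} \<and> (\<Sum>i\<in>{1..n}. X i i) = 0"
proof
  let ?W = "{X \<in> supported {(i, j). seaweed_position A B i j}. (\<Sum>i\<in>{1..n}. X i i) = 0}"
  assume "X \<in> seaweed n A B"
  moreover have "seaweed n A B \<subseteq> ?W"
    unfolding seaweed_def
  proof (rule mat.span_minimal)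
    show "mat.subspace ?W"
      by (intro mat.subspaceI) (auto simp: supported_def sum.distrib sum_distrib_left[symmetric])
    have "matrix_unit i j k k = 0" if "i \<noteq> j" for i j k using that by (auto simp: matrix_unit_apply)
    then show "traceless_diagonal n
      \<union> {matrix_unit i j | i j. i \<in> {1..n} \<and> j \<in> {1..n} \<and> i > j \<and> block_index A i = block_index A j}
      \<union> {matrix_unit i j | i j. i \<in> {1..n} \<and> j \<in> {1..n} \<and> i < j \<and> block_index B i = block_index B j} \<subseteq> ?W"
      using n by (auto simp: traceless_diagonal_def supported_def seaweed_position_def matrix_unit_apply)
  qed
  ultimately show "X \<in> supported {(i, j). seaweed_position A B i j} \<and> (\<Sum>i\<in>{1..n}. X i i) = 0" by auto
next
  assume X: "X \<in> supported {(i, j). seaweed_position A B i j} \<and> (\<Sum>i\<in>{1..n}. X i i) = 0"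
  let ?P = "{(i, j). seaweed_position A B i j \<and> i \<noteq> j}"
  let ?D = "\<lambda>i j. if i = j then X i j else 0"
  have fin: "finite ?P" by (rule finite_subset[OF _ finite_seaweed_positions[of A B]]) auto
  have D: "?D \<in> traceless_diagonal n"
    using X n by (auto simp: traceless_diagonal_def supported_def seaweed_position_def) 
  have O: "(\<lambda>i j. if i = j then 0 else X i j) \<in> supported ?P"
    using X by (auto simp: supported_def)
  have e: "X = ?D + (\<lambda>i j. if i = j then 0 else X i j)" by (auto simp: fun_eq_iff)
  have o: "(\<lambda>i j. if i = j then 0 else X i j) \<in> seaweed n A B"
  proof -
    have "(\<lambda>i j. if i = j then 0 else X i j) \<in> mat.span ((\<lambda>(i, j). matrix_unit i j) ` ?P)"
      using O span_matrix_units[OF fin] by simp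
    moreover have "(\<lambda>(i, j). matrix_unit i j) ` ?P \<subseteq> traceless_diagonal n
      \<union> {matrix_unit i j | i j. i \<in> {1..n} \<and> j \<in> {1..n} \<and> i > j \<and> block_index A i = block_index A j}
      \<union> {matrix_unit i j | i j. i \<in> {1..n} \<and> j \<in> {1..n} \<and> i < j \<and> block_index B i = block_index B j}"
      using n by (auto simp: seaweed_position_def)
    ultimately show ?thesis unfolding seaweed_def using mat.span_mono by blast
  qed
  have d: "?D \<in> seaweed n A B" unfolding seaweed_def using D by (intro mat.span_base) auto
  have s: "mat.subspace (seaweed n A B)" by (simp add: seaweed_def mat.subspace_span)
  show "X \<in> seaweed n A B" by (subst e) (rule mat.subspace_add[OF s d o])
qed

lemma seaweed_lie_algebra:
  assumes n: "sum_list A = n" shows "seaweed_lie_algebra n A B"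
proof unfold_locales
  let ?S = "{(i, j). seaweed_position A B i j}"
  show "\<exists>G. finite G \<and> mat.span G = seaweed n A B"
  proof -
    obtain G where G: "G \<subseteq> seaweed n A B" "mat.independent G" "seaweed n A B \<subseteq> mat.span G"
      by (rule mat.basis_exists[of "seaweed n A B"])
    have "G \<subseteq> mat.span ((\<lambda>(i, j). matrix_unit i j) ` ?S)"
      unfolding span_matrix_units[OF finite_seaweed_positions] using G(1) seaweed_iff[OF n] by blast
    then have "finite G"
      using mat.independent_span_bound[OF finite_imageI[OF finite_seaweed_positions] G(2)] by blast
    moreover have "mat.span G = seaweed n A B"
    proof
      show "mat.span G \<subseteq> seaweed n A B"
        by (rule mat.span_minimal[OF G(1)]) (simp add: seaweed_def mat.subspace_span)
    qed (rule G(3))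
    ultimately show ?thesis by blast
  qed
  fix X Y Z :: "nat \<Rightarrow> nat \<Rightarrow> complex" and c :: complex
  show "commutator n X Y \<in> seaweed n A B" if X: "X \<in> seaweed n A B" and Y: "Y \<in> seaweed n A B"
  proof -
    have prod: "mat_mult n X Y i j = 0" if X: "X \<in> seaweed n A B" and Y: "Y \<in> seaweed n A B"
      and ij: "\<not> seaweed_position A B i j" for X Y i j
      unfolding mat_mult_def
    proof (intro sum.neutral ballI)
      fix k
      have "\<not> seaweed_position A B i k \<or> \<not> seaweed_position A B k j"
        using seaweed_position_trans ij by blast
      then show "X i k * Y k j = 0" using X Y seaweed_iff[OF n] by (auto simp: supported_def)
    qed
    show ?thesis
      using prod[OF X Y] prod[OF Y X] commutator_trace[of n X Y]
      unfolding seaweed_iff[OF n] by (auto simp: supported_def commutator_def)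
  qed
  show "commutator n (X + Y) Z = commutator n X Z + commutator n Y Z"
    "commutator n X (Y + Z) = commutator n X Y + commutator n X Z"
    by (auto simp: commutator_def mat_mult_add_left mat_mult_add_right algebra_simps)
  show "commutator n (mat_scale c X) Y = mat_scale c (commutator n X Y)"
    "commutator n X (mat_scale c Y) = mat_scale c (commutator n X Y)"
    by (auto simp: commutator_def mat_mult_scale_left mat_mult_scale_right mat.scale_right_diff_distrib)
  show "commutator n X X = 0" by (simp add: commutator_def)
  show "commutator n X (commutator n Y Z) + commutator n Y (commutator n Z X) + commutator n Z (commutator n X Y) = 0"
    by (rule commutator_jacobi)
qed

definition meander_functional :: "nat list \<Rightarrow> nat list \<Rightarrow> (nat \<Rightarrow> nat \<Rightarrow> complex) \<Rightarrow> complex" where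
  "meander_functional A B X = (\<Sum>j\<in>{1..sum_list A}.
     (if j < block_mirror A j then X (block_mirror A j) j else 0) +
     (if block_mirror B j < j then X (block_mirror B j) j else 0))"

lemma commutator_matrix_unit:
  assumes "p \<in> {1..n}" "q \<in> {1..n}"
  shows "commutator n X (matrix_unit p q) k l = (if l = q then X k p else 0) - (if k = p then X q l else 0)"
proof -
  have "mat_mult n X (matrix_unit p q) k l = (\<Sum>i\<in>{1..n}. if i = p then (if l = q then X k p else 0) else 0)"
    unfolding mat_mult_def by (intro sum.cong) (auto simp: matrix_unit_apply)
  moreover have "mat_mult n (matrix_unit p q) X k l = (\<Sum>i\<in>{1..n}. if i = q then (if k = p then X q l else 0) else 0)"
    unfolding mat_mult_def by (intro sum.cong) (auto simp: matrix_unit_apply)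
  ultimately show ?thesis using assms by (simp add: commutator_def)
qed

lemma meander_functional_bracket:
  assumes n: "sum_list A = n" "sum_list B = n" and p: "p \<in> {1..n}" and q: "q \<in> {1..n}"
  shows "meander_functional A B (commutator n X (matrix_unit p q)) =
      ((if q < block_mirror A q then X (block_mirror A q) p else 0) +
       (if block_mirror B q < q then X (block_mirror B q) p else 0)) -
      ((if block_mirror A p < p then X q (block_mirror A p) else 0) +
       (if p < block_mirror B p then X q (block_mirror B p) else 0))"
proof -
  have mA: "block_mirror A j \<in> {1..n}" "block_mirror A (block_mirror A j) = j" if "j \<in> {1..n}" for j
    using block_mirror_range[of j A] block_mirror_involution[of j A] that n by auto
  have mB: "block_mirror B j \<in> {1..n}" "block_mirror B (block_mirror B j) = j" if "j \<in> {1..n}" for j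
    using block_mirror_range[of j B] block_mirror_involution[of j B] that n by auto
  let ?C = "commutator n X (matrix_unit p q)"
  have "meander_functional A B ?C =
      (\<Sum>j\<in>{1..n}. (if j = q then (if q < block_mirror A q then X (block_mirror A q) p else 0) else 0)) +
      (\<Sum>j\<in>{1..n}. (if j = q then (if block_mirror B q < q then X (block_mirror B q) p else 0) else 0)) -
      (\<Sum>j\<in>{1..n}. (if j = block_mirror A p then (if block_mirror A p < p then X q (block_mirror A p) else 0) else 0)) -
      (\<Sum>j\<in>{1..n}. (if j = block_mirror B p then (if p < block_mirror B p then X q (block_mirror B p) else 0) else 0))"
    unfolding meander_functional_def n(1) sum.distrib[symmetric] sum_subtractf[symmetric]
  proof (intro sum.cong refl)
    fix j assume j: "j \<in> {1..n}"
    have eqA: "block_mirror A j = p \<longleftrightarrow> j = block_mirror A p" using mA j p by metis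
    have eqB: "block_mirror B j = p \<longleftrightarrow> j = block_mirror B p" using mB j p by metis
    have a: "(if j < block_mirror A j then ?C (block_mirror A j) j else 0) =
        (if j = q then (if q < block_mirror A q then X (block_mirror A q) p else 0) else 0) -
        (if j = block_mirror A p then (if block_mirror A p < p then X q (block_mirror A p) else 0) else 0)"
      unfolding commutator_matrix_unit[OF p q] eqA using mA(2)[OF p] by auto
    have b: "(if block_mirror B j < j then ?C (block_mirror B j) j else 0) =
        (if j = q then (if block_mirror B q < q then X (block_mirror B q) p else 0) else 0) -
        (if j = block_mirror B p then (if p < block_mirror B p then X q (block_mirror B p) else 0) else 0)"
      unfolding commutator_matrix_unit[OF p q] eqB using mB(2)[OF p] by auto
    show "(if j < block_mirror A j then ?C (block_mirror A j) j else 0) +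
         (if block_mirror B j < j then ?C (block_mirror B j) j else 0) =
         (if j = q then if q < block_mirror A q then X (block_mirror A q) p else 0 else 0) +
         (if j = q then if block_mirror B q < q then X (block_mirror B q) p else 0 else 0) -
         (if j = block_mirror A p then if block_mirror A p < p then X q (block_mirror A p) else 0 else 0) -
         (if j = block_mirror B p then if p < block_mirror B p then X q (block_mirror B p) else 0 else 0)"
      unfolding a b by (simp only: add_diff_eq diff_diff_eq2 diff_add_eq ac_simps)
  qed
  then show ?thesis using p q mA(1)[OF p] mB(1)[OF p] by simp
qed

text \<open>
  Testing an element \<open>X\<close> of the radical against matrix units gives the equations of \<^const>\<open>meander_kernel\<close>
  off the diagonal. Only traceless diagonal matrices can be tested, so on the diagonal the errors of
  the equations are merely equal; but their sum is the trace of a commutator, hence they vanish. By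
  rigidity \<open>X\<close> is a scalar matrix, and its trace is zero.
\<close>

lemma meander_functional_frobenius:
  assumes n: "sum_list A = n" "n \<ge> 1" and rigid: "rigid A B"
  shows "seaweed_frobenius_functional n A B (meander_functional A B)"
proof -
  interpret L: fin_dim_lie_algebra mat_scale "commutator n" "seaweed n A B"
    by (rule seaweed_lie_algebra[OF n(1)])
  have nB: "sum_list B = n" using rigid n by (simp add: rigid_def)
  have mA: "block_mirror A j \<in> {1..n}" "block_mirror A (block_mirror A j) = j" if "j \<in> {1..n}" for j
    using block_mirror_range[of j A] block_mirror_involution[of j A] that n by auto
  have mB: "block_mirror B j \<in> {1..n}" "block_mirror B (block_mirror B j) = j" if "j \<in> {1..n}" for j
    using block_mirror_range[of j B] block_mirror_involution[of j B] that nB by auto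
  let ?F = "meander_functional A B"
  have F_add: "?F (X + Y) = ?F X + ?F Y" for X Y
    unfolding meander_functional_def sum.distrib[symmetric] by (intro sum.cong) auto
  have F_scale: "?F (mat_scale c X) = c * ?F X" for X c
    unfolding meander_functional_def sum_distrib_left by (intro sum.cong) (auto simp: algebra_simps)
  show ?thesis
    unfolding L.frobenius_functional_iff L.linear_functional_def
  proof (intro conjI ballI allI impI F_add F_scale)
    fix X assume Xg: "X \<in> seaweed n A B" and ker: "\<forall>Y\<in>seaweed n A B. ?F (commutator n X Y) = 0"
    let ?z = "\<lambda>p q. ?F (commutator n X (matrix_unit p q))"
    have supp: "X i j = 0" if "\<not> seaweed_position A B i j" for i j
      using Xg that unfolding seaweed_iff[OF n(1)] by (auto simp: supported_def)
    have off: "?z p q = 0" if "seaweed_position A B p q" "p \<noteq> q" for p q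
    proof -
      have "matrix_unit p q \<in> seaweed n A B"
        unfolding seaweed_iff[OF n(1)] using that
        by (auto simp: supported_def matrix_unit_apply intro!: sum.neutral)
      then show ?thesis using ker by blast
    qed
    have diag: "?z p p = ?z q q" if "p \<in> {1..n}" "q \<in> {1..n}" for p q
    proof -
      have s: "(\<Sum>k\<in>{1..n}. matrix_unit p p k k) = 1" if "p \<in> {1..n}" for p
        using that by (simp add: matrix_unit_apply)
      have "matrix_unit p p - matrix_unit q q \<in> seaweed n A B"
        unfolding seaweed_iff[OF n(1)]
      proof
        show "matrix_unit p p - matrix_unit q q \<in> supported {(i, j). seaweed_position A B i j}"
          using that n by (auto simp: supported_def matrix_unit_apply seaweed_position_def)
        show "(\<Sum>k\<in>{1..n}. (matrix_unit p p - matrix_unit q q) k k) = 0"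
          using s[OF that(1)] s[OF that(2)] by (simp add: sum_subtractf)
      qed
      then have "?F (commutator n X (matrix_unit p p - matrix_unit q q)) = 0" using ker by blast
      moreover have "commutator n X (matrix_unit p p) =
          commutator n X (matrix_unit p p - matrix_unit q q) + commutator n X (matrix_unit q q)"
        by (simp add: commutator_def mat_mult_diff_left mat_mult_diff_right algebra_simps)
      ultimately show ?thesis using F_add by simp
    qed
    have total: "(\<Sum>p\<in>{1..n}. ?z p p) = 0"
    proof -
      have A1: "(\<Sum>p\<in>{1..n}. if p < block_mirror A p then X (block_mirror A p) p else 0) =
          (\<Sum>p\<in>{1..n}. if block_mirror A p < p then X p (block_mirror A p) else 0)"
        by (rule sum.reindex_bij_witness[of _ "block_mirror A" "block_mirror A"]) (use mA in auto)
      have B1: "(\<Sum>p\<in>{1..n}. if block_mirror B p < p then X (block_mirror B p) p else 0) =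
          (\<Sum>p\<in>{1..n}. if p < block_mirror B p then X p (block_mirror B p) else 0)"
        by (rule sum.reindex_bij_witness[of _ "block_mirror B" "block_mirror B"]) (use mB in auto)
      have "(\<Sum>p\<in>{1..n}. ?z p p) = (\<Sum>p\<in>{1..n}.
         ((if p < block_mirror A p then X (block_mirror A p) p else 0) +
          (if block_mirror B p < p then X (block_mirror B p) p else 0)) -
         ((if block_mirror A p < p then X p (block_mirror A p) else 0) +
          (if p < block_mirror B p then X p (block_mirror B p) else 0)))"
        using meander_functional_bracket[OF n(1) nB] by (intro sum.cong refl) blast
      also have "\<dots> = 0" unfolding sum_subtractf sum.distrib A1 B1 by simp
      finally show ?thesis .
    qed
    have on: "?z q q = 0" if q: "q \<in> {1..n}" for q
    proof -
      have "(\<Sum>p\<in>{1..n}. ?z p p) = (\<Sum>p\<in>{1..n}. ?z q q)"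
        by (intro sum.cong refl) (rule diag[OF _ q])
      then have "of_nat n * ?z q q = 0" unfolding total by simp
      then show ?thesis using n(2) by (simp only: mult_eq_0_iff of_nat_eq_0_iff) simp
    qed
    have "meander_kernel A B X"
      unfolding meander_kernel_def
    proof (intro conjI allI impI supp)
      fix i j assume s: "seaweed_position A B i j"
      then have ij: "i \<in> {1..n}" "j \<in> {1..n}" using n by (auto simp: seaweed_position_def)
      have "?z i j = 0" using off[OF s] on ij by (cases "i = j") auto
      then show "(if j < block_mirror A j then X (block_mirror A j) i else 0) +
        (if block_mirror B j < j then X (block_mirror B j) i else 0) =
        (if block_mirror A i < i then X j (block_mirror A i) else 0) +
        (if i < block_mirror B i then X j (block_mirror B i) else 0)"
        unfolding meander_functional_bracket[OF n(1) nB ij] by (simp only: right_minus_eq)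
    qed
    then obtain c where c: "\<forall>i\<in>{1..n}. \<forall>j\<in>{1..n}. X i j = (if i = j then c else 0)"
      using rigid n unfolding rigid_def by blast
    have "(\<Sum>i\<in>{1..n}. X i i) = of_nat n * c" using c by simp
    then have "c = 0" using Xg n(2) unfolding seaweed_iff[OF n(1)] by auto
    then have "X i j = 0" for i j
      using c supp[of i j] n by (cases "i \<in> {1..n} \<and> j \<in> {1..n}") (auto simp: seaweed_position_def)
    then show "X = 0" by (auto simp: fun_eq_iff)
  qed
qed

section \<open>Seaweeds graded by a potential\<close>

text \<open>
  Ordered pairs of vertices of a common block (equal vertices included) with potential difference \<open>m\<close>.
\<close>

definition diff_count :: "nat list \<Rightarrow> (nat \<Rightarrow> int) \<Rightarrow> int \<Rightarrow> nat" where
  "diff_count A d m = (\<Sum>i\<in>{1..sum_list A}. \<Sum>j\<in>{1..sum_list A}.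
     if block_index A i = block_index A j \<and> d i - d j = m then 1 else 0)"

lemma card_pairs:
  "card {(i, j). i \<in> {1..n::nat} \<and> j \<in> {1..n} \<and> \<Phi> i j} = (\<Sum>i\<in>{1..n}. \<Sum>j\<in>{1..n}. if \<Phi> i j then 1 else 0)"
proof -
  have "{(i, j). i \<in> {1..n} \<and> j \<in> {1..n} \<and> \<Phi> i j} = (SIGMA i:{1..n}. {j \<in> {1..n}. \<Phi> i j})" by auto
  then have "card {(i, j). i \<in> {1..n} \<and> j \<in> {1..n} \<and> \<Phi> i j} = (\<Sum>i\<in>{1..n}. card {j \<in> {1..n}. \<Phi> i j})"
    by simp
  also have "\<dots> = (\<Sum>i\<in>{1..n}. \<Sum>j\<in>{1..n}. if \<Phi> i j then 1 else 0)"
    by (intro sum.cong refl) (simp add: sum.If_cases Int_def)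
  finally show ?thesis .
qed

text \<open>
  The potential \<open>d\<close> grows by one along every arc, from left to right on top and from right to left at the
  bottom, so the matrix units that the meander functional sees have degree one.
\<close>

locale graded_seaweed =
  fixes A B :: "nat list" and n :: nat and d :: "nat \<Rightarrow> int"
  assumes sum_A: "sum_list A = n" and pos: "n \<ge> 1" and rigid: "rigid A B"
    and top_arc: "\<And>j. j \<in> {1..n} \<Longrightarrow> j < block_mirror A j \<Longrightarrow> d (block_mirror A j) = d j + 1"
    and bottom_arc: "\<And>j. j \<in> {1..n} \<Longrightarrow> block_mirror B j < j \<Longrightarrow> d (block_mirror B j) = d j + 1"
begin

lemma sum_B: "sum_list B = n"
  using rigid sum_A by (simp add: rigid_def)

sublocale L: fin_dim_lie_algebra mat_scale "commutator n" "seaweed n A B"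
  by (rule seaweed_lie_algebra[OF sum_A])

abbreviation "F\<^sub>0 \<equiv> meander_functional A B"

lemma frobenius_F\<^sub>0: "L.frobenius_functional F\<^sub>0"
  by (rule meander_functional_frobenius[OF sum_A pos rigid])

text \<open>
  The diagonal belongs to degree zero here, although only its traceless part lies in the algebra;
  hence the correction in \<open>principal_mult_F\<^sub>0\<close>.
\<close>

definition "positions m = {(i, j). seaweed_position A B i j \<and> d i - d j = m}"

lemma finite_positions: "finite (positions m)"
  by (rule finite_subset[OF _ finite_seaweed_positions[of A B]]) (auto simp: positions_def)

definition grading_element :: "nat \<Rightarrow> nat \<Rightarrow> complex" where
  "grading_element i j = (if i = j \<and> i \<in> {1..n} then of_int (d i) - (\<Sum>k\<in>{1..n}. of_int (d k)) / of_nat n else 0)"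

lemma grading_element_mem: "grading_element \<in> seaweed n A B"
  unfolding seaweed_iff[OF sum_A]
proof
  show "grading_element \<in> supported {(i, j). seaweed_position A B i j}"
    using sum_A by (auto simp: supported_def grading_element_def seaweed_position_def)
  have "(\<Sum>i\<in>{1..n}. grading_element i i) = (\<Sum>i\<in>{1..n}. of_int (d i) - (\<Sum>k\<in>{1..n}. of_int (d k)) / of_nat n)"
    by (intro sum.cong) (auto simp: grading_element_def)
  also have "\<dots> = 0" using pos by (simp add: sum_subtractf)
  finally show "(\<Sum>i\<in>{1..n}. grading_element i i) = 0" .
qed

lemma seaweed_support: "X \<in> seaweed n A B \<Longrightarrow> \<not> seaweed_position A B i j \<Longrightarrow> X i j = 0"
  unfolding seaweed_iff[OF sum_A] by (auto simp: supported_def)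

lemma seaweed_position_range: "seaweed_position A B i j \<Longrightarrow> i \<in> {1..n} \<and> j \<in> {1..n}"
  using sum_A by (auto simp: seaweed_position_def)

lemma ad_grading_element:
  assumes X: "X \<in> seaweed n A B"
  shows "commutator n grading_element X i j = of_int (d i - d j) * X i j"
proof (cases "i \<in> {1..n} \<and> j \<in> {1..n}")
  case True
  have "mat_mult n grading_element X i j = (\<Sum>k\<in>{1..n}. if k = i then grading_element i i * X i j else 0)"
    unfolding mat_mult_def by (intro sum.cong) (auto simp: grading_element_def)
  moreover have "mat_mult n X grading_element i j = (\<Sum>k\<in>{1..n}. if k = j then X i j * grading_element j j else 0)"
    unfolding mat_mult_def by (intro sum.cong) (auto simp: grading_element_def)
  ultimately have "commutator n grading_element X i j = (grading_element i i - grading_element j j) * X i j"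
    using True by (simp add: commutator_def algebra_simps)
  also have "grading_element i i - grading_element j j = of_int (d i - d j)"
    using True by (simp add: grading_element_def)
  finally show ?thesis .
next
  case False
  have "X i k * grading_element k j = 0" "grading_element i k * X k j = 0" for k
    using False seaweed_support[OF X] seaweed_position_range by (auto simp: grading_element_def)
  then have "commutator n grading_element X i j = 0"
    unfolding commutator_def mat_mult_def fun_diff_def by (simp only: sum.neutral_const diff_self)
  moreover have "X i j = 0" using False seaweed_support[OF X] seaweed_position_range by blast
  ultimately show ?thesis by simp
qed

lemma principal_element_F\<^sub>0: "L.principal_element F\<^sub>0 = grading_element"
proof (rule L.principal_element_eqI[OF frobenius_F\<^sub>0 grading_element_mem])
  fix X assume X: "X \<in> seaweed n A B"
  show "F\<^sub>0 (commutator n grading_element X) = F\<^sub>0 X"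
    unfolding meander_functional_def sum_A ad_grading_element[OF X]
    using top_arc bottom_arc by (intro sum.cong) (auto split: if_splits)
qed

lemma eigenspace_iff:
  "X \<in> L.ad_eigenspace grading_element (of_int m) \<longleftrightarrow>
     X \<in> supported (positions m) \<and> (\<Sum>i\<in>{1..n}. X i i) = 0"
proof
  assume "X \<in> L.ad_eigenspace grading_element (of_int m)"
  then have X: "X \<in> seaweed n A B" and e: "commutator n grading_element X = mat_scale (of_int m) X"
    by (auto simp: L.ad_eigenspace_iff)
  have "X i j = 0" if "(i, j) \<notin> positions m" for i j
  proof (cases "seaweed_position A B i j")
    case True
    then have "d i - d j \<noteq> m" using that by (simp add: positions_def)
    moreover have "of_int (d i - d j) * X i j = of_int m * X i j"
      using fun_cong[OF fun_cong[OF e], of i j] ad_grading_element[OF X] by simp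
    ultimately show ?thesis by (metis mult_right_cancel of_int_eq_iff)
  qed (rule seaweed_support[OF X])
  then show "X \<in> supported (positions m) \<and> (\<Sum>i\<in>{1..n}. X i i) = 0"
    using X unfolding seaweed_iff[OF sum_A] by (auto simp: supported_def)
next
  assume r: "X \<in> supported (positions m) \<and> (\<Sum>i\<in>{1..n}. X i i) = 0"
  then have X: "X \<in> seaweed n A B"
    unfolding seaweed_iff[OF sum_A] by (auto simp: supported_def positions_def)
  have "commutator n grading_element X = mat_scale (of_int m) X"
  proof (intro ext)
    fix i j
    show "commutator n grading_element X i j = mat_scale (of_int m) X i j"
      unfolding ad_grading_element[OF X]
      using r by (cases "(i, j) \<in> positions m") (auto simp: supported_def positions_def)
  qed
  then show "X \<in> L.ad_eigenspace grading_element (of_int m)"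
    using X by (simp add: L.ad_eigenspace_iff)
qed

lemma semisimple_integral_F\<^sub>0: "L.semisimple_integral_grading F\<^sub>0"
  unfolding L.semisimple_integral_grading_def principal_element_F\<^sub>0 L.ad_semisimple_def
proof (intro conjI allI impI)
  let ?U = "\<Union>c. L.ad_eigenspace grading_element c"
  show "mat.span ?U = seaweed n A B"
  proof
    show "mat.span ?U \<subseteq> seaweed n A B"
      using L.ad_eigenspace_subset by (intro mat.span_minimal L.subspace_algebra) auto
    have "X \<in> ?U" if "X \<in> traceless_diagonal n" for X
    proof -
      have "X \<in> L.ad_eigenspace grading_element (of_int 0)"
        unfolding eigenspace_iff using that sum_A
        by (auto simp: traceless_diagonal_def supported_def positions_def seaweed_position_def)
      then show ?thesis by blast
    qed
    moreover have "matrix_unit i j \<in> ?U" if "seaweed_position A B i j" "i \<noteq> j" for i j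
    proof -
      have "matrix_unit i j \<in> L.ad_eigenspace grading_element (of_int (d i - d j))"
        unfolding eigenspace_iff using that
        by (auto simp: supported_def positions_def matrix_unit_apply intro!: sum.neutral)
      then show ?thesis by blast
    qed
    ultimately show "seaweed n A B \<subseteq> mat.span ?U"
      unfolding seaweed_def using sum_A
      by (intro mat.span_mono) (auto simp: seaweed_position_def)
  qed
next
  fix c assume "L.ad_eigenspace grading_element c \<noteq> {0}"
  moreover have "0 \<in> L.ad_eigenspace grading_element c"
    by (rule mat.subspace_0[OF L.subspace_ad_eigenspace[OF grading_element_mem]])
  ultimately obtain X where X: "X \<in> L.ad_eigenspace grading_element c" "X \<noteq> 0" by blast
  then obtain i j where ij: "X i j \<noteq> 0" by (auto simp: fun_eq_iff)
  have "of_int (d i - d j) * X i j = c * X i j"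
    using X(1) ad_grading_element[of X i j] unfolding L.ad_eigenspace_iff by auto
  then have "c = of_int (d i - d j)" using ij by (metis mult_right_cancel)
  then show "c \<in> \<int>" by (simp only: Ints_of_int)
qed

lemma principal_mult_F\<^sub>0:
  "L.principal_mult F\<^sub>0 m + (if m = 0 then 1 else 0) = card (positions m)"
proof -
  let ?V = "L.ad_eigenspace grading_element (of_int m)"
  have pm: "L.principal_mult F\<^sub>0 m = mat.dim ?V"
    by (simp add: L.principal_mult_def principal_element_F\<^sub>0)
  show ?thesis
  proof (cases "m = 0")
    case False
    have "?V = supported (positions m)"
    proof -
      have "(\<Sum>i\<in>{1..n}. X i i) = 0" if "X \<in> supported (positions m)" for X
        using that False by (intro sum.neutral) (auto simp: supported_def positions_def)
      then show ?thesis using eigenspace_iff by blast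
    qed
    then show ?thesis using False pm dim_supported[OF finite_positions] by simp
  next
    case True
    obtain G where G: "finite G" "mat.independent G" "mat.span G = ?V" "card G = mat.dim ?V"
      using L.subspace_finite_basis[OF L.subspace_ad_eigenspace[OF grading_element_mem] L.ad_eigenspace_subset]
      by blast
    \<comment> \<open>Adding one matrix of nonzero trace completes the traceless matrices of degree zero.\<close>
    let ?e = "matrix_unit 1 1"
    have tr_e: "(\<Sum>i\<in>{1..n}. ?e i i) = (1 :: complex)" using pos by (simp add: matrix_unit_apply)
    have e_sup: "?e \<in> supported (positions m)"
      using True pos sum_A by (auto simp: supported_def positions_def matrix_unit_apply seaweed_position_def)
    have "?e \<notin> ?V" unfolding eigenspace_iff using tr_e by simp
    then have e_span: "?e \<notin> mat.span G" using G(3) by simp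
    have ind: "mat.independent (insert ?e G)" using e_span G(2) by (rule mat.independent_insertI)
    have "mat.span (insert ?e G) = supported (positions m)"
    proof
      have "G \<subseteq> supported (positions m)"
        using G(3) mat.span_superset[of G] eigenspace_iff by blast
      then show "mat.span (insert ?e G) \<subseteq> supported (positions m)"
        using e_sup by (intro mat.span_minimal subspace_supported) auto
      show "supported (positions m) \<subseteq> mat.span (insert ?e G)"
      proof
        fix X assume X: "X \<in> supported (positions m)"
        let ?t = "\<Sum>i\<in>{1..n}. X i i"
        have "X - mat_scale ?t ?e \<in> ?V"
          unfolding eigenspace_iff
        proof
          show "X - mat_scale ?t ?e \<in> supported (positions m)"
            by (rule mat.subspace_diff[OF subspace_supported X mat.subspace_scale[OF subspace_supported e_sup]])
          have "(\<Sum>i\<in>{1..n}. (X - mat_scale ?t ?e) i i) = ?t - ?t * (\<Sum>i\<in>{1..n}. ?e i i)"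
            by (simp add: sum_subtractf sum_distrib_left)
          then show "(\<Sum>i\<in>{1..n}. (X - mat_scale ?t ?e) i i) = 0" unfolding tr_e by simp
        qed
        then have "X - mat_scale ?t ?e \<in> mat.span (insert ?e G)"
          using G(3) mat.span_mono[of G "insert ?e G"] by auto
        then have "X - mat_scale ?t ?e + mat_scale ?t ?e \<in> mat.span (insert ?e G)"
          by (rule mat.span_add[OF _ mat.span_scale[OF mat.span_base]]) simp
        then show "X \<in> mat.span (insert ?e G)" by simp
      qed
    qed
    then have "card (insert ?e G) = card (positions m)"
      using mat.dim_span[of "insert ?e G"] mat.dim_eq_card_independent[OF ind] dim_supported[OF finite_positions]
      by simp
    moreover have "?e \<notin> G" using e_span mat.span_base by blast
    ultimately show ?thesis using True G pm by simp
  qed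
qed

text \<open>
  The left side counts the positions of degree \<open>m\<close> and, by the symmetry, those of degree \<open>- m\<close>. Transposing
  the latter, a pair of distinct vertices is counted once for every composition that has both of
  them in one block. The two diagonals account for the correction in degree zero.
\<close>

lemma principal_mult_recurrence:
  "int (L.principal_mult F\<^sub>0 m) + int (L.principal_mult F\<^sub>0 (m + 1)) + (if m = 0 then 2 else 0) =
     int (diff_count A d m) + int (diff_count B d m)"
proof -
  have "L.principal_mult F\<^sub>0 (m + 1) = L.principal_mult F\<^sub>0 (- m)"
    using L.principal_mult_symmetric[OF frobenius_F\<^sub>0, of "- m"] semisimple_integral_F\<^sub>0
    by (simp add: L.semisimple_integral_grading_def add.commute)
  then have "L.principal_mult F\<^sub>0 m + L.principal_mult F\<^sub>0 (m + 1) + (if m = 0 then 2 else 0)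
      = card (positions m) + card (positions (- m))"
    using principal_mult_F\<^sub>0[of m] principal_mult_F\<^sub>0[of "- m"] by (simp split: if_splits)
  also have "card (positions m) =
      (\<Sum>i\<in>{1..n}. \<Sum>j\<in>{1..n}. if seaweed_position A B i j \<and> d i - d j = m then 1 else 0)"
    unfolding card_pairs[symmetric] positions_def
    using seaweed_position_range by (intro arg_cong[where f = card]) auto
  also have "card (positions (- m)) =
      (\<Sum>i\<in>{1..n}. \<Sum>j\<in>{1..n}. if seaweed_position A B i j \<and> d i - d j = - m then 1 else 0)"
    unfolding card_pairs[symmetric] positions_def
    using seaweed_position_range by (intro arg_cong[where f = card]) auto
  also have "\<dots> = (\<Sum>i\<in>{1..n}. \<Sum>j\<in>{1..n}. if seaweed_position A B j i \<and> d i - d j = m then 1 else 0)"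
    by (subst sum.swap) (intro sum.cong refl if_cong, auto)
  also have "(\<Sum>i\<in>{1..n}. \<Sum>j\<in>{1..n}. if seaweed_position A B i j \<and> d i - d j = m then 1 else 0)
      + (\<Sum>i\<in>{1..n}. \<Sum>j\<in>{1..n}. if seaweed_position A B j i \<and> d i - d j = m then 1 else 0)
      = diff_count A d m + diff_count B d m"
    unfolding diff_count_def sum_A sum_B sum.distrib[symmetric]
  proof (intro sum.cong refl)
    fix i j assume "i \<in> {1..n}" "j \<in> {1..n}"
    then show "(if seaweed_position A B i j \<and> d i - d j = m then 1 else 0) +
        (if seaweed_position A B j i \<and> d i - d j = m then 1 else 0) =
        (if block_index A i = block_index A j \<and> d i - d j = m then 1 else 0) +
        (if block_index B i = block_index B j \<and> d i - d j = m then 1 else (0::nat))"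
      using sum_A by (cases i j rule: linorder_cases) (auto simp: seaweed_position_def)
  qed
  finally have "L.principal_mult F\<^sub>0 m + L.principal_mult F\<^sub>0 (m + 1) + (if m = 0 then 2 else 0)
      = diff_count A d m + diff_count B d m" .
  then show ?thesis by (simp split: if_splits)
qed

end

section \<open>The potential of the family\<close>

text \<open>
  The permutation of \<open>{..<t}\<close> that sends \<open>0, 1, 2, \<dots>\<close> to the odd numbers and \<open>t - 1, t - 2, \<dots>\<close> to the even
  numbers, both in increasing order.
\<close>

definition zigzag :: "nat \<Rightarrow> nat \<Rightarrow> nat" where
  "zigzag t a = min (2 * a + 1) (2 * (t - 1 - a))"

text \<open>
  The potential at column \<open>x\<close> of row \<open>y\<close> when the first \<open>t\<^sup>2\<close> vertices are written in \<open>t\<close> rows. Following two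
  arcs of the core meander shifts a vertex by a whole row and the potential by two, which produces the
  zigzag in both directions; the rows with odd offset are traversed backwards.
\<close>

definition core_potential :: "nat \<Rightarrow> nat \<Rightarrow> nat \<Rightarrow> int" where
  "core_potential t x y = - int (zigzag t y + (if 2 * y + 1 < 2 * (t - 1 - y) then zigzag t (t - 1 - x) else zigzag t x))"

text \<open>
  The left half of the vertices: the core, whose last vertex opens the first block of size two, then
  the run of these blocks and the central vertex.
\<close>

definition left_potential :: "nat \<Rightarrow> nat \<Rightarrow> int" where
  "left_potential t i =
     (if i \<le> t\<^sup>2 then core_potential t ((i - 1) mod t) ((i - 1) div t)
      else if even (i - t\<^sup>2) then 0 else - 1)"

text \<open>
  The right half is determined by the top arcs, which join \<open>i\<close> to \<open>6 t\<^sup>2 + 1 - i\<close>.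
\<close>

definition potential :: "nat \<Rightarrow> nat \<Rightarrow> int" where
  "potential t i = (if i \<le> 3 * t\<^sup>2 then left_potential t i else left_potential t (6 * t\<^sup>2 + 1 - i) + 1)"

text \<open>
  The condition on the bottom arcs, for one composition at a time: a composite is checked part by part,
  with \<open>d\<close> shifted to the first vertex of the part.
\<close>

definition descending :: "nat list \<Rightarrow> (nat \<Rightarrow> int) \<Rightarrow> bool" where
  "descending A d \<longleftrightarrow> (\<forall>j\<in>{1..sum_list A}. block_mirror A j < j \<longrightarrow> d (block_mirror A j) = d j + 1)"

lemma descending_append:
  assumes "descending A d" "descending B (\<lambda>i. d (sum_list A + i))"
  shows "descending (A @ B) d"
  unfolding descending_def
proof (intro ballI impI)
  fix j assume j: "j \<in> {1..sum_list (A @ B)}" and lt: "block_mirror (A @ B) j < j"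
  show "d (block_mirror (A @ B) j) = d j + 1"
  proof (cases "j \<le> sum_list A")
    case True
    then have m: "block_mirror (A @ B) j = block_mirror A j" using j by (simp add: block_mirror_append)
    show ?thesis using assms(1) j lt True unfolding m descending_def by simp
  next
    case False
    then have m: "block_mirror (A @ B) j = sum_list A + block_mirror B (j - sum_list A)"
      using j by (simp add: block_mirror_append)
    have "j - sum_list A \<in> {1..sum_list B}" "block_mirror B (j - sum_list A) < j - sum_list A"
      using j lt False unfolding m by auto
    then have "d (sum_list A + block_mirror B (j - sum_list A)) = d (sum_list A + (j - sum_list A)) + 1"
      using assms(2) unfolding descending_def by blast
    then show ?thesis unfolding m using False by simp
  qed
qed

lemma descending_single:
  assumes "\<And>j. j \<in> {1..a} \<Longrightarrow> a + 1 < 2 * j \<Longrightarrow> d (a + 1 - j) = d j + 1"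
  shows "descending [a] d"
  using assms by (auto simp: descending_def)

lemma descending_pairs:
  assumes "\<And>k. k < r \<Longrightarrow> d (2 * k + 1) = d (2 * k + 2) + 1"
  shows "descending (replicate r 2) d"
  using assms
proof (induction r arbitrary: d)
  case (Suc r)
  have "descending ([2] @ replicate r 2) d"
  proof (rule descending_append)
    show "descending [2] d"
    proof (rule descending_single)
      fix j :: nat assume j: "j \<in> {1..2}" "2 + 1 < 2 * j"
      then have "j = 2" by auto
      then show "d (2 + 1 - j) = d j + 1" using Suc.prems[of 0] by (simp add: numeral_2_eq_2)
    qed
    show "descending (replicate r 2) (\<lambda>i. d (sum_list [2] + i))"
    proof (rule Suc.IH)
      fix k assume "k < r"
      then show "d (sum_list [2] + (2 * k + 1)) = d (sum_list [2] + (2 * k + 2)) + 1"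
        using Suc.prems[of "Suc k"] by (simp add: algebra_simps)
    qed
  qed
  then show ?case by simp
qed (simp add: descending_def)

text \<open>
  The half turn of the grid exchanges the two branches of the zigzag, so it changes the offset of a row by
  one; in the middle row of an odd grid the offset stays and the change happens within the row.
\<close>

lemma core_rotate:
  assumes "x < t" "y < t" "t - 1 - y < y \<or> (y = t - 1 - y \<and> t - 1 - x < x)"
  shows "core_potential t x y = core_potential t (t - 1 - x) (t - 1 - y) + 1"
proof -
  obtain x' y' where t: "t = x + x' + 1" "t = y + y' + 1"
    using assms(1,2) by (metis add.commute add_Suc_right less_imp_Suc_add plus_1_eq_Suc)
  then have s: "t - 1 - x = x'" "t - 1 - y = y'" "t - 1 - x' = x" "t - 1 - y' = y" by auto
  show ?thesis
    using assms(3) t unfolding core_potential_def zigzag_def s by (auto simp: min_def; presburger)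
qed

text \<open>
  The reflection of the first block is the half turn of the grid without its last row.
\<close>

lemma core_rotate_short:
  assumes "x < t" "Suc y < t" "t - 2 - y < y \<or> (y = t - 2 - y \<and> t - 1 - x < x)"
  shows "core_potential t (t - 1 - x) (t - 2 - y) = core_potential t x y + 1"
proof -
  obtain x' where t: "t = x + x' + 1"
    using assms(1) by (metis add.commute add_Suc_right less_imp_Suc_add plus_1_eq_Suc)
  obtain y' where t2: "t = y + y' + 2"
    using assms(2) by (metis add.commute add_2_eq_Suc' add_Suc_right less_imp_Suc_add add_Suc)
  have s: "t - 1 - x = x'" "t - 2 - y = y'" "t - 1 - x' = x" "t - 1 - y' = Suc y" "t - 1 - y = Suc y'" using t t2 by auto
  show ?thesis
    using assms(3) t t2 unfolding core_potential_def zigzag_def s by (auto simp: min_def; presburger)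
qed

text \<open>
  The second block is the last row without its last vertex.
\<close>

lemma core_last_row:
  assumes "Suc x < t" "t - 2 - x < x"
  shows "core_potential t (t - 2 - x) (t - 1) = core_potential t x (t - 1) + 1"
proof -
  obtain x' where t: "t = x + x' + 2"
    using assms(1) by (metis add.commute add_2_eq_Suc' add_Suc_right less_imp_Suc_add add_Suc)
  have s: "t - 2 - x = x'" "t - 1 - x = Suc x'" "t - 1 - x' = Suc x" using t by auto
  show ?thesis
    using assms(2) t unfolding core_potential_def zigzag_def s by (auto simp: min_def; presburger)
qed

lemma grid_coordinates:
  fixes j t k :: nat
  assumes "1 \<le> j" "j \<le> t * k"
  obtains x y where "x < t" "y < k" "j = 1 + x + t * y"
proof -
  have t: "t > 0" using assms by (cases t) auto
  have "(j - 1) div t < k" using assms t by (simp add: less_mult_imp_div_less mult.commute)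
  moreover have "j = 1 + (j - 1) mod t + t * ((j - 1) div t)" using assms by simp
  ultimately show thesis using that t mod_less_divisor by blast
qed

lemma left_potential_grid:
  assumes "x < t" "y < t" shows "left_potential t (1 + x + t * y) = core_potential t x y"
proof -
  have "t * Suc y \<le> t * t" using assms(2) by (intro mult_le_mono2) simp
  then have "1 + x + t * y \<le> t\<^sup>2" using assms(1) by (simp add: power2_eq_square)
  then show ?thesis using assms by (simp add: left_potential_def)
qed

lemma left_potential_rotate:
  assumes j: "1 \<le> j" "j \<le> t\<^sup>2" "t\<^sup>2 + 1 < 2 * j"
  shows "left_potential t j = left_potential t (t\<^sup>2 + 1 - j) + 1"
proof -
  obtain x y where xy: "x < t" "y < t" "j = 1 + x + t * y"
    using grid_coordinates[of j t t] j by (auto simp: power2_eq_square)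
  obtain x' y' where t: "t = x + x' + 1" "t = y + y' + 1"
    using xy(1,2) by (metis add.commute add_Suc_right less_imp_Suc_add plus_1_eq_Suc)
  have s: "x' = t - 1 - x" "y' = t - 1 - y" "x' < t" "y' < t" using t by auto
  have "t\<^sup>2 = t * (y + y' + 1)" using t(2) by (simp add: power2_eq_square)
  then have sq: "t\<^sup>2 = t * y + t * y' + t" by (simp add: algebra_simps)
  then have e: "t\<^sup>2 + 1 - j = 1 + x' + t * y'" using xy(3) t(1) by simp
  have "y' < y \<or> (y = y' \<and> x' < x)"
  proof (rule ccontr)
    assume n: "\<not> (y' < y \<or> (y = y' \<and> x' < x))"
    have lt: "t * y' + x' < t * y + x" using j(3) xy(3) sq t(1) by linarith
    show False
    proof (cases "y = y'")
      case False
      then have "t * Suc y \<le> t * y'" using n by (intro mult_le_mono2) simp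
      then show False using lt xy(1) by simp
    qed (use n lt in simp)
  qed
  then show ?thesis
    unfolding e unfolding xy(3) left_potential_grid[OF xy(1,2)] left_potential_grid[OF s(3,4)]
    using core_rotate[OF xy(1,2)] s by simp
qed

lemma left_potential_blocks:
  assumes t: "t \<ge> 2"
  shows "descending [t * (t - 1), t - 1] (left_potential t)"
proof -
  have 1: "descending [t * (t - 1)] (left_potential t)"
  proof (rule descending_single)
    fix j assume j: "j \<in> {1..t * (t - 1)}" "t * (t - 1) + 1 < 2 * j"
    obtain x y where xy: "x < t" "y < t - 1" "j = 1 + x + t * y"
      using grid_coordinates[of j t "t - 1"] j by auto
    obtain x' where t1: "t = x + x' + 1"
      using xy(1) by (metis add.commute add_Suc_right less_imp_Suc_add plus_1_eq_Suc)
    define y' where "y' = t - 2 - y"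
    have t2: "t - 1 = y + y' + 1" using xy(2) by (simp add: y'_def)
    have s: "x' = t - 1 - x" "y' = t - 2 - y" "x' < t" "y' < t" "y < t" "Suc y < t" using t1 t2 by auto
    have sq: "t * (t - 1) = t * y + t * y' + t" unfolding t2 by (simp add: algebra_simps)
    then have e: "t * (t - 1) + 1 - j = 1 + x' + t * y'" using xy(3) t1 by simp
    have "y' < y \<or> (y = y' \<and> x' < x)"
    proof (rule ccontr)
      assume n: "\<not> (y' < y \<or> (y = y' \<and> x' < x))"
      have lt: "t * y' + x' < t * y + x" using j(2) xy(3) sq t1 by linarith
      show False
      proof (cases "y = y'")
        case False
        then have "t * Suc y \<le> t * y'" using n by (intro mult_le_mono2) simp
        then show False using lt xy(1) by simp
      qed (use n lt in simp)
    qed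
    then show "left_potential t (t * (t - 1) + 1 - j) = left_potential t j + 1"
      unfolding e unfolding xy(3) left_potential_grid[OF xy(1) s(5)] left_potential_grid[OF s(3,4)]
      using core_rotate_short[OF xy(1) s(6)] s by simp
  qed
  have 2: "descending [t - 1] (\<lambda>i. left_potential t (sum_list [t * (t - 1)] + i))"
  proof (rule descending_single)
    fix j assume j: "j \<in> {1..t - 1}" "t - 1 + 1 < 2 * j"
    define x where "x = j - 1"
    have x: "j = x + 1" "Suc x < t" "t - 2 - x < x" "x < t" using j t by (auto simp: x_def)
    have "t - 1 + 1 - j = t - 2 - x + 1" using x by simp
    then have "left_potential t (t * (t - 1) + (t - 1 + 1 - j)) = core_potential t (t - 2 - x) (t - 1)"
      using left_potential_grid[of "t - 2 - x" t "t - 1"] t by (simp add: add.commute)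
    moreover have "left_potential t (t * (t - 1) + j) = core_potential t x (t - 1)"
      using left_potential_grid[of x t "t - 1"] t x by (simp add: add.commute)
    ultimately show "left_potential t (sum_list [t * (t - 1)] + (t - 1 + 1 - j)) =
        left_potential t (sum_list [t * (t - 1)] + j) + 1"
      using core_last_row[OF x(2,3)] by simp
  qed
  show ?thesis using descending_append[OF 1 2] by simp
qed

lemma sum_list_pairs: "sum_list (replicate r 2) = 2 * (r :: nat)"
  by (simp add: sum_list_replicate)

lemma left_potential_run:
  assumes "t \<ge> 2" shows "left_potential t (t\<^sup>2 + k) = (if even k then 0 else - 1)"
proof (cases "k = 0")
  case True
  have "t\<^sup>2 = 1 + (t - 1) + t * (t - 1)"
    using assms by (simp add: power2_eq_square algebra_simps diff_mult_distrib2)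
  then have "left_potential t (t\<^sup>2) = core_potential t (t - 1) (t - 1)"
    using left_potential_grid[of "t - 1" t "t - 1"] assms by simp
  then show ?thesis using True by (simp add: core_potential_def zigzag_def)
qed (simp add: left_potential_def)

lemma potential_left_pair:
  assumes "t \<ge> 2" "k < t\<^sup>2"
  shows "potential t (t\<^sup>2 - 1 + (2 * k + 1)) = potential t (t\<^sup>2 - 1 + (2 * k + 2)) + 1"
proof -
  have "t\<^sup>2 - 1 + (2 * k + 1) = t\<^sup>2 + 2 * k" "t\<^sup>2 - 1 + (2 * k + 2) = t\<^sup>2 + (2 * k + 1)"
    using assms(1) by auto
  then show ?thesis
    using assms left_potential_run[of t "2 * k"] left_potential_run[of t "2 * k + 1"] by (simp add: potential_def)
qed

lemma potential_right_pair:
  assumes "t \<ge> 2" "k < t\<^sup>2"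
  shows "potential t (3 * t\<^sup>2 + (2 * k + 1)) = potential t (3 * t\<^sup>2 + (2 * k + 2)) + 1"
proof -
  have e: "6 * t\<^sup>2 + 1 - (3 * t\<^sup>2 + (2 * k + 1)) = t\<^sup>2 + 2 * (t\<^sup>2 - k)"
    "6 * t\<^sup>2 + 1 - (3 * t\<^sup>2 + (2 * k + 2)) = t\<^sup>2 + (2 * (t\<^sup>2 - k - 1) + 1)" using assms(2) by auto
  show ?thesis unfolding potential_def e left_potential_run[OF assms(1)] by simp
qed

lemma potential_bottom:
  assumes t: "t \<ge> 2"
  shows "descending ([t * (t - 1), t - 1] @ replicate (t\<^sup>2) 2 @ [1] @ replicate (t\<^sup>2) 2 @ [t\<^sup>2]) (potential t)"
proof -
  have tt: "t * (t - 1) + (t - 1) = t\<^sup>2 - 1" "1 \<le> t\<^sup>2" "t\<^sup>2 = t * (t - 1) + t"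
    using t by (auto simp: power2_eq_square algebra_simps diff_mult_distrib2)
  have cong: "descending A d'" if "descending A d" "\<And>i. i \<in> {1..sum_list A} \<Longrightarrow> d' i = d i" for A d d'
    using that block_mirror_range[of _ A] unfolding descending_def by auto
  have 1: "descending [t * (t - 1), t - 1] (potential t)"
  proof (rule cong[OF left_potential_blocks[OF t]])
    fix i assume "i \<in> {1..sum_list [t * (t - 1), t - 1]}"
    then have "i \<le> t * (t - 1) + (t - 1)" by simp
    then have "i \<le> 3 * t\<^sup>2" unfolding tt(1) by linarith
    then show "potential t i = left_potential t i" by (simp add: potential_def)
  qed
  have 2: "descending (replicate (t\<^sup>2) 2) (\<lambda>i. potential t (t\<^sup>2 - 1 + i))"
    by (rule descending_pairs) (rule potential_left_pair[OF t])
  have 3: "descending [1] (\<lambda>i. potential t (3 * t\<^sup>2 - 1 + i))"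
    by (rule descending_single) auto
  have 4: "descending (replicate (t\<^sup>2) 2) (\<lambda>i. potential t (3 * t\<^sup>2 + i))"
    by (rule descending_pairs) (rule potential_right_pair[OF t])
  have 5: "descending [t\<^sup>2] (\<lambda>i. potential t (5 * t\<^sup>2 + i))"
  proof (rule descending_single)
    fix j assume j: "j \<in> {1..t\<^sup>2}" "t\<^sup>2 + 1 < 2 * j"
    have "6 * t\<^sup>2 + 1 - (5 * t\<^sup>2 + (t\<^sup>2 + 1 - j)) = j" "6 * t\<^sup>2 + 1 - (5 * t\<^sup>2 + j) = t\<^sup>2 + 1 - j"
      "\<not> 5 * t\<^sup>2 + (t\<^sup>2 + 1 - j) \<le> 3 * t\<^sup>2" "\<not> 5 * t\<^sup>2 + j \<le> 3 * t\<^sup>2"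
      using j tt(2) by auto
    then show "potential t (5 * t\<^sup>2 + (t\<^sup>2 + 1 - j)) = potential t (5 * t\<^sup>2 + j) + 1"
      using left_potential_rotate[of j t] j by (simp add: potential_def)
  qed
  have s: "sum_list [t * (t - 1), t - 1] = t\<^sup>2 - 1" "sum_list [1 :: nat] = 1" using tt by auto
  have shift: "t\<^sup>2 - 1 + (2 * t\<^sup>2 + i) = 3 * t\<^sup>2 - 1 + i" "3 * t\<^sup>2 - 1 + (1 + i) = 3 * t\<^sup>2 + i"
    "3 * t\<^sup>2 + (2 * t\<^sup>2 + i) = 5 * t\<^sup>2 + i" for i
    using tt(2) by auto
  show ?thesis
    by (intro descending_append) (simp_all only: s sum_list_pairs shift 1 2 3 4 5)
qed

lemma graded_family: "graded_seaweed [family_size L] (family_composition L) (family_size L) (potential (L + 5))"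
proof -
  define t where "t = L + 5"
  have t: "t \<ge> 2" "1 \<le> t\<^sup>2" by (auto simp: t_def power2_eq_square)
  have n: "family_size L = 6 * t\<^sup>2" by (simp add: family_size_def Let_def t_def)
  have B: "family_composition L = [t * (t - 1), t - 1] @ replicate (t\<^sup>2) 2 @ [1] @ replicate (t\<^sup>2) 2 @ [t\<^sup>2]"
    by (simp add: family_composition_def Let_def t_def)
  have rigid: "rigid [family_size L] (family_composition L)" by (rule rigid_family)
  show ?thesis
    unfolding t_def[symmetric]
  proof
    show "sum_list [family_size L] = family_size L" "rigid [family_size L] (family_composition L)"
      using rigid by auto
    show "1 \<le> family_size L" using t n by simp
    fix j assume j: "j \<in> {1..family_size L}"
    show "potential t (block_mirror [family_size L] j) = potential t j + 1"
      if "j < block_mirror [family_size L] j"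
    proof -
      have m: "block_mirror [family_size L] j = 6 * t\<^sup>2 + 1 - j" using j n by simp
      then have "j \<le> 3 * t\<^sup>2" "\<not> 6 * t\<^sup>2 + 1 - j \<le> 3 * t\<^sup>2" "6 * t\<^sup>2 + 1 - (6 * t\<^sup>2 + 1 - j) = j"
        using that j by auto
      then show ?thesis unfolding m by (simp add: potential_def)
    qed
    have "sum_list (family_composition L) = family_size L"
      using rigid by (simp add: rigid_def)
    then show "potential t (block_mirror (family_composition L) j) = potential t j + 1"
      if "block_mirror (family_composition L) j < j"
      using potential_bottom[OF t(1)] that j unfolding descending_def B by simp
  qed
qed

section \<open>Distribution of the potential\<close>

lemma sum_split_at: "(\<Sum>i\<in>{1..a + b}. g i) = (\<Sum>i\<in>{1..a}. g i) + (\<Sum>i\<in>{1..b}. g (a + i :: nat))"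
  for g :: "nat \<Rightarrow> 'b::comm_monoid_add"
  by (induction b) (simp_all add: add.assoc)

lemma sum_lessThan_split: "(\<Sum>i<a + b. g i) = (\<Sum>i<a. g i) + (\<Sum>i<b. g (a + i :: nat))"
  for g :: "nat \<Rightarrow> 'b::comm_monoid_add"
  by (induction b) (simp_all add: add.assoc)

lemma sum_shift_lessThan: "(\<Sum>i\<in>{1..n}. g i) = (\<Sum>i<n. g (1 + i :: nat))"
  for g :: "nat \<Rightarrow> 'b::comm_monoid_add"
  by (induction n) simp_all

lemma zigzag_bij: "bij_betw (zigzag t) {..<t} {..<t}"
proof -
  have "zigzag t a < t" if "a < t" for a
    using that by (auto simp: zigzag_def min_def)
  moreover have "inj_on (zigzag t) {..<t}"
  proof (rule inj_onI)
    fix a b assume ab: "a \<in> {..<t}" "b \<in> {..<t}" "zigzag t a = zigzag t b"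
    have "2 * a + 1 \<noteq> 2 * (t - 1 - b)" "2 * b + 1 \<noteq> 2 * (t - 1 - a)" by presburger+
    then show "a = b" using ab by (auto simp: zigzag_def min_def split: if_splits)
  qed
  ultimately show ?thesis
    by (intro bij_betw_imageI endo_inj_surj) auto
qed

lemma sum_zigzag: "(\<Sum>a<t. g (zigzag t a)) = (\<Sum>s<t. g s)"
  for g :: "nat \<Rightarrow> 'b::comm_monoid_add"
  by (rule sum.reindex_bij_betw[OF zigzag_bij])

lemma sum_zigzag_rotated: "(\<Sum>a<t. g (zigzag t (t - 1 - a))) = (\<Sum>s<t. g s)"
  for g :: "nat \<Rightarrow> 'b::comm_monoid_add"
proof -
  have "(\<Sum>a<t. g (zigzag t (t - 1 - a))) = (\<Sum>a<t. g (zigzag t a))"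
    by (rule sum.reindex_bij_witness[of _ "\<lambda>a. t - 1 - a" "\<lambda>a. t - 1 - a"]) auto
  then show ?thesis by (simp add: sum_zigzag)
qed

text \<open>
  The sum of \<open>f\<close> over the potentials of the core, without reference to the vertices that carry them
  (\<open>core_distribution\<close>).
\<close>

definition core_sum :: "nat \<Rightarrow> (int \<Rightarrow> int) \<Rightarrow> int" where
  "core_sum t f = (\<Sum>s<t. \<Sum>w<t. f (- int (s + w)))"

text \<open>
  On a row the column enters through a permutation only.
\<close>

lemma core_row_sum: "(\<Sum>x<t. f (core_potential t x y)) = (\<Sum>w<t. f (- int (zigzag t y + w)))"
  for f :: "int \<Rightarrow> int"
  unfolding core_potential_def
  using sum_zigzag[of "\<lambda>w. f (- int (zigzag t y + w))" t] sum_zigzag_rotated[of "\<lambda>w. f (- int (zigzag t y + w))" t]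
  by (cases "2 * y + 1 < 2 * (t - 1 - y)") (simp_all cong: if_cong)

lemma left_potential_rows:
  fixes f :: "int \<Rightarrow> int"
  assumes "k \<le> t"
  shows "(\<Sum>i\<in>{1..t * k}. f (left_potential t i)) = (\<Sum>y<k. \<Sum>w<t. f (- int (zigzag t y + w)))"
proof -
  have "(\<Sum>i\<in>{1..t * k}. f (left_potential t i)) = (\<Sum>i<k * t. f (left_potential t (1 + i)))"
    unfolding sum_shift_lessThan by (simp add: mult.commute)
  also have "\<dots> = (\<Sum>y<k. \<Sum>i\<in>{y * t..<y * t + t}. f (left_potential t (1 + i)))"
    by (rule sum.nat_group[symmetric])
  also have "\<dots> = (\<Sum>y<k. \<Sum>w<t. f (- int (zigzag t y + w)))"
  proof (rule sum.cong[OF refl])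
    fix y assume y: "y \<in> {..<k}"
    have "(\<Sum>i\<in>{y * t..<y * t + t}. f (left_potential t (1 + i))) = (\<Sum>x<t. f (left_potential t (1 + (y * t + x))))"
      by (rule sum.reindex_bij_witness[of _ "\<lambda>x. y * t + x" "\<lambda>i. i - y * t"]) auto
    also have "\<dots> = (\<Sum>x<t. f (core_potential t x y))"
      using left_potential_grid[of _ t y] y assms by (intro sum.cong) (auto simp: algebra_simps)
    finally show "(\<Sum>i\<in>{y * t..<y * t + t}. f (left_potential t (1 + i))) = (\<Sum>w<t. f (- int (zigzag t y + w)))"
      unfolding core_row_sum .
  qed
  finally show ?thesis .
qed

lemma core_distribution: "(\<Sum>i\<in>{1..t\<^sup>2}. f (left_potential t i)) = core_sum t f"
  using left_potential_rows[of t t f] sum_zigzag[of "\<lambda>s. \<Sum>w<t. f (- int (s + w))" t]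
  by (simp add: core_sum_def power2_eq_square)

text \<open>
  The missing last row has offset zero.
\<close>

lemma first_block_distribution:
  assumes "t \<ge> 1"
  shows "(\<Sum>i\<in>{1..t * (t - 1)}. f (left_potential t i)) = core_sum t f - (\<Sum>w<t. f (- int w))"
proof -
  let ?g = "\<lambda>s. \<Sum>w<t. f (- int (s + w))"
  have "(\<Sum>y<Suc (t - 1). ?g (zigzag t y)) = core_sum t f"
    using sum_zigzag[of ?g t] assms by (simp add: core_sum_def)
  moreover have "zigzag t (t - 1) = 0" by (simp add: zigzag_def)
  ultimately have "(\<Sum>y<t - 1. ?g (zigzag t y)) = core_sum t f - ?g 0" by (simp del: of_nat_add)
  then show ?thesis using left_potential_rows[of "t - 1" t f] by simp
qed

lemma second_block_distribution:
  fixes f :: "int \<Rightarrow> int"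
  assumes "t \<ge> 1"
  shows "(\<Sum>i\<in>{1..t - 1}. f (left_potential t (t * (t - 1) + i))) = (\<Sum>w<t. f (- int w)) - f 0"
proof -
  have s0: "zigzag t (t - 1) = 0" by (simp add: zigzag_def)
  have "(\<Sum>i\<in>{1..t - 1}. f (left_potential t (t * (t - 1) + i))) = (\<Sum>x<t - 1. f (core_potential t x (t - 1)))"
    unfolding sum_shift_lessThan
    using left_potential_grid[of _ t "t - 1"] assms by (intro sum.cong) (auto simp: algebra_simps)
  moreover have "(\<Sum>x<Suc (t - 1). f (core_potential t x (t - 1))) = (\<Sum>w<t. f (- int w))"
    using core_row_sum[of f t "t - 1"] assms s0 by simp
  moreover have "core_potential t (t - 1) (t - 1) = 0"
    by (simp add: core_potential_def zigzag_def)
  ultimately show ?thesis by simp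
qed

lemma left_half_distribution:
  "(\<Sum>i\<in>{1..3 * t\<^sup>2}. f (left_potential t i)) = core_sum t f + int (t\<^sup>2) * (f 0 + f (- 1))"
proof -
  have alt: "(\<Sum>i\<in>{1..2 * r}. f (if even i then 0 else - 1)) = int r * (f 0 + f (- 1))" for r
    by (induction r) (simp_all add: algebra_simps)
  have "(\<Sum>i\<in>{1..t\<^sup>2 + 2 * t\<^sup>2}. f (left_potential t i)) =
      core_sum t f + (\<Sum>i\<in>{1..2 * t\<^sup>2}. f (left_potential t (t\<^sup>2 + i)))"
    unfolding sum_split_at core_distribution ..
  also have "(\<Sum>i\<in>{1..2 * t\<^sup>2}. f (left_potential t (t\<^sup>2 + i))) = (\<Sum>i\<in>{1..2 * t\<^sup>2}. f (if even i then 0 else - 1))"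
    by (intro sum.cong) (auto simp: left_potential_def)
  finally show ?thesis unfolding alt by simp
qed

lemma potential_distribution:
  "(\<Sum>i\<in>{1..6 * t\<^sup>2}. f (potential t i)) =
     core_sum t f + core_sum t (\<lambda>u. f (u + 1)) + int (t\<^sup>2) * (f (- 1) + 2 * f 0 + f 1)"
proof -
  have "(\<Sum>i\<in>{1..3 * t\<^sup>2 + 3 * t\<^sup>2}. f (potential t i)) =
     (\<Sum>i\<in>{1..3 * t\<^sup>2}. f (potential t i)) + (\<Sum>i\<in>{1..3 * t\<^sup>2}. f (potential t (3 * t\<^sup>2 + i)))"
    by (rule sum_split_at)
  also have "(\<Sum>i\<in>{1..3 * t\<^sup>2}. f (potential t i)) = (\<Sum>i\<in>{1..3 * t\<^sup>2}. f (left_potential t i))"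
    by (intro sum.cong) (auto simp: potential_def)
  also have "(\<Sum>i\<in>{1..3 * t\<^sup>2}. f (potential t (3 * t\<^sup>2 + i))) = (\<Sum>i\<in>{1..3 * t\<^sup>2}. f (left_potential t i + 1))"
    by (rule sum.reindex_bij_witness[of _ "\<lambda>i. 3 * t\<^sup>2 + 1 - i" "\<lambda>i. 3 * t\<^sup>2 + 1 - i"])
      (auto simp: potential_def)
  finally show ?thesis
    using left_half_distribution[of f t] left_half_distribution[of "\<lambda>u. f (u + 1)" t] by (simp add: algebra_simps)
qed

lemma last_block_distribution:
  assumes "t \<ge> 1"
  shows "(\<Sum>i\<in>{1..t\<^sup>2}. f (potential t (5 * t\<^sup>2 + i))) = core_sum t (\<lambda>u. f (u + 1))"
proof -
  have t: "1 \<le> t\<^sup>2" using assms by simp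
  have "(\<Sum>i\<in>{1..t\<^sup>2}. f (potential t (5 * t\<^sup>2 + i))) = (\<Sum>i\<in>{1..t\<^sup>2}. f (left_potential t i + 1))"
    by (rule sum.reindex_bij_witness[of _ "\<lambda>i. t\<^sup>2 + 1 - i" "\<lambda>i. t\<^sup>2 + 1 - i"])
      (use t in \<open>auto simp: potential_def\<close>)
  then show ?thesis using core_distribution[of "\<lambda>u. f (u + 1)" t] by simp
qed

text \<open>
  Vertices of different parts never share a block.
\<close>

lemma diff_count_append: "diff_count (A @ B) d m = diff_count A d m + diff_count B (\<lambda>i. d (sum_list A + i)) m"
proof -
  let ?a = "sum_list A" and ?b = "sum_list B"
  let ?g = "\<lambda>i j. if block_index (A @ B) i = block_index (A @ B) j \<and> d i - d j = m then 1 else (0::nat)"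
  have A: "block_index (A @ B) i = block_index A i" "block_index A i < length A" if "i \<in> {1..?a}" for i
    using that block_index_less_length[of i A] by (auto simp: block_index_append)
  have B: "block_index (A @ B) (?a + i) = length A + block_index B i" if "i \<in> {1..?b}" for i
    using that by (auto simp: block_index_append)
  have "diff_count (A @ B) d m = (\<Sum>i\<in>{1..?a + ?b}. \<Sum>j\<in>{1..?a + ?b}. ?g i j)"
    by (simp add: diff_count_def)
  also have "\<dots> = ((\<Sum>i\<in>{1..?a}. \<Sum>j\<in>{1..?a}. ?g i j) + (\<Sum>i\<in>{1..?a}. \<Sum>j\<in>{1..?b}. ?g i (?a + j))) +
      ((\<Sum>i\<in>{1..?b}. \<Sum>j\<in>{1..?a}. ?g (?a + i) j) + (\<Sum>i\<in>{1..?b}. \<Sum>j\<in>{1..?b}. ?g (?a + i) (?a + j)))"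
    unfolding sum_split_at sum.distrib by (simp only: ac_simps)
  also have "(\<Sum>i\<in>{1..?a}. \<Sum>j\<in>{1..?b}. ?g i (?a + j)) = 0"
  proof (intro sum.neutral ballI)
    fix i j assume i: "i \<in> {1..?a}" and j: "j \<in> {1..?b}"
    show "?g i (?a + j) = 0" unfolding A(1)[OF i] B[OF j] using A(2)[OF i] by simp
  qed
  also have "(\<Sum>i\<in>{1..?b}. \<Sum>j\<in>{1..?a}. ?g (?a + i) j) = 0"
  proof (intro sum.neutral ballI)
    fix i j assume i: "i \<in> {1..?b}" and j: "j \<in> {1..?a}"
    show "?g (?a + i) j = 0" unfolding A(1)[OF j] B[OF i] using A(2)[OF j] by simp
  qed
  also have "(\<Sum>i\<in>{1..?a}. \<Sum>j\<in>{1..?a}. ?g i j) = diff_count A d m"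
    unfolding diff_count_def by (intro sum.cong refl) (simp only: A(1))
  also have "(\<Sum>i\<in>{1..?b}. \<Sum>j\<in>{1..?b}. ?g (?a + i) (?a + j)) = diff_count B (\<lambda>i. d (?a + i)) m"
    unfolding diff_count_def by (intro sum.cong refl) (simp only: B add_left_cancel)
  finally show ?thesis by simp
qed

lemma diff_count_single:
  "int (diff_count [a] d m) = (\<Sum>i\<in>{1..a}. \<Sum>j\<in>{1..a}. if d i - d j = m then 1 else 0)"
proof -
  have "diff_count [a] d m = (\<Sum>i\<in>{1..a}. \<Sum>j\<in>{1..a}. if d i - d j = m then 1 else 0)"
    unfolding diff_count_def by (intro sum.cong) auto
  then show ?thesis by (simp add: if_distrib[of int] cong: if_cong)
qed

lemma diff_count_functional:
  assumes "\<And>f :: int \<Rightarrow> int. (\<Sum>i\<in>{1..a}. f (d i)) = G f"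
  shows "int (diff_count [a] d m) = G (\<lambda>u. G (\<lambda>v. if u - v = m then 1 else 0))"
  unfolding diff_count_single assms[of "\<lambda>v. if _ - v = m then 1 else 0"] by (rule assms)

lemma diff_count_pairs:
  assumes "\<And>k. k < r \<Longrightarrow> d (2 * k + 1) = d (2 * k + 2) + 1" "m \<ge> 0"
  shows "diff_count (replicate r 2) d m = r * (if m = 0 then 2 else if m = 1 then 1 else 0)"
  using assms(1)
proof (induction r arbitrary: d)
  case (Suc r)
  have "diff_count ([2] @ replicate r 2) d m = diff_count [2] d m + diff_count (replicate r 2) (\<lambda>i. d (2 + i)) m"
    unfolding diff_count_append by simp
  also have "diff_count (replicate r 2) (\<lambda>i. d (2 + i)) m = r * (if m = 0 then 2 else if m = 1 then 1 else 0)"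
  proof (rule Suc.IH)
    fix k assume "k < r"
    then show "d (2 + (2 * k + 1)) = d (2 + (2 * k + 2)) + 1" using Suc.prems[of "Suc k"] by (simp add: algebra_simps)
  qed
  also have "diff_count [2] d m = (if m = 0 then 2 else if m = 1 then 1 else 0)"
  proof -
    have s: "{Suc 0..2} = {Suc 0, 2}" by auto
    have d12: "d (Suc 0) = d 2 + 1" using Suc.prems[of 0] by (simp add: numeral_2_eq_2)
    show ?thesis using assms(2) by (auto simp: diff_count_def s d12)
  qed
  finally show ?case by simp
qed (simp add: diff_count_def)

section \<open>Correlations\<close>

text \<open>
  The value \<open>- x\<close> has the weight \<open>p x\<close>.
\<close>

definition weighted_sum :: "nat \<Rightarrow> (int \<Rightarrow> int) \<Rightarrow> (int \<Rightarrow> int) \<Rightarrow> int" where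
  "weighted_sum M p f = (\<Sum>x<M. p (int x) * f (- int x))"

definition correlation :: "nat \<Rightarrow> (int \<Rightarrow> int) \<Rightarrow> int \<Rightarrow> int" where
  "correlation M p m = (\<Sum>x<M. p (int x) * p (int x + m))"

lemma weighted_sum_add: "weighted_sum M p (\<lambda>u. f u + g u) = weighted_sum M p f + weighted_sum M p g"
  and weighted_sum_scale: "weighted_sum M p (\<lambda>u. c * f u) = c * weighted_sum M p f"
  by (simp_all add: weighted_sum_def algebra_simps sum.distrib sum_distrib_left)

lemma weighted_sum_indicator:
  assumes "\<And>x. x < 0 \<or> int M \<le> x \<Longrightarrow> p x = 0"
  shows "weighted_sum M p (\<lambda>v. if v = a then 1 else 0) = p (- a)"
proof (cases "0 \<le> - a \<and> - a < int M")
  case True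
  then have "weighted_sum M p (\<lambda>v. if v = a then 1 else 0) = (\<Sum>x<M. if x = nat (- a) then p (- a) else 0)"
    unfolding weighted_sum_def by (intro sum.cong) auto
  also have "\<dots> = p (- a)" using True by auto
  finally show ?thesis .
next
  case False
  then have "p (- a) = 0" using assms[of "- a"] by auto
  moreover have "weighted_sum M p (\<lambda>v. if v = a then 1 else 0) = 0"
    unfolding weighted_sum_def using False by (intro sum.neutral) auto
  ultimately show ?thesis by simp
qed

text \<open>
  Counting pairs with difference \<open>m\<close> is the autocorrelation of the weights at \<open>m\<close>.
\<close>

lemma weighted_sum_correlation:
  assumes "\<And>x. x < 0 \<or> int M \<le> x \<Longrightarrow> p x = 0"
  shows "weighted_sum M p (\<lambda>u. weighted_sum M p (\<lambda>v. if u - v = m then 1 else 0)) = correlation M p m"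
proof -
  have "weighted_sum M p (\<lambda>v. if u - v = m then 1 else 0) = p (m - u)" for u
  proof -
    have "(u - v = m) = (v = u - m)" for v by auto
    then show ?thesis using weighted_sum_indicator[of M p "u - m"] assms by simp
  qed
  then show ?thesis by (simp add: weighted_sum_def correlation_def add.commute)
qed

lemma correlation_symmetric:
  assumes "\<And>x. x < 0 \<or> int M \<le> x \<Longrightarrow> p x = 0"
  shows "correlation M p (- m) = correlation M p m"
proof -
  have double: "correlation M p k = (\<Sum>x<M. \<Sum>y<M. p (int x) * (p (int y) * (if - int x - - int y = k then 1 else 0)))" for k
    using weighted_sum_correlation[of M p k] assms by (simp add: weighted_sum_def sum_distrib_left)
  have "correlation M p (- m) = (\<Sum>y<M. \<Sum>x<M. p (int x) * (p (int y) * (if - int x - - int y = - m then 1 else 0)))"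
    unfolding double by (rule sum.swap)
  also have "\<dots> = correlation M p m"
    unfolding double by (rule sum.cong[OF refl], rule sum.cong[OF refl]) auto
  finally show ?thesis .
qed

text \<open>
  The number of ways to write \<open>x\<close> as a sum of two numbers below \<open>t\<close>.
\<close>

definition tent :: "nat \<Rightarrow> int \<Rightarrow> int" where
  "tent t x = max 0 (min (x + 1) (2 * int t - 1 - x))"

text \<open>
  The weights of the first block of the bottom composition: those of the core without the last row.
\<close>

definition trapezoid :: "nat \<Rightarrow> int \<Rightarrow> int" where
  "trapezoid t x = max 0 (min x (2 * int t - 1 - x))"

text \<open>
  The weights of the second block of the bottom composition.
\<close>

definition plateau :: "nat \<Rightarrow> int \<Rightarrow> int" where
  "plateau t x = (if 1 \<le> x \<and> x < int t then 1 else 0)"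

lemma tent_outside: "t \<ge> 1 \<Longrightarrow> x < 0 \<or> int (2 * t - 1) \<le> x \<Longrightarrow> tent t x = 0"
  and trapezoid_outside: "t \<ge> 1 \<Longrightarrow> x < 0 \<or> int (2 * t - 1) \<le> x \<Longrightarrow> trapezoid t x = 0"
  and plateau_outside: "t \<ge> 1 \<Longrightarrow> x < 0 \<or> int (2 * t - 1) \<le> x \<Longrightarrow> plateau t x = 0"
  by (auto simp: tent_def trapezoid_def plateau_def)

lemma core_sum_weighted:
  assumes "t \<ge> 1" shows "core_sum t f = weighted_sum (2 * t - 1) (tent t) f"
proof -
  have inner: "(\<Sum>w<t. f (- int (s + w))) = (\<Sum>x<2 * t - 1. if s \<le> x \<and> x < s + t then f (- int x) else 0)"
    if s: "s < t" for s
  proof -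
    have "(\<Sum>w<t. f (- int (s + w))) = (\<Sum>x\<in>{s..<s + t}. f (- int x))"
      by (rule sum.reindex_bij_witness[of _ "\<lambda>x. x - s" "\<lambda>w. s + w"]) auto
    also have "\<dots> = (\<Sum>x<2 * t - 1. if s \<le> x \<and> x < s + t then f (- int x) else 0)"
      using s by (intro sum.mono_neutral_cong_left) auto
    finally show ?thesis .
  qed
  have count: "(\<Sum>s<t. if s \<le> x \<and> x < s + t then a else 0) = tent t (int x) * a"
    if x: "x < 2 * t - 1" for x and a :: int
  proof -
    have "(\<Sum>s<t. if s \<le> x \<and> x < s + t then a else 0) = (\<Sum>s\<in>{x + 1 - t..<min t (x + 1)}. a)"
      by (rule sum.mono_neutral_cong_right) auto
    also have "\<dots> = int (min t (x + 1) - (x + 1 - t)) * a" by simp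
    also have "int (min t (x + 1) - (x + 1 - t)) = tent t (int x)"
      using x assms by (auto simp: tent_def min_def max_def of_nat_diff)
    finally show ?thesis .
  qed
  have "core_sum t f = (\<Sum>s<t. \<Sum>x<2 * t - 1. if s \<le> x \<and> x < s + t then f (- int x) else 0)"
    unfolding core_sum_def by (rule sum.cong[OF refl]) (use inner in simp)
  also have "\<dots> = (\<Sum>x<2 * t - 1. \<Sum>s<t. if s \<le> x \<and> x < s + t then f (- int x) else 0)"
    by (rule sum.swap)
  also have "\<dots> = (\<Sum>x<2 * t - 1. tent t (int x) * f (- int x))"
    by (rule sum.cong[OF refl]) (use count in simp)
  finally show ?thesis by (simp add: weighted_sum_def)
qed

lemma row_sum_weighted:
  fixes f :: "int \<Rightarrow> int"
  assumes "t \<ge> 1" shows "(\<Sum>w<t. f (- int w)) = (\<Sum>x<2 * t - 1. (if x < t then 1 else 0) * f (- int x))"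
  using assms by (intro sum.mono_neutral_cong_left) auto

lemma first_block_weighted:
  fixes f :: "int \<Rightarrow> int"
  assumes "t \<ge> 1"
  shows "core_sum t f - (\<Sum>w<t. f (- int w)) = weighted_sum (2 * t - 1) (trapezoid t) f"
proof -
  have "tent t (int x) - (if x < t then 1 else 0) = trapezoid t (int x)" if "x < 2 * t - 1" for x
    using that unfolding tent_def trapezoid_def by (cases "x < t") auto
  then show ?thesis
    unfolding core_sum_weighted[OF assms] row_sum_weighted[OF assms] weighted_sum_def sum_subtractf[symmetric]
    by (intro sum.cong refl) (simp add: left_diff_distrib[symmetric])
qed

lemma second_block_weighted:
  fixes f :: "int \<Rightarrow> int"
  assumes "t \<ge> 1"
  shows "(\<Sum>w<t. f (- int w)) - f 0 = weighted_sum (2 * t - 1) (plateau t) f"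
proof -
  have "f 0 = (\<Sum>x<2 * t - 1. if x = 0 then f (- int x) else 0)" using assms by simp
  then have "(\<Sum>w<t. f (- int w)) - f 0 =
      (\<Sum>x<2 * t - 1. (if x < t then 1 else 0) * f (- int x) - (if x = 0 then f (- int x) else 0))"
    unfolding row_sum_weighted[OF assms] sum_subtractf by simp
  also have "\<dots> = weighted_sum (2 * t - 1) (plateau t) f"
    unfolding weighted_sum_def by (intro sum.cong) (auto simp: plateau_def)
  finally show ?thesis .
qed

lemma sum_product_linear:
  fixes a b e g :: int
  shows "6 * (\<Sum>i<k. (a + e * int i) * (b + g * int i)) =
    int k * (6 * a * b + 3 * (a * g + b * e) * (int k - 1) + e * g * (int k - 1) * (2 * int k - 1))"
  by (induction k) (simp_all add: algebra_simps)

text \<open>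
  The summation range is cut where one of the arguments \<open>x\<close> and \<open>x + m\<close> passes the top or the end of the
  weights, so that both weights are linear on every part.
\<close>

lemma correlation_split:
  assumes "t = m + q + 1"
  shows "correlation (2 * t - 1) p (int m) =
    (\<Sum>i<q + 1. p (int i) * p (int i + int m)) +
    (\<Sum>i<m. p (int (q + 1 + i)) * p (int (q + 1 + i) + int m)) +
    (\<Sum>i<q. p (int (t + i)) * p (int (t + i) + int m)) +
    (\<Sum>i<m. p (int (t + q + i)) * p (int (t + q + i) + int m))"
proof -
  have M: "2 * t - 1 = (((q + 1) + m) + q) + m" using assms by simp
  have shift: "t + i = q + 1 + m + i" for i using assms by simp
  show ?thesis unfolding correlation_def M sum_lessThan_split shift ..
qed

lemma tent_correlation:
  assumes "m < t"
  shows "6 * correlation (2 * t - 1) (tent t) (int m) =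
    4 * int t ^ 3 - 6 * int t * int m ^ 2 + 3 * int m ^ 3 + 2 * int t - 3 * int m"
proof -
  obtain q where t: "t = m + q + 1" using assms by (metis Suc_eq_plus1 add_Suc_right less_imp_Suc_add)
  have "(\<Sum>i<q + 1. tent t (int i) * tent t (int i + int m)) = (\<Sum>i<q + 1. (1 + 1 * int i) * (int m + 1 + 1 * int i))"
    by (intro sum.cong) (auto simp: tent_def t algebra_simps)
  moreover have "(\<Sum>i<m. tent t (int (q + 1 + i)) * tent t (int (q + 1 + i) + int m)) =
      (\<Sum>i<m. (int q + 2 + 1 * int i) * (int m + int q + (-1) * int i))"
    by (intro sum.cong) (auto simp: tent_def t algebra_simps)
  moreover have "(\<Sum>i<q. tent t (int (t + i)) * tent t (int (t + i) + int m)) =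
      (\<Sum>i<q. (int m + int q + (-1) * int i) * (int q + (-1) * int i))"
    by (intro sum.cong) (auto simp: tent_def t algebra_simps)
  moreover have "(\<Sum>i<m. tent t (int (t + q + i)) * tent t (int (t + q + i) + int m)) = 0"
    by (intro sum.neutral) (auto simp: tent_def t algebra_simps)
  ultimately have "6 * correlation (2 * t - 1) (tent t) (int m) =
      6 * (\<Sum>i<q + 1. (1 + 1 * int i) * (int m + 1 + 1 * int i)) +
      6 * (\<Sum>i<m. (int q + 2 + 1 * int i) * (int m + int q + (-1) * int i)) +
      6 * (\<Sum>i<q. (int m + int q + (-1) * int i) * (int q + (-1) * int i))"
    unfolding correlation_split[OF t] by simp
  also have "\<dots> = 4 * int t ^ 3 - 6 * int t * int m ^ 2 + 3 * int m ^ 3 + 2 * int t - 3 * int m"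
    unfolding sum_product_linear t by (simp add: algebra_simps power2_eq_square power3_eq_cube)
  finally show ?thesis .
qed

lemma trapezoid_correlation:
  assumes "m < t"
  shows "6 * correlation (2 * t - 1) (trapezoid t) (int m) =
    4 * int t ^ 3 - 6 * int t * int m ^ 2 + 3 * int m ^ 3 + 2 * int t - 3 * int m - 6 * int t ^ 2 + 3 * int m * (int m + 1)"
proof -
  obtain q where t: "t = m + q + 1" using assms by (metis Suc_eq_plus1 add_Suc_right less_imp_Suc_add)
  have "(\<Sum>i<q + 1. trapezoid t (int i) * trapezoid t (int i + int m)) = (\<Sum>i<q + 1. (0 + 1 * int i) * (int m + 1 * int i))"
    by (intro sum.cong) (auto simp: trapezoid_def t algebra_simps)
  moreover have "(\<Sum>i<m. trapezoid t (int (q + 1 + i)) * trapezoid t (int (q + 1 + i) + int m)) =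
      (\<Sum>i<m. (int q + 1 + 1 * int i) * (int m + int q + (-1) * int i))"
    by (intro sum.cong) (auto simp: trapezoid_def t algebra_simps)
  moreover have "(\<Sum>i<q. trapezoid t (int (t + i)) * trapezoid t (int (t + i) + int m)) =
      (\<Sum>i<q. (int m + int q + (-1) * int i) * (int q + (-1) * int i))"
    by (intro sum.cong) (auto simp: trapezoid_def t algebra_simps)
  moreover have "(\<Sum>i<m. trapezoid t (int (t + q + i)) * trapezoid t (int (t + q + i) + int m)) = 0"
    by (intro sum.neutral) (auto simp: trapezoid_def t algebra_simps)
  ultimately have "6 * correlation (2 * t - 1) (trapezoid t) (int m) =
      6 * (\<Sum>i<q + 1. (0 + 1 * int i) * (int m + 1 * int i)) +
      6 * (\<Sum>i<m. (int q + 1 + 1 * int i) * (int m + int q + (-1) * int i)) +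
      6 * (\<Sum>i<q. (int m + int q + (-1) * int i) * (int q + (-1) * int i))"
    unfolding correlation_split[OF t] by simp
  also have "\<dots> = 4 * int t ^ 3 - 6 * int t * int m ^ 2 + 3 * int m ^ 3 + 2 * int t - 3 * int m - 6 * int t ^ 2 + 3 * int m * (int m + 1)"
    unfolding sum_product_linear t by (simp add: algebra_simps power2_eq_square power3_eq_cube)
  finally show ?thesis .
qed

lemma plateau_correlation:
  assumes "m < t"
  shows "correlation (2 * t - 1) (plateau t) (int m) = int t - 1 - int m"
proof -
  have "correlation (2 * t - 1) (plateau t) (int m) = (\<Sum>x<2 * t - 1. if 1 \<le> x \<and> x < t - m then 1 else 0)"
    unfolding correlation_def plateau_def by (intro sum.cong) (use assms in auto)
  also have "\<dots> = (\<Sum>x\<in>{1..<t - m}. 1)"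
    by (rule sum.mono_neutral_cong_right) (use assms in auto)
  also have "\<dots> = int t - 1 - int m" using assms by (simp add: of_nat_diff)
  finally show ?thesis .
qed

definition core_corr :: "nat \<Rightarrow> int \<Rightarrow> int" where
  "core_corr t m = correlation (2 * t - 1) (tent t) m"

lemma core_indicator:
  assumes "t \<ge> 1" shows "core_sum t (\<lambda>v. if v = a then 1 else 0) = tent t (- a)"
  unfolding core_sum_weighted[OF assms] by (rule weighted_sum_indicator) (rule tent_outside[OF assms])

lemma core_tent:
  assumes "t \<ge> 1" shows "core_sum t (\<lambda>u. tent t (m - u)) = core_corr t m"
  unfolding core_sum_weighted[OF assms] by (simp add: weighted_sum_def core_corr_def correlation_def add.commute)

lemma core_add: "t \<ge> 1 \<Longrightarrow> core_sum t (\<lambda>u. f u + g u) = core_sum t f + core_sum t g"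
  and core_scale: "t \<ge> 1 \<Longrightarrow> core_sum t (\<lambda>u. c * f u) = c * core_sum t f"
  by (simp_all add: core_sum_weighted weighted_sum_add weighted_sum_scale)

lemma core_corr_symmetric: "t \<ge> 1 \<Longrightarrow> core_corr t (- m) = core_corr t m"
  unfolding core_corr_def by (rule correlation_symmetric) (rule tent_outside)

text \<open>
  All vertices share the top block. They carry two copies of the core, shifted against each other by
  one, and the values \<open>-1, 0, 0, 1\<close>, each \<open>t\<^sup>2\<close> times. The three summands collect the pairs within the
  copies, the mixed pairs, and the pairs within the runs.
\<close>

lemma full_count:
  assumes t: "t \<ge> 1"
  shows "int (diff_count [6 * t\<^sup>2] (potential t) m) =
     2 * core_corr t m + core_corr t (m + 1) + core_corr t (m - 1)
     + int (t\<^sup>2) * (3 * tent t (1 - m) + 3 * tent t (- m) + tent t (- 1 - m) + tent t (2 - m)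
         + tent t (m - 1) + 3 * tent t m + 3 * tent t (m + 1) + tent t (m + 2))
     + int (t\<^sup>2) * int (t\<^sup>2) * (6 * (if m = 0 then 1 else 0) + 4 * (if m = 1 then 1 else 0) + 4 * (if m = - 1 then 1 else 0)
         + (if m = 2 then 1 else 0) + (if m = - 2 then 1 else 0))"
proof -
  define G where "G f = core_sum t f + core_sum t (\<lambda>u. f (u + 1)) + int (t\<^sup>2) * (f (- 1) + 2 * f 0 + f 1)" for f
  define r where "r = int (t\<^sup>2)"
  let ?I = "\<lambda>P. if P then 1 else (0 :: int)"
  have inner: "G (\<lambda>v. if u - v = m then 1 else 0) =
      tent t (m - u) + tent t ((m + 1) - u) + r * ?I (u = m - 1) + 2 * r * ?I (u = m) + r * ?I (u = m + 1)" for u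
  proof -
    have 1: "(\<lambda>v. ?I (u - v = m)) = (\<lambda>v. ?I (v = u - m))" by (auto simp: fun_eq_iff)
    have 2: "(\<lambda>v. ?I (u - (v + 1) = m)) = (\<lambda>v. ?I (v = u - m - 1))" by (auto simp: fun_eq_iff)
    have "core_sum t (\<lambda>v. ?I (u - v = m)) = tent t (m - u)"
      unfolding 1 core_indicator[OF t] by simp
    moreover have "core_sum t (\<lambda>v. ?I (u - (v + 1) = m)) = tent t ((m + 1) - u)"
      unfolding 2 core_indicator[OF t] by (simp add: algebra_simps)
    ultimately show ?thesis
      unfolding G_def r_def[symmetric] by (auto simp: algebra_simps)
  qed
  have shift: "(\<lambda>u. tent t (m - (u + 1))) = (\<lambda>u. tent t ((m - 1) - u))"
    "(\<lambda>u. tent t ((m + 1) - (u + 1))) = (\<lambda>u. tent t (m - u))"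
    "(\<lambda>u. ?I (u + 1 = m - 1)) = (\<lambda>u. ?I (u = m - 2))" "(\<lambda>u. ?I (u + 1 = m)) = (\<lambda>u. ?I (u = m - 1))"
    "(\<lambda>u. ?I (u + 1 = m + 1)) = (\<lambda>u. ?I (u = m))"
    by (auto simp: fun_eq_iff algebra_simps)
  have "int (diff_count [6 * t\<^sup>2] (potential t) m) = G (\<lambda>u. G (\<lambda>v. if u - v = m then 1 else 0))"
    by (rule diff_count_functional) (simp only: potential_distribution G_def)
  also have "\<dots> = core_corr t m + core_corr t (m + 1) + r * tent t (1 - m) + 2 * r * tent t (- m) + r * tent t (- 1 - m)
     + (core_corr t (m - 1) + core_corr t m + r * tent t (2 - m) + 2 * r * tent t (1 - m) + r * tent t (- m))
     + r * ((tent t (m + 1) + tent t (m + 2) + r * ?I (- 1 = m - 1) + 2 * r * ?I (- 1 = m) + r * ?I (- 1 = m + 1))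
        + 2 * (tent t m + tent t (m + 1) + r * ?I (0 = m - 1) + 2 * r * ?I (0 = m) + r * ?I (0 = m + 1))
        + (tent t (m - 1) + tent t m + r * ?I (1 = m - 1) + 2 * r * ?I (1 = m) + r * ?I (1 = m + 1)))"
  proof -
    have c1: "core_sum t (\<lambda>u. tent t (m - u) + tent t ((m + 1) - u) + r * ?I (u = m - 1) + 2 * r * ?I (u = m) + r * ?I (u = m + 1))
       = core_corr t m + core_corr t (m + 1) + r * tent t (1 - m) + 2 * r * tent t (- m) + r * tent t (- 1 - m)"
    proof -
      have e: "- (m + 1) = - 1 - m" by simp
      show ?thesis
        unfolding core_add[OF t] core_scale[OF t] core_tent[OF t] core_indicator[OF t] e by simp
    qed
    have c2: "core_sum t (\<lambda>u. tent t (m - (u + 1)) + tent t ((m + 1) - (u + 1)) + r * ?I (u + 1 = m - 1) + 2 * r * ?I (u + 1 = m) + r * ?I (u + 1 = m + 1))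
       = core_corr t (m - 1) + core_corr t m + r * tent t (2 - m) + 2 * r * tent t (1 - m) + r * tent t (- m)"
      unfolding core_add[OF t] core_scale[OF t] shift core_tent[OF t] core_indicator[OF t] by simp
    show ?thesis
      unfolding inner unfolding G_def c1 c2 r_def[symmetric] by (simp add: add.commute)
  qed
  also have "\<dots> = 2 * core_corr t m + core_corr t (m + 1) + core_corr t (m - 1)
     + r * (3 * tent t (1 - m) + 3 * tent t (- m) + tent t (- 1 - m) + tent t (2 - m)
         + tent t (m - 1) + 3 * tent t m + 3 * tent t (m + 1) + tent t (m + 2))
     + r * r * (6 * ?I (m = 0) + 4 * ?I (m = 1) + 4 * ?I (m = - 1) + ?I (m = 2) + ?I (m = - 2))"
    by (simp add: algebra_simps)
  finally show ?thesis unfolding r_def .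
qed

text \<open>
  The summands come from the first, the second and the last block, from the two runs of blocks of size
  two, and from the central vertex.
\<close>

lemma block_count:
  assumes t: "t \<ge> 2" and m: "0 \<le> m"
  shows "int (diff_count ([t * (t - 1), t - 1] @ replicate (t\<^sup>2) 2 @ [1] @ replicate (t\<^sup>2) 2 @ [t\<^sup>2]) (potential t) m) =
     correlation (2 * t - 1) (trapezoid t) m + correlation (2 * t - 1) (plateau t) m + core_corr t m
     + int (t\<^sup>2) * (4 * (if m = 0 then 1 else 0) + 2 * (if m = 1 then 1 else 0)) + (if m = 0 then 1 else 0)"
proof -
  have t1: "t \<ge> 1" using t by simp
  have tt: "t * (t - 1) + (t - 1) = t\<^sup>2 - 1" "1 \<le> t\<^sup>2"
    using t by (auto simp: power2_eq_square algebra_simps diff_mult_distrib2)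
  have small: "potential t i = left_potential t i" if "i \<le> t\<^sup>2" for i using that by (simp add: potential_def)
  have b1: "int (diff_count [t * (t - 1)] (potential t) m) = correlation (2 * t - 1) (trapezoid t) m"
  proof -
    have "int (diff_count [t * (t - 1)] (potential t) m) =
        weighted_sum (2 * t - 1) (trapezoid t) (\<lambda>u. weighted_sum (2 * t - 1) (trapezoid t) (\<lambda>v. if u - v = m then 1 else 0))"
    proof (rule diff_count_functional)
      fix f :: "int \<Rightarrow> int"
      have "(\<Sum>i\<in>{1..t * (t - 1)}. f (potential t i)) = (\<Sum>i\<in>{1..t * (t - 1)}. f (left_potential t i))"
        using tt by (intro sum.cong) (auto intro!: arg_cong[where f = f] small)
      then show "(\<Sum>i\<in>{1..t * (t - 1)}. f (potential t i)) = weighted_sum (2 * t - 1) (trapezoid t) f"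
        using first_block_distribution[OF t1, of f] first_block_weighted[OF t1, of f] by simp
    qed
    then show ?thesis
      using weighted_sum_correlation[of "2 * t - 1" "trapezoid t" m] trapezoid_outside[OF t1] by simp
  qed
  have b2: "int (diff_count [t - 1] (\<lambda>i. potential t (t * (t - 1) + i)) m) = correlation (2 * t - 1) (plateau t) m"
  proof -
    have "int (diff_count [t - 1] (\<lambda>i. potential t (t * (t - 1) + i)) m) =
        weighted_sum (2 * t - 1) (plateau t) (\<lambda>u. weighted_sum (2 * t - 1) (plateau t) (\<lambda>v. if u - v = m then 1 else 0))"
    proof (rule diff_count_functional)
      fix f :: "int \<Rightarrow> int"
      have "(\<Sum>i\<in>{1..t - 1}. f (potential t (t * (t - 1) + i))) = (\<Sum>i\<in>{1..t - 1}. f (left_potential t (t * (t - 1) + i)))"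
        using tt by (intro sum.cong) (auto intro!: arg_cong[where f = f] small)
      then show "(\<Sum>i\<in>{1..t - 1}. f (potential t (t * (t - 1) + i))) = weighted_sum (2 * t - 1) (plateau t) f"
        using second_block_distribution[OF t1, of f] second_block_weighted[OF t1, of f] by simp
    qed
    then show ?thesis
      using weighted_sum_correlation[of "2 * t - 1" "plateau t" m] plateau_outside[OF t1] by simp
  qed
  let ?w = "if m = 0 then 2 else if m = 1 then 1 else 0"
  have b3: "diff_count (replicate (t\<^sup>2) 2) (\<lambda>i. potential t (t\<^sup>2 - 1 + i)) m = t\<^sup>2 * ?w"
    by (rule diff_count_pairs[OF _ m]) (rule potential_left_pair[OF t])
  have b4: "diff_count [1] (\<lambda>i. potential t (3 * t\<^sup>2 - 1 + i)) m = (if m = 0 then 1 else 0)"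
    by (simp add: diff_count_def)
  have b5: "diff_count (replicate (t\<^sup>2) 2) (\<lambda>i. potential t (3 * t\<^sup>2 + i)) m = t\<^sup>2 * ?w"
    by (rule diff_count_pairs[OF _ m]) (rule potential_right_pair[OF t])
  have b6: "int (diff_count [t\<^sup>2] (\<lambda>i. potential t (5 * t\<^sup>2 + i)) m) = core_corr t m"
  proof -
    have "int (diff_count [t\<^sup>2] (\<lambda>i. potential t (5 * t\<^sup>2 + i)) m) =
        core_sum t (\<lambda>u. core_sum t (\<lambda>v. if u + 1 - (v + 1) = m then 1 else 0))"
      by (rule diff_count_functional[where G = "\<lambda>f. core_sum t (\<lambda>u. f (u + 1))"]) (rule last_block_distribution[OF t1])
    also have "\<dots> = core_corr t m"
      unfolding core_sum_weighted[OF t1] core_corr_def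
      using weighted_sum_correlation[of "2 * t - 1" "tent t" m] tent_outside[OF t1] by simp
    finally show ?thesis .
  qed
  have shift: "t\<^sup>2 - 1 + (2 * t\<^sup>2 + i) = 3 * t\<^sup>2 - 1 + i" "3 * t\<^sup>2 - 1 + (1 + i) = 3 * t\<^sup>2 + i"
    "3 * t\<^sup>2 + (2 * t\<^sup>2 + i) = 5 * t\<^sup>2 + i" for i
    using tt(2) by auto
  have s: "sum_list [t * (t - 1), t - 1] = t\<^sup>2 - 1" "sum_list [1 :: nat] = 1" "sum_list [t * (t - 1)] = t * (t - 1)"
    using tt by auto
  have b12: "diff_count [t * (t - 1), t - 1] (potential t) m =
      diff_count [t * (t - 1)] (potential t) m + diff_count [t - 1] (\<lambda>i. potential t (t * (t - 1) + i)) m"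
    using diff_count_append[of "[t * (t - 1)]" "[t - 1]"] by simp
  have "diff_count ([t * (t - 1), t - 1] @ replicate (t\<^sup>2) 2 @ [1] @ replicate (t\<^sup>2) 2 @ [t\<^sup>2]) (potential t) m =
      (diff_count [t * (t - 1)] (potential t) m + diff_count [t - 1] (\<lambda>i. potential t (t * (t - 1) + i)) m)
      + (t\<^sup>2 * ?w + ((if m = 0 then 1 else 0) + (t\<^sup>2 * ?w + diff_count [t\<^sup>2] (\<lambda>i. potential t (5 * t\<^sup>2 + i)) m)))"
    unfolding diff_count_append s sum_list_pairs shift b3 b4 b5 b12 ..
  then show ?thesis
    using b1 b2 b6 by (simp add: algebra_simps)
qed

section \<open>Closed form of the multiplicities\<close>

locale family =
  fixes L t :: nat
  assumes t_eq: "t = L + 5" and L: "L \<ge> 1"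

sublocale family \<subseteq> graded_seaweed "[family_size L]" "family_composition L" "family_size L" "potential t"
  unfolding t_eq by (rule graded_family)

context family begin

definition ooms_mult :: "nat \<Rightarrow> int" where
  "ooms_mult m = int (L.principal_mult F\<^sub>0 (int m))"

definition pair_count :: "nat \<Rightarrow> int" where
  "pair_count m = int (diff_count [family_size L] (potential t) (int m))
     + int (diff_count (family_composition L) (potential t) (int m))"

lemma ooms_mult_recurrence: "ooms_mult m + ooms_mult (Suc m) + (if m = 0 then 2 else 0) = pair_count m"
  using principal_mult_recurrence[of "int m"] by (simp add: ooms_mult_def pair_count_def add.commute)

lemma ooms_mult_start: "ooms_mult 1 = ooms_mult 0"
  using L.principal_mult_symmetric[OF frobenius_F\<^sub>0, of 0] semisimple_integral_F\<^sub>0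
  by (simp add: ooms_mult_def L.semisimple_integral_grading_def)

text \<open>
  Six times the autocorrelation of the core, as a polynomial (\<open>core_corr_poly\<close>).
\<close>

definition core_poly :: "int \<Rightarrow> int" where
  "core_poly m = 4 * int t ^ 3 - 6 * int t * m ^ 2 + 3 * m ^ 3 + 2 * int t - 3 * m"

lemma core_corr_poly: "m < t \<Longrightarrow> 6 * core_corr t (int m) = core_poly (int m)"
  unfolding core_corr_def core_poly_def by (rule tent_correlation)

text \<open>
  The bound on \<open>m\<close> keeps the arguments of \<^const>\<open>tent\<close>, which go up to \<open>m + 2\<close>, on its increasing side.
  The case distinctions come from pairs of values close to zero, which end at \<open>m = 2\<close>, and from the
  symmetry of the autocorrelation, which replaces its argument \<open>-1\<close> by \<open>1\<close>.
\<close>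

lemma pair_count_poly:
  assumes m: "m + 3 \<le> t"
  shows "6 * pair_count m = 4 * core_poly (int m) + core_poly (int (m + 1))
      + (if m = 0 then core_poly 1 else core_poly (int m - 1))
      + 6 * int t ^ 2 * ((8 * int m + 12)
         + (if m = 0 then 12 else if m = 1 then 5 else if m = 2 then 1 else 0)
         + (if m = 0 then 4 else if m = 1 then 2 else 0))
      + 6 * int t ^ 4 * (if m = 0 then 6 else if m = 1 then 4 else if m = 2 then 1 else 0)
      - 6 * int t ^ 2 + 3 * int m * (int m + 1) + 6 * (int t - 1 - int m) + (if m = 0 then 6 else 0)"
proof -
  have t: "t \<ge> 1" "t \<ge> 2" using m by auto
  have n: "family_size L = 6 * t\<^sup>2" by (simp add: family_size_def Let_def t_eq)
  have B: "family_composition L = [t * (t - 1), t - 1] @ replicate (t\<^sup>2) 2 @ [1] @ replicate (t\<^sup>2) 2 @ [t\<^sup>2]"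
    by (simp add: family_composition_def Let_def t_eq)
  have tri_up: "tent t x = x + 1" if "- 1 \<le> x" "x \<le> int t - 1" for x
    using that by (auto simp: tent_def)
  have tri_neg: "tent t x = 0" if "x \<le> - 1" for x using that by (simp add: tent_def)
  have c1: "6 * core_corr t (int m + 1) = core_poly (int (m + 1))"
    using core_corr_poly[of "m + 1"] m by (simp add: add.commute)
  have c0: "6 * core_corr t (int m - 1) = (if m = 0 then core_poly 1 else core_poly (int m - 1))"
  proof (cases "m = 0")
    case True
    then show ?thesis using core_corr_symmetric[OF t(1), of 1] core_corr_poly[of 1] m by simp
  next
    case False
    then have "int m - 1 = int (m - 1)" by simp
    then show ?thesis using core_corr_poly[of "m - 1"] m False by simp
  qed
  have tz: "6 * correlation (2 * t - 1) (trapezoid t) (int m) = core_poly (int m) - 6 * int t ^ 2 + 3 * int m * (int m + 1)"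
    using trapezoid_correlation[of m t] m by (simp add: core_poly_def)
  have pl: "correlation (2 * t - 1) (plateau t) (int m) = int t - 1 - int m"
    using plateau_correlation[of m t] m by simp
  have up: "tent t (int m - 1) + 3 * tent t (int m) + 3 * tent t (int m + 1) + tent t (int m + 2) = 8 * int m + 12"
    using m by (simp add: tri_up)
  have down: "3 * tent t (1 - int m) + 3 * tent t (- int m) + tent t (- 1 - int m) + tent t (2 - int m)
      = (if m = 0 then 12 else if m = 1 then 5 else if m = 2 then 1 else 0)"
  proof -
    consider "m = 0" | "m = 1" | "m = 2" | "m \<ge> 3" by linarith
    then show ?thesis using m by cases (simp_all add: tri_up tri_neg)
  qed
  have A: "int (diff_count [family_size L] (potential t) (int m)) =
     2 * core_corr t (int m) + core_corr t (int m + 1) + core_corr t (int m - 1)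
     + int (t\<^sup>2) * ((if m = 0 then 12 else if m = 1 then 5 else if m = 2 then 1 else 0) + (8 * int m + 12))
     + int (t\<^sup>2) * int (t\<^sup>2) * (if m = 0 then 6 else if m = 1 then 4 else if m = 2 then 1 else 0)"
  proof -
    have s: "3 * tent t (1 - int m) + 3 * tent t (- int m) + tent t (- 1 - int m) + tent t (2 - int m)
         + tent t (int m - 1) + 3 * tent t (int m) + 3 * tent t (int m + 1) + tent t (int m + 2)
         = (if m = 0 then 12 else if m = 1 then 5 else if m = 2 then 1 else 0) + (8 * int m + 12)"
      using up down by linarith
    show ?thesis unfolding n full_count[OF t(1)] s by simp
  qed
  have Bc: "int (diff_count (family_composition L) (potential t) (int m)) =
     correlation (2 * t - 1) (trapezoid t) (int m) + (int t - 1 - int m) + core_corr t (int m)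
     + int (t\<^sup>2) * (if m = 0 then 4 else if m = 1 then 2 else 0) + (if m = 0 then 1 else 0)"
    unfolding B using block_count[OF t(2), of "int m"] pl by simp
  have sq: "int (t\<^sup>2) * int (t\<^sup>2) = int t ^ 4" "int (t\<^sup>2) = int t ^ 2"
    by (simp_all add: power2_eq_square power4_eq_xxxx)
  show ?thesis
    unfolding pair_count_def A Bc sq
    using core_corr_poly[of m] c1 c0 tz m
    by (simp add: algebra_simps)
qed

text \<open>
  Six times \<open>h\<^sub>m\<close> for \<open>3 \<le> m \<le> t - 2\<close>. The first summand stems from the positions below the diagonal
  within the two copies of the core, the second from those between the copies, the third from those
  between the runs and the copies. The rest is six times the multiplicity of degree \<open>m\<close> of the core
  seaweed with compositions \<open>[t\<^sup>2]\<close> and \<open>[t (t - 1), t - 1, 1]\<close>.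
\<close>

definition ooms_poly :: "int \<Rightarrow> int" where
  "ooms_poly m = core_poly m + core_poly (m - 1) + 24 * int t ^ 2 * (m + 1)
     + 4 * int t ^ 3 - 3 * int t ^ 2 + 5 * int t - 6
     - 6 * (2 * int t - 1) * (m - 1) - 3 * (2 * int t - 5) * (m - 1) * (m - 2) + 3 * (m - 1) * (m - 2) * (m - 3)"

text \<open>
  The recurrence and \<open>h\<^sub>0 = h\<^sub>1\<close> determine \<open>h\<^sub>1\<close>, \<open>h\<^sub>2\<close>, \<open>h\<^sub>3\<close> and then all further multiplicities; from \<open>m = 3\<close> on
  the pair counts are polynomial, and the closed form satisfies the same recurrence.
\<close>

lemma ooms_mult_poly:
  assumes "3 \<le> m" "m + 2 \<le> t" shows "6 * ooms_mult m = ooms_poly (int m)"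
  using assms
proof (induction m rule: nat_induct_at_least)
  case base
  have t6: "6 \<le> t" using t_eq L by simp
  have "2 * ooms_mult 1 = pair_count 0 - 2" "ooms_mult 2 = pair_count 1 - ooms_mult 1"
    "ooms_mult 3 = pair_count 2 - ooms_mult 2"
    using ooms_mult_recurrence[of 0] ooms_mult_recurrence[of 1] ooms_mult_recurrence[of 2] ooms_mult_start
    by (simp_all add: numeral_2_eq_2 numeral_3_eq_3)
  then have "6 * ooms_mult 3 = 6 * pair_count 2 - 6 * pair_count 1 + 3 * pair_count 0 - 6" by linarith
  then have "2 * (6 * ooms_mult 3) = 2 * (6 * pair_count 2) - 2 * (6 * pair_count 1) + 6 * pair_count 0 - 12" by linarith
  also have "\<dots> = 2 * ooms_poly 3"
    using base t6
    by (subst (1 2 3) pair_count_poly)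
      (simp_all add: ooms_poly_def core_poly_def algebra_simps power2_eq_square power3_eq_cube)
  finally show ?case by simp
next
  case (Suc m)
  have "6 * ooms_mult (Suc m) = 6 * pair_count m - 6 * ooms_mult m"
    using ooms_mult_recurrence[of m] Suc.hyps by simp
  also have "\<dots> = 6 * pair_count m - ooms_poly (int m)" using Suc by simp
  also have "\<dots> = ooms_poly (int (Suc m))"
    using Suc.hyps Suc.prems
    by (subst pair_count_poly)
      (simp_all add: ooms_poly_def core_poly_def algebra_simps power2_eq_square power3_eq_cube)
  finally show ?case .
qed

lemma ooms_mult_gap: "2 * (ooms_mult (t - 2) - ooms_mult 3) = int L * (5 * int L ^ 2 + 43 * int L + 106)"
proof -
  have i: "int (t - 2) = int L + 3" "int t = int L + 5" using t_eq by auto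
  have "6 * ooms_mult (t - 2) = ooms_poly (int (t - 2))" "6 * ooms_mult 3 = ooms_poly (int 3)"
    by (rule ooms_mult_poly; use t_eq L in simp)+
  then have "6 * ooms_mult (t - 2) - 6 * ooms_mult 3 = ooms_poly (int L + 3) - ooms_poly 3"
    unfolding i by simp
  also have "\<dots> = 3 * (int L * (5 * int L ^ 2 + 43 * int L + 106))"
    unfolding ooms_poly_def core_poly_def i by (simp add: algebra_simps power2_eq_square power3_eq_cube)
  finally show ?thesis by simp
qed

end

section \<open>The defect of the family\<close>

context fin_dim_lie_algebra begin

text \<open>
  A rise from \<open>a\<close> to \<open>b\<close> is a sum of consecutive increments, each bounded by its positive part.
\<close>

lemma sl2_defect_ge_rise:
  assumes F: "frobenius_functional F" and grading: "semisimple_integral_grading F" and ab: "1 \<le> a" "a \<le> b"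
  shows "int (principal_mult F (int b)) - int (principal_mult F (int a)) \<le> sl2_defect F"
proof -
  obtain M\<^sub>0 where M\<^sub>0: "\<And>j. int M\<^sub>0 < \<bar>j\<bar> \<Longrightarrow> principal_mult F j = 0" "M\<^sub>0 \<ge> 1"
    using principal_mult_bounded[OF F] by blast
  define M where "M = max M\<^sub>0 b"
  have M: "\<And>j. int M < \<bar>j\<bar> \<Longrightarrow> principal_mult F j = 0" "M \<ge> 1"
    using M\<^sub>0 by (auto simp: M_def)
  let ?d = "\<lambda>m. ooms F (m + 1) - ooms F m"
  have "ooms F b - ooms F a = (\<Sum>m\<in>{a..<b}. ooms F (Suc m) - ooms F m)"
    by (rule sum_Suc_diff'[OF ab(2), symmetric])
  also have "\<dots> \<le> (\<Sum>m\<in>{a..<b}. max 0 (?d m))"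
    by (intro sum_mono) auto
  also have "\<dots> \<le> (\<Sum>m=1..M. max 0 (?d m))"
    using ab by (intro sum_mono2) (auto simp: M_def)
  also have "\<dots> = sl2_defect F"
    using sl2_defect_sum[OF F grading M] by simp
  finally show ?thesis using ooms_def[OF F grading M] by simp
qed

end

context family begin

lemma spectrum:
  assumes "L.frobenius_functional F"
  shows "L.semisimple_integral_grading F" "L.principal_mult F = L.principal_mult F\<^sub>0"
  using L.principal_spectrum_unique[OF frobenius_F\<^sub>0 assms semisimple_integral_F\<^sub>0] .

lemma defect_bound:
  assumes F: "L.frobenius_functional F"
  shows "real L * (5 * real L ^ 2 + 43 * real L + 106) / 2 \<le> real_of_int (L.sl2_defect F)"
proof -
  have "ooms_mult (t - 2) - ooms_mult 3 \<le> L.sl2_defect F"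
    using L.sl2_defect_ge_rise[OF F spectrum(1)[OF F], of 3 "t - 2"] t_eq L
    by (simp add: ooms_mult_def spectrum(2)[OF F])
  then have "int L * (5 * int L ^ 2 + 43 * int L + 106) \<le> 2 * L.sl2_defect F"
    unfolding ooms_mult_gap[symmetric] by simp
  then have "real_of_int (int L * (5 * int L ^ 2 + 43 * int L + 106)) \<le> real_of_int (2 * L.sl2_defect F)"
    by (simp only: of_int_le_iff)
  then show ?thesis by simp
qed

end

lemma composition_family: "composition (family_size L) [family_size L]" "composition (family_size L) (family_composition L)"
proof -
  show "composition (family_size L) [family_size L]"
    by (simp add: composition_def family_size_def Let_def)
  have "sum_list (family_composition L) = family_size L" using rigid_family[of L] by (simp add: rigid_def)
  then show "composition (family_size L) (family_composition L)"
    by (auto simp: composition_def family_composition_def Let_def)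
qed

lemma cubic_growth:
  assumes "\<And>L. L \<ge> 1 \<Longrightarrow> real L * (5 * real L ^ 2 + 43 * real L + 106) / 2 \<le> real_of_int (D L)"
  shows "\<not> bdd_above (D ` {1..})" "(\<lambda>L. real_of_int (D L)) \<in> \<Omega>(\<lambda>L. real L ^ 3)"
proof -
  have cube: "real L ^ 3 \<le> real_of_int (D L)" if "L \<ge> 1" for L
  proof -
    have "2 * real L ^ 3 \<le> real L * (5 * real L ^ 2 + 43 * real L + 106)"
      by (simp add: algebra_simps power2_eq_square power3_eq_cube)
    then show ?thesis using assms[OF that] by simp
  qed
  show "\<not> bdd_above (D ` {1..})"
  proof
    assume "bdd_above (D ` {1..})"
    then obtain b where b: "\<And>L. L \<ge> 1 \<Longrightarrow> D L \<le> b" by (auto simp: bdd_above_def)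
    define L where "L = nat \<bar>b\<bar> + 1"
    have "real L \<le> real L ^ 3" using self_le_power[of "real L" 3] by (simp add: L_def)
    also have "\<dots> \<le> real_of_int (D L)" by (rule cube) (simp add: L_def)
    also have "\<dots> \<le> real_of_int b" using b[of L] by (simp add: L_def)
    finally show False by (simp add: L_def)
  qed
  show "(\<lambda>L. real_of_int (D L)) \<in> \<Omega>(\<lambda>L. real L ^ 3)"
  proof (rule landau_omega.bigI[of 1])
    show "\<forall>\<^sub>F L in sequentially. 1 * norm (real L ^ 3) \<le> norm (real_of_int (D L))"
      using eventually_ge_at_top[of 1]
    proof eventually_elim
      case (elim L)
      have "0 \<le> real L ^ 3" by simp
      then show ?case using cube[OF elim] by simp
    qed
  qed simp
qed

theorem corollary5p2:
  shows "(\<forall>(scale :: complex \<Rightarrow> 'a::ab_group_add \<Rightarrow> 'a) bracket \<gg> F.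
            fin_dim_lie_algebra scale bracket \<gg> \<and>
            fin_dim_lie_algebra.frobenius_functional scale bracket \<gg> F \<and>
            fin_dim_lie_algebra.semisimple_integral_grading scale bracket \<gg> F \<longrightarrow>
            (let h = (\<lambda>m. int (fin_dim_lie_algebra.principal_mult scale bracket \<gg> F m));
                 \<Theta> = fin_dim_lie_algebra.centered_principal_char scale bracket \<gg> F;
                 Def = fin_dim_lie_algebra.sl2_defect scale bracket \<gg> F
             in \<Theta> = Sum_any (\<lambda>m::nat. if m \<ge> 1
                      then of_int (h (int m) - h (int m + 1)) * sym_char (2 * m - 1) else 0) \<and>
                Def = negative_mass \<Theta> \<and>
                (Def = 0 \<longleftrightarrow> fin_dim_lie_algebra.unimodal scale bracket \<gg> F)))
       \<and>
         (\<forall>L::nat. L \<ge> 1 \<longrightarrow>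
            (let n = family_size L; A = [n]; B = family_composition L
             in composition n A \<and> composition n B \<and>
                seaweed_lie_algebra n A B \<and>
                seaweed_frobenius n A B \<and>
                (\<forall>F F'. seaweed_frobenius_functional n A B F \<and> seaweed_frobenius_functional n A B F' \<longrightarrow>
                   seaweed_principal_mult n A B F = seaweed_principal_mult n A B F') \<and>
                (\<forall>F. seaweed_frobenius_functional n A B F \<longrightarrow>
                   seaweed_semisimple_integral_grading n A B F \<and>
                   real_of_int (seaweed_sl2_defect n A B F)
                     \<ge> real L * (5 * real L ^ 2 + 43 * real L + 106) / 2)))
       \<and>
         (\<forall>\<Phi>. (\<forall>L\<ge>1. seaweed_frobenius_functional
                    (family_size L) [family_size L] (family_composition L) (\<Phi> L)) \<longrightarrow>
            (let Def = (\<lambda>L. seaweed_sl2_defect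
                    (family_size L) [family_size L] (family_composition L) (\<Phi> L))
             in \<not> bdd_above (Def ` {1..}) \<and>
                (\<lambda>L. real_of_int (Def L)) \<in> \<Omega>(\<lambda>L. real L ^ 3)))"
proof (intro conjI allI impI)
  fix scale :: "complex \<Rightarrow> 'a \<Rightarrow> 'a" and bracket \<gg> F
  assume a: "fin_dim_lie_algebra scale bracket \<gg> \<and>
            fin_dim_lie_algebra.frobenius_functional scale bracket \<gg> F \<and>
            fin_dim_lie_algebra.semisimple_integral_grading scale bracket \<gg> F"
  interpret fin_dim_lie_algebra scale bracket \<gg> using a by blast
  have F: "frobenius_functional F" and grading: "semisimple_integral_grading F" using a by blast+
  obtain M where M: "\<And>j. int M < \<bar>j\<bar> \<Longrightarrow> principal_mult F j = 0" "M \<ge> 1"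
    using principal_mult_bounded[OF F] by blast
  have \<Theta>: "centered_principal_char F = Sum_any (\<lambda>m::nat. if m \<ge> 1
      then of_int (int (principal_mult F (int m)) - int (principal_mult F (int m + 1))) * sym_char (2 * m - 1) else 0)"
  proof -
    have ooms: "ooms F m = int (principal_mult F (int m))" for m by (rule ooms_def[OF F grading M])
    show ?thesis
      using centered_principal_char_expand[OF F grading M] unfolding ooms by (simp add: add.commute cong: if_cong)
  qed
  show "let h = (\<lambda>m. int (principal_mult F m)); \<Theta> = centered_principal_char F; Def = sl2_defect F
     in \<Theta> = Sum_any (\<lambda>m::nat. if m \<ge> 1
              then of_int (h (int m) - h (int m + 1)) * sym_char (2 * m - 1) else 0) \<and>
        Def = negative_mass \<Theta> \<and> (Def = 0 \<longleftrightarrow> unimodal F)"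
    unfolding Let_def
    using \<Theta> sl2_defect_negative_mass[OF F grading M] sl2_defect_eq_0_iff[OF F grading M] by blast
next
  fix L :: nat assume L: "L \<ge> 1"
  interpret fam: family L "L + 5" using L by unfold_locales auto
  have frob: "seaweed_frobenius (family_size L) [family_size L] (family_composition L)"
    unfolding fam.L.frobenius_def using fam.frobenius_F\<^sub>0 by blast
  have alg: "seaweed_lie_algebra (family_size L) [family_size L] (family_composition L)"
    by (rule fam.L.fin_dim_lie_algebra_axioms)
  show "let n = family_size L; A = [n]; B = family_composition L
     in composition n A \<and> composition n B \<and> seaweed_lie_algebra n A B \<and> seaweed_frobenius n A B \<and>
        (\<forall>F F'. seaweed_frobenius_functional n A B F \<and> seaweed_frobenius_functional n A B F' \<longrightarrow>
           seaweed_principal_mult n A B F = seaweed_principal_mult n A B F') \<and>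
        (\<forall>F. seaweed_frobenius_functional n A B F \<longrightarrow>
           seaweed_semisimple_integral_grading n A B F \<and>
           real_of_int (seaweed_sl2_defect n A B F) \<ge> real L * (5 * real L ^ 2 + 43 * real L + 106) / 2)"
    unfolding Let_def
    using composition_family alg frob fam.spectrum fam.defect_bound by auto
next
  fix \<Phi>
  assume \<Phi>: "\<forall>L\<ge>1. seaweed_frobenius_functional (family_size L) [family_size L] (family_composition L) (\<Phi> L)"
  let ?D = "\<lambda>L. seaweed_sl2_defect (family_size L) [family_size L] (family_composition L) (\<Phi> L)"
  have bound: "real L * (5 * real L ^ 2 + 43 * real L + 106) / 2 \<le> real_of_int (?D L)" if L: "L \<ge> 1" for L
  proof -
    interpret fam: family L "L + 5" using L by unfold_locales auto
    show ?thesis using fam.defect_bound \<Phi> L by blast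
  qed
  show "let Def = ?D in \<not> bdd_above (Def ` {1..}) \<and> (\<lambda>L. real_of_int (Def L)) \<in> \<Omega>(\<lambda>L. real L ^ 3)"
    unfolding Let_def using cubic_growth[of ?D] bound by simp
qed

end
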